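(* Let $X=X(\mathbb T)$ be a Banach lattice on $\mathbb T$ satisfying Assumption A, and let $r,s\in\mathbb N$. Let $K_{n,r}$, $n\in\mathbb N$, be the Kantorovich-type operators described in the context, and suppose that there exist constants $C_1,C_2,C_3>0$ such that $$\|K_{n,r}f\|_X\le C_1\|f\|_X\quad\text{for all } f\in X,\ n\in\mathbb N,$$ $$\|T-K_{n,r}T\|_X\le C_2\,n^{-s}\|T^{(s)}\|_X\quad\text{for all } T\in\mathcal T_n,\ n\in\mathbb N,$$ $$C_3\,n^{-s}\|\varphi^{(s)}\|_X\le\|\varphi-K_{n,r}\varphi\|_X\quad\text{for all } \varphi\in\Phi_n,\ n\in\mathbb N.$$ Then for all $f\in X$ and all $n\in\mathbb N$ $$\|f-K_{n,r}f\|_X\asymp\|(I-\dot A_{\gamma/n})^s f\|_X,$$ where $\asymp$ denotes a two-sided inequality with positive constants independent of $f$ and $n$.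
   Context: **Banach lattice.** $\mathbb T$ is the unit circle, identified with $[-\pi,\pi)$ (functions are $2\pi$-periodic), and $\mu$ is the normalized Lebesgue measure on $\mathbb T$. A Banach lattice $X$ on $\mathbb T$ is a Banach space of measurable functions on $\mathbb T$ with norm $\|\cdot\|_X$ such that: (1) if $f$ is measurable, $g\in X$ and $|f|\le|g|$, then $f\in X$ and $\|f\|_X\le\|g\|_X$; (2) if $f_n\in X$, $\sup_n\|f_n\|_X<\infty$ and $0\le f_n\uparrow f$, then $f\in X$ and $\|f_n\|_X\to\|f\|_X$; (3) if $E\subset\mathbb T$ is measurable with $\mu(E)<\infty$, then $\chi_E\in X$ and there is $c_E>0$ with $\int_E|f|\,d\mu\le c_E\|f\|_X$ for all $f\in X$. **Steklov averages.** For locally integrable $f$ and $h>0$: $A_hf(x)=\frac1h\int_{x-h/2}^{x+h/2}f(t)\,dt$, $\dot A_hf(x)=A_hf(x+h/2)=\frac1h\int_x^{x+h}f(t)\,dt$, and $A_{h,r}f=\sum_{k=1}^r(-1)^{k+1}\binom rk A_h^kf=f-(I-A_h)^rf$. **Assumption A.** For all $f\in X$ and $h>0$, $A_hf\in X$, and $\sup_{h>0}\sup_{\|f\|_X\le1}\|A_hf\|_X<\infty$. **Spaces $\Phi_n$.** $\mathcal T_n$ is the set of trigonometric polynomials of degree at most $n$. $(\Phi_n)_n$ is a nested family of linear subspaces of $X$ ($\Phi_m\subset\Phi_n$ for $m\le n$, $\Phi_0=\{0\}$) satisfying the Bernstein inequality: there is $B>0$ depending only on $X$ with $\|\varphi^{(k)}\|_X\le(Bn)^k\|\varphi\|_X$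 for all $k\in\mathbb N$, $\varphi\in\Phi_n$ (in particular the derivatives exist and lie in $X$). **Operators.** For each $n\in\mathbb N$, $\varphi_{k,n}\in\Phi_n$, $k=1,\dots,m_n$, are $2\pi$-periodic functions and $(x_{k,n})_{k=1}^{m_n}\subset\mathbb T$ are points for which there are positive constants $\gamma,\gamma'$ (independent of $n,k$) with $\frac{\gamma}{n}\le x_{k+1,n}-x_{k,n}\le\frac{\gamma'}{n}$, $k=1,\dots,m_n$, where $x_{m_n+1,n}=2\pi+x_{1,n}$. Then $$K_{n,r}f(x)=\sum_{k=1}^{m_n}A_{\gamma/n,r}f(x_{k,n})\,\varphi_{k,n}(x).$$ *)

theory Defs
  imports "HOL-Analysis.Analysis"
begin

text \<open>
  Functions on the circle are represented by (complex-valued) \<open>2\<pi>\<close>-periodic functions on the real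
  line.  Elements of a function space are honest functions rather than classes modulo null sets,
  so a norm is a function \<open>N\<close> with \<open>N f = 0\<close> iff \<open>f = 0\<close> almost everywhere.
\<close>

text \<open>The underlying space of this probability measure is the whole line, but everything outside
  \<open>[-\<pi>, \<pi>)\<close> is null.\<close>

definition circle_measure :: "real measure" where
  "circle_measure = uniform_measure lebesgue {-pi..<pi}"

definition circle_functions :: "(real \<Rightarrow> complex) set" where
  "circle_functions = {f \<in> borel_measurable lebesgue. \<forall>x. f (x + 2 * pi) = f x}"

definition linear_subspace :: "(real \<Rightarrow> complex) set \<Rightarrow> bool" where
  "linear_subspace V \<longleftrightarrow>
     (\<lambda>x. 0) \<in> V \<and>
     (\<forall>f\<in>V. \<forall>g\<in>V. (\<lambda>x. f x + g x) \<in> V) \<and>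
     (\<forall>c. \<forall>f\<in>V. (\<lambda>x. c * f x) \<in> V)"

text \<open>
  In \<open>Fatou\<close> the limit function is finite-valued; this loses nothing, since \<open>integrable\<close> together
  with monotone convergence forces the limit of a norm-bounded increasing sequence to be finite
  almost everywhere.  \<open>integrable\<close> uses the nonnegative integral because the Bochner integral of a
  non-integrable function is \<open>0\<close>.  No finiteness condition on the measure of \<open>E\<close> is needed, the
  circle having measure \<open>1\<close>.
\<close>

locale banach_lattice_on_circle =
  fixes X :: "(real \<Rightarrow> complex) set"
    and N :: "(real \<Rightarrow> complex) \<Rightarrow> real"
  assumes measurable_periodic: "X \<subseteq> circle_functions"
    and subspace: "linear_subspace X"
    and norm_nonneg: "f \<in> X \<Longrightarrow> 0 \<le> N f"
    and norm_eq_zero_iff: "f \<in> X \<Longrightarrow> N f = 0 \<longleftrightarrow> (AE x in circle_measure. f x = 0)"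
    and norm_scale: "f \<in> X \<Longrightarrow> N (\<lambda>x. c * f x) = cmod c * N f"
    and norm_triangle: "f \<in> X \<Longrightarrow> g \<in> X \<Longrightarrow> N (\<lambda>x. f x + g x) \<le> N f + N g"
    and complete:
      "(\<And>n. F n \<in> X) \<Longrightarrow>
       (\<And>e. e > 0 \<Longrightarrow> \<exists>M. \<forall>i\<ge>M. \<forall>j\<ge>M. N (\<lambda>x. F i x - F j x) < e) \<Longrightarrow>
       \<exists>f\<in>X. (\<lambda>n. N (\<lambda>x. F n x - f x)) \<longlonglongrightarrow> 0"
    and ideal:
      "f \<in> circle_functions \<Longrightarrow> g \<in> X \<Longrightarrow>
       (AE x in circle_measure. cmod (f x) \<le> cmod (g x)) \<Longrightarrow> f \<in> X \<and> N f \<le> N g"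
    and Fatou:
      "(\<And>n. (\<lambda>x. complex_of_real (u n x)) \<in> X) \<Longrightarrow>
       bdd_above (range (\<lambda>n. N (\<lambda>x. complex_of_real (u n x)))) \<Longrightarrow>
       (\<lambda>x. complex_of_real (v x)) \<in> circle_functions \<Longrightarrow>
       (AE x in circle_measure. (\<forall>n. 0 \<le> u n x \<and> u n x \<le> u (Suc n) x) \<and>
          (\<lambda>n. u n x) \<longlonglongrightarrow> v x) \<Longrightarrow>
       (\<lambda>x. complex_of_real (v x)) \<in> X \<and>
       (\<lambda>n. N (\<lambda>x. complex_of_real (u n x))) \<longlonglongrightarrow> N (\<lambda>x. complex_of_real (v x))"
    and indicator:
      "indicator E \<in> circle_functions \<Longrightarrow> indicator E \<in> X"
    and integrable:
      "indicator E \<in> circle_functions \<Longrightarrow>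
       \<exists>c>0. \<forall>f\<in>X. (\<integral>\<^sup>+x\<in>E. ennreal (cmod (f x)) \<partial>circle_measure) \<le> ennreal (c * N f)"

text \<open>The integrals are over \<open>lebesgue\<close>, not \<open>lborel\<close>: the functions need not be Borel.\<close>

definition steklov :: "real \<Rightarrow> (real \<Rightarrow> complex) \<Rightarrow> real \<Rightarrow> complex" where
  "steklov h f = (\<lambda>x. (1 / h) *\<^sub>R (LINT t:{x - h/2..x + h/2}|lebesgue. f t))"

definition forward_steklov :: "real \<Rightarrow> (real \<Rightarrow> complex) \<Rightarrow> real \<Rightarrow> complex" where
  "forward_steklov h f = (\<lambda>x. steklov h f (x + h/2))"

definition iterated_steklov :: "real \<Rightarrow> nat \<Rightarrow> (real \<Rightarrow> complex) \<Rightarrow> real \<Rightarrow> complex" where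
  "iterated_steklov h r f =
     (\<lambda>x. \<Sum>k=1..r. (-1) ^ (k + 1) * of_nat (r choose k) * (steklov h ^^ k) f x)"

text \<open>The operator \<open>(I - D)\<^sup>s\<close> with \<open>D = forward_steklov h\<close>:\<close>

definition steklov_difference :: "real \<Rightarrow> nat \<Rightarrow> (real \<Rightarrow> complex) \<Rightarrow> real \<Rightarrow> complex" where
  "steklov_difference h s = (\<lambda>f x. f x - forward_steklov h f x) ^^ s"

definition assumption_A :: "(real \<Rightarrow> complex) set \<Rightarrow> ((real \<Rightarrow> complex) \<Rightarrow> real) \<Rightarrow> bool" where
  "assumption_A X N \<longleftrightarrow>
     (\<forall>f\<in>X. \<forall>h>0. steklov h f \<in> X) \<and>
     (\<exists>C. \<forall>h>0. \<forall>f\<in>X. N f \<le> 1 \<longrightarrow> N (steklov h f) \<le> C)"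

definition trig_polys :: "nat \<Rightarrow> (real \<Rightarrow> complex) set" where
  "trig_polys n = {T. \<exists>c :: int \<Rightarrow> complex. T = (\<lambda>x. \<Sum>k=-int n..int n. c k * cis (of_int k * x))}"

definition nth_derivative :: "nat \<Rightarrow> (real \<Rightarrow> complex) \<Rightarrow> real \<Rightarrow> complex" where
  "nth_derivative k = (\<lambda>f x. vector_derivative f (at x)) ^^ k"

definition bernstein_family ::
    "(real \<Rightarrow> complex) set \<Rightarrow> ((real \<Rightarrow> complex) \<Rightarrow> real) \<Rightarrow> (nat \<Rightarrow> (real \<Rightarrow> complex) set) \<Rightarrow> bool" where
  "bernstein_family X N \<Phi> \<longleftrightarrow>
     (\<forall>n. \<Phi> n \<subseteq> X \<and> linear_subspace (\<Phi> n)) \<and>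
     \<Phi> 0 = {\<lambda>x. 0} \<and>
     (\<forall>m n. m \<le> n \<longrightarrow> \<Phi> m \<subseteq> \<Phi> n) \<and>
     (\<forall>n. \<forall>\<phi>\<in>\<Phi> n. \<forall>k. (\<forall>x. nth_derivative k \<phi> differentiable at x) \<and> nth_derivative k \<phi> \<in> X) \<and>
     (\<exists>B>0. \<forall>n. \<forall>\<phi>\<in>\<Phi> n. \<forall>k. N (nth_derivative k \<phi>) \<le> (B * real n) ^ k * N \<phi>)"

text \<open>The argument \<open>x n k\<close> is the \<open>k\<close>-th node (\<open>1 \<le> k \<le> m n\<close>) of the \<open>n\<close>-th system; the node with
  index \<open>m n + 1\<close> is the first one shifted by a full period.\<close>

definition node_system ::
    "real \<Rightarrow> real \<Rightarrow> (nat \<Rightarrow> nat) \<Rightarrow> (nat \<Rightarrow> nat \<Rightarrow> real) \<Rightarrow> bool" where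
  "node_system \<gamma> \<gamma>' m x \<longleftrightarrow>
     (\<forall>n\<ge>1. (\<forall>k\<in>{1..m n}. x n k \<in> {-pi..<pi}) \<and>
        x n (m n + 1) = 2 * pi + x n 1 \<and>
        (\<forall>k\<in>{1..m n}. \<gamma> / real n \<le> x n (k + 1) - x n k \<and> x n (k + 1) - x n k \<le> \<gamma>' / real n))"

definition kantorovich ::
    "real \<Rightarrow> (nat \<Rightarrow> nat) \<Rightarrow> (nat \<Rightarrow> nat \<Rightarrow> real) \<Rightarrow> (nat \<Rightarrow> nat \<Rightarrow> real \<Rightarrow> complex) \<Rightarrow>
     nat \<Rightarrow> nat \<Rightarrow> (real \<Rightarrow> complex) \<Rightarrow> real \<Rightarrow> complex" where
  "kantorovich \<gamma> m x \<phi> n r f =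
     (\<lambda>t. \<Sum>k=1..m n. iterated_steklov (\<gamma> / real n) r f (x n k) * \<phi> n k t)"

end

theory Submission
  imports Defs
begin

text \<open>
  Write \<open>h = \<gamma> / n\<close>, \<open>\<Delta> = I - \<dot>A\<^sub>h\<close> and \<open>K\<close> for the Kantorovich operator.

  The lower estimate is soft.  Split \<open>\<Delta>\<^sup>s f = \<Delta>\<^sup>s (f - K f) + \<Delta>\<^sup>s K f\<close>.  The first term is bounded by
  \<open>\<parallel>f - K f\<parallel>\<close> because averages are bounded on \<open>X\<close>.  For the second, \<open>\<Delta>\<close> commutes with differentiation
  and \<open>\<bar>\<Delta> g\<bar> \<le> h\<close> times an average of \<open>\<bar>g'\<bar>\<close>, so \<open>\<parallel>\<Delta>\<^sup>s \<phi>\<parallel> \<lesssim> n\<^bsup>-s\<^esup> \<parallel>\<phi>\<^sup>(\<^sup>s\<^sup>)\<parallel>\<close> for \<open>\<phi> = K f\<close>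
  (\<open>N_defect_power_le_derivative\<close>).  The third hypothesis on \<open>K\<close> turns this into
  \<open>\<parallel>K f - K K f\<parallel> = \<parallel>K (f - K f)\<parallel> \<lesssim> \<parallel>f - K f\<parallel>\<close>.

  The upper estimate needs a trigonometric polynomial \<open>T\<close> of degree \<open>n\<close> that realizes \<open>\<Delta>\<^sup>s f\<close>:
  \<open>\<parallel>f - T\<parallel> + n\<^bsup>-s\<^esup> \<parallel>T\<^sup>(\<^sup>s\<^sup>)\<parallel> \<lesssim> \<parallel>\<Delta>\<^sup>s f\<parallel>\<close> (\<open>realization\<close>).  Given \<open>T\<close>, one compares \<open>f\<close>, \<open>T\<close>, \<open>K T\<close> and \<open>K f\<close>
  by the first two hypotheses on \<open>K\<close>.

  Since \<open>X\<close> need not be translation invariant, the only bounded operators at hand are averages.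
  Every Fourier multiplier used below is therefore bounded through its kernel: if the symbol
  \<open>p\<close> satisfies \<open>p(k) = O((1 + (k/n)\<^sup>2)\<^bsup>-1\<^esup>)\<close> and its second difference is smaller by a further
  factor \<open>n\<^bsup>-2\<^esup>\<close>, then two summations by parts give a kernel of size \<open>n / (1 + n\<^sup>2 z\<^sup>2)\<close>
  (\<open>decaying_symbol_kernel\<close>), and such a kernel is dominated by a convergent dyadic
  combination of Steklov averages of \<open>\<bar>f\<bar>\<close> (\<open>fourier_multiplier_pointwise\<close>).  The symbols come from
  sequences whose first and second differences are \<open>O(1/n)\<close> and \<open>O(1/n\<^sup>2)\<close>; these form an algebra that
  is closed under inversion of elements bounded away from \<open>0\<close> (\<open>slowly_varying_inverse\<close>).

  On \<open>e\<^bsup>ikx\<^esup>\<close> the operator \<open>\<Delta>\<close> acts as \<open>1 - a(hk)\<close> with \<open>a(t) = \<integral>\<^sub>0\<^sup>1 e\<^bsup>itu\<^esup> du\<close>, which vanishes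
  only at \<open>k = 0\<close>, and there to first order.  Let \<open>V\<close> be the low-pass filter with a smooth symbol supported in \<open>\<bar>k\<bar> \<le> n\<close>.
  Then \<open>T = f - (I - V)\<^sup>s f\<close> works.  For \<open>T\<^sup>(\<^sup>s\<^sup>)\<close>, the quotient of \<open>(ik/n)\<^sup>s\<close> by \<open>(1 - a)\<^sup>s\<close> is smooth
  on the support of \<open>V\<close>.  For \<open>f - T\<close>, it suffices to treat \<open>s = 1\<close> and iterate, because \<open>V\<close> and \<open>\<Delta>\<close> commute.
  With \<open>g = \<Delta> f\<close> one has \<open>f = g + \<dot>A\<^sub>h g + \<dot>A\<^sub>h\<^sup>2 f\<close>, and on the high frequencies
  \<open>\<dot>A\<^sub>h\<^sup>2 f\<close> is obtained from \<open>g\<close> by the symbol \<open>a\<^sup>2 / (1 - a)\<close>, which decays like \<open>k\<^bsup>-2\<^esup>\<close>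
  (\<open>low_pass_error\<close>).
\<close>

section \<open>Locally integrable functions and Steklov averages\<close>

definition locally_L1 :: "(real \<Rightarrow> 'b::euclidean_space) \<Rightarrow> bool" where
  "locally_L1 f \<longleftrightarrow> (\<forall>a b. f absolutely_integrable_on {a..b})"

abbreviation circle_periodic :: "(real \<Rightarrow> 'b) \<Rightarrow> bool" where
  "circle_periodic f \<equiv> (\<forall>x. f (x + 2 * pi) = f x)"

lemma locally_L1_integrable: "locally_L1 f \<Longrightarrow> f integrable_on {a..b}"
  using absolutely_integrable_on_def locally_L1_def by blast

lemma locally_L1_norm: "locally_L1 f \<Longrightarrow> locally_L1 (\<lambda>x. norm (f x))"
  using absolutely_integrable_norm unfolding locally_L1_def o_def by blast

text \<open>A continuous factor is bounded and measurable on each compact interval.\<close>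

lemma locally_L1_mult_continuous:
  fixes f :: "real \<Rightarrow> 'b::{euclidean_space,real_normed_algebra}"
  assumes "locally_L1 f" and "continuous_on UNIV g"
  shows "locally_L1 (\<lambda>x. g x * f x)"
  unfolding locally_L1_def
proof (intro allI)
  fix a b
  have c: "continuous_on {a..b} g" using assms(2) continuous_on_subset by blast
  show "(\<lambda>x. g x * f x) absolutely_integrable_on {a..b}"
  proof (rule absolutely_integrable_bounded_measurable_product[where h="(*)"])
    show "bilinear ((*) :: 'b \<Rightarrow> 'b \<Rightarrow> 'b)"
      by (simp add: bilinear_conv_bounded_bilinear bounded_bilinear_mult)
    show "g \<in> borel_measurable (lebesgue_on {a..b})"
      using c continuous_imp_measurable_on_sets_lebesgue by (metis lmeasurable_cbox cbox_interval fmeasurableD)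
    show "bounded (g ` {a..b})"
      using c compact_continuous_image compact_imp_bounded by blast
  qed (use assms(1) in \<open>auto simp: locally_L1_def\<close>)
qed

lemma locally_L1_continuous: "continuous_on UNIV g \<Longrightarrow> locally_L1 g"
  unfolding locally_L1_def
  by (meson absolutely_integrable_continuous_real continuous_on_subset top_greatest)

lemma locally_L1_diff: "locally_L1 f \<Longrightarrow> locally_L1 g \<Longrightarrow> locally_L1 (\<lambda>x. f x - g x)"
  by (simp add: locally_L1_def set_integral_diff)

lemma locally_L1_cmult: "locally_L1 f \<Longrightarrow> locally_L1 (\<lambda>x. c * f x :: complex)"
  by (simp add: locally_L1_def)

lemma absolutely_integrable_on_Icc_subset:
  fixes f :: "real \<Rightarrow> 'b::euclidean_space"
  assumes "f absolutely_integrable_on {a..b}" "a \<le> c" "d \<le> b"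
  shows "f absolutely_integrable_on {c..d}"
  by (rule absolutely_integrable_on_subinterval[OF assms(1)]) (use assms(2,3) in auto)

text \<open>Translations by multiples of the period cover the line, so integrability need only be known
  on one period.\<close>

lemma locally_L1_periodic:
  fixes f :: "real \<Rightarrow> complex"
  assumes per: "circle_periodic f" and "f absolutely_integrable_on {-pi..pi}"
  shows "locally_L1 f"
proof -
  have shift: "f absolutely_integrable_on {a + 2*pi..b + 2*pi} \<longleftrightarrow> f absolutely_integrable_on {a..b}" for a b
  proof -
    have "(\<lambda>x. f (x + 2*pi)) integrable_on {a..b} \<longleftrightarrow> f integrable_on {a+2*pi..b+2*pi}"
      using integrable_shift_real_ivl_iff[of f "2*pi" "a+2*pi" "b+2*pi"] by simp
    moreover have "(\<lambda>x. norm (f (x + 2*pi))) integrable_on {a..b} \<longleftrightarrow> (\<lambda>x. norm (f x)) integrable_on {a+2*pi..b+2*pi}"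
      using integrable_shift_real_ivl_iff[of "\<lambda>x. norm (f x)" "2*pi" "a+2*pi" "b+2*pi"] by simp
    ultimately show ?thesis using per unfolding absolutely_integrable_on_def by simp
  qed
  have "f absolutely_integrable_on {-pi - 2*pi*real n..pi + 2*pi*real n}" for n
  proof (induction n)
    case 0 then show ?case using assms by simp
  next
    case (Suc n)
    define L where "L = -pi - 2*pi*real n"
    define R where "R = pi + 2*pi*real n"
    have LR: "L + 2*pi \<le> R" "L \<le> R" "R - 2*pi \<ge> L" 
    proof -
      have "0 \<le> pi * real n" by simp
      then show "L + 2*pi \<le> R" "L \<le> R" "R - 2*pi \<ge> L" using pi_gt_zero unfolding L_def R_def by linarith+
    qed
    have 0: "f absolutely_integrable_on {L..R}" using Suc by (simp add: L_def R_def)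
    have "f absolutely_integrable_on {L+2*pi..R+2*pi}" using shift 0 by blast
    moreover have "f absolutely_integrable_on {L..L+2*pi}"
      by (rule absolutely_integrable_on_Icc_subset[OF 0]) (use LR in linarith)+
    ultimately have R: "f absolutely_integrable_on {L..R+2*pi}"
      using LR pi_gt_zero by (metis absolutely_integrable_on_combine add_increasing2 le_add_same_cancel1 less_eq_real_def zero_less_mult_iff zero_less_numeral add_right_mono)
    have "f absolutely_integrable_on {L-2*pi..R-2*pi}"
      using shift[of "L-2*pi" "R-2*pi"] 0 by simp
    then have "f absolutely_integrable_on {L-2*pi..L}"
      by (rule absolutely_integrable_on_Icc_subset) (use LR in linarith)+
    then have "f absolutely_integrable_on {L-2*pi..R+2*pi}"
      using R by (rule absolutely_integrable_on_combine) (use LR pi_gt_zero in linarith)+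
    moreover have "L - 2*pi = -pi - 2*pi*real (Suc n)" "R + 2*pi = pi + 2*pi*real (Suc n)"
      by (simp_all add: algebra_simps L_def R_def)
    ultimately show ?case by metis
  qed note * = this
  show ?thesis unfolding locally_L1_def
  proof (intro allI)
    fix a b
    obtain n where n: "\<bar>a\<bar> + \<bar>b\<bar> \<le> real n" using real_arch_simple by blast
    have "1 * real n \<le> 2*pi*real n" using pi_gt3 by (intro mult_right_mono) auto
    show "f absolutely_integrable_on {a..b}"
      by (rule absolutely_integrable_on_Icc_subset[OF *[of n]])
         (use n pi_gt_zero \<open>1 * real n \<le> 2*pi*real n\<close> in linarith)+
  qed
qed

text \<open>Moving the window from \<open>a\<close> to \<open>b\<close> trades the integral over \<open>[a, b]\<close> for its translate by a period.\<close>

lemma integral_over_period: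
  fixes f :: "real \<Rightarrow> 'b::euclidean_space"
  assumes per: "circle_periodic f" and L1: "locally_L1 f"
  shows "integral {a..a + 2*pi} f = integral {-pi..pi} f"
proof -
  have le: "integral {a..a + 2*pi} f = integral {b..b + 2*pi} f" if "a \<le> b" for a b
  proof -
    have s: "integral {a+2*pi..b+2*pi} f = integral {a..b} f"
      using integral_shift_real_ivl[of "a+2*pi" "2*pi" "b+2*pi" f] per by simp
    have "integral {a..b} f + integral {b..b+2*pi} f = integral {a..b+2*pi} f"
      using that by (intro Henstock_Kurzweil_Integration.integral_combine locally_L1_integrable L1) auto
    moreover have "integral {a..a+2*pi} f + integral {a+2*pi..b+2*pi} f = integral {a..b+2*pi} f"
      using that by (intro Henstock_Kurzweil_Integration.integral_combine locally_L1_integrable L1) auto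
    ultimately show ?thesis using s by (metis add.commute add_right_imp_eq)
  qed
  have "integral {a..a + 2*pi} f = integral {-pi..-pi + 2*pi} f"
    using le[of a "-pi"] le[of "-pi" a] by (cases "a \<le> -pi") auto
  then show ?thesis by simp
qed

lemma integral_Icc_mono_nonneg:
  fixes f :: "real \<Rightarrow> real"
  assumes "locally_L1 f" "\<And>x. 0 \<le> f x" "c \<le> a" "b \<le> d"
  shows "integral {a..b} f \<le> integral {c..d} f"
  by (rule integral_subset_le) (use assms locally_L1_integrable in auto)

lemma steklov_eq_integral:
  "locally_L1 f \<Longrightarrow> steklov h f x = (1/h) *\<^sub>R integral {x - h/2..x + h/2} f"
  by (simp add: steklov_def locally_L1_def set_lebesgue_integral_eq_integral)

lemma forward_steklov_eq_integral:
  "locally_L1 f \<Longrightarrow> forward_steklov h f x = (1/h) *\<^sub>R integral {x..x + h} f"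
  by (simp add: forward_steklov_def steklov_eq_integral add.commute add.left_commute)

text \<open>On a bounded range of \<open>x\<close> the window integral is a difference of two values of one indefinite
  integral.\<close>

lemma continuous_integral_window:
  fixes f :: "real \<Rightarrow> complex"
  assumes "locally_L1 f" "0 \<le> h"
  shows "continuous_on UNIV (\<lambda>x. integral {x + c..x + c + h} f)"
proof -
  have "continuous_on {-R<..<R} (\<lambda>x. integral {x + c..x + c + h} f)" for R
  proof -
    define a where "a = - R + c"
    define b where "b = R + c + h"
    have F: "continuous_on {a..b} (\<lambda>x. integral {a..x} f)"
      by (rule indefinite_integral_continuous_1) (use assms locally_L1_integrable in auto)
    have "continuous_on {-R<..<R} (\<lambda>x. integral {a..x + c + h} f)"
      by (rule continuous_on_compose2[OF F]) (auto intro!: continuous_intros simp: a_def b_def assms add_increasing2)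
    moreover have "continuous_on {-R<..<R} (\<lambda>x. integral {a..x + c} f)"
      by (rule continuous_on_compose2[OF F]) (use assms in \<open>auto intro!: continuous_intros simp: a_def b_def\<close>)
    ultimately have "continuous_on {-R<..<R} (\<lambda>x. integral {a..x + c + h} f - integral {a..x + c} f)"
      by (rule continuous_on_diff)
    moreover have "integral {a..x + c + h} f - integral {a..x + c} f = integral {x + c..x + c + h} f"
      if "x \<in> {-R<..<R}" for x
    proof -
      have "integral {a..x + c} f + integral {x+c..x + c+h} f = integral {a..x + c + h} f"
        using that assms by (intro Henstock_Kurzweil_Integration.integral_combine locally_L1_integrable) (auto simp: a_def)
      then show ?thesis by (metis add_diff_cancel_left')
    qed
    ultimately show ?thesis by (rule continuous_on_eq)
  qed
  then have "continuous_on (\<Union>R. {-R<..<R}) (\<lambda>x. integral {x + c..x + c + h} f)"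
    by (intro continuous_on_open_UN) auto
  moreover have "(\<Union>R::real. {-R<..<R}) = UNIV"
  proof -
    have "x \<in> {-(\<bar>x\<bar>+1)<..<(\<bar>x\<bar>+1)}" for x :: real by auto
    then show ?thesis by blast
  qed
  ultimately show ?thesis by simp
qed

lemma forward_steklov_continuous:
  assumes "locally_L1 f" "h > 0"
  shows "continuous_on UNIV (forward_steklov h f)"
proof -
  have "continuous_on UNIV (\<lambda>x. (1/h) *\<^sub>R integral {x + 0..x + 0 + h} f)"
    using assms by (intro continuous_intros continuous_integral_window) auto
  moreover have "(\<lambda>x. (1/h) *\<^sub>R integral {x + 0..x + 0 + h} f) = forward_steklov h f"
    by (rule ext) (simp add: forward_steklov_eq_integral assms)
  ultimately show ?thesis by metis
qed

lemma steklov_eq_forward: "steklov h f x = forward_steklov h f (x - h/2)"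
  by (simp add: forward_steklov_def)

lemma forward_steklov_periodic:
  assumes "circle_periodic f" "locally_L1 f"
  shows "circle_periodic (forward_steklov h f)"
proof (intro allI)
  fix x
  have "integral {x + 2*pi..x + h + 2*pi} f = integral {x..x + h} f"
    using integral_shift_real_ivl[of "x+2*pi" "2*pi" "x + h+2*pi" f] assms by simp
  then show "forward_steklov h f (x + 2 * pi) = forward_steklov h f x"
    using assms by (simp add: forward_steklov_eq_integral algebra_simps)
qed

lemma forward_steklov_diff:
  assumes "locally_L1 f" "locally_L1 g"
  shows "forward_steklov h (\<lambda>x. f x - g x) x = forward_steklov h f x - forward_steklov h g x"
  using assms by (simp add: forward_steklov_eq_integral locally_L1_diff locally_L1_integrable
      Henstock_Kurzweil_Integration.integral_diff scaleR_diff_right)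

lemma steklov_diff:
  assumes "locally_L1 f" "locally_L1 g"
  shows "steklov h (\<lambda>x. f x - g x) = (\<lambda>x. steklov h f x - steklov h g x)"
  using assms by (simp add: steklov_eq_forward forward_steklov_diff fun_eq_iff)

lemma steklov_cmult:
  assumes "locally_L1 f"
  shows "steklov h (\<lambda>x. c * f x) = (\<lambda>x. c * steklov h f x)"
  using assms by (simp add: steklov_eq_integral locally_L1_cmult fun_eq_iff)

lemma locally_L1_of_real_norm:
  fixes f :: "real \<Rightarrow> complex"
  assumes "locally_L1 f"
  shows "locally_L1 (\<lambda>x. complex_of_real (norm (f x)))"
  using locally_L1_norm[OF assms]
    absolutely_integrable_linear[OF _ bounded_linear_of_real, where f="\<lambda>x. norm (f x)"]
  by (auto simp: locally_L1_def o_def)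

lemma integral_of_real_norm:
  fixes f :: "real \<Rightarrow> complex"
  assumes "locally_L1 f"
  shows "integral {a..b} (\<lambda>x. complex_of_real (norm (f x))) = of_real (integral {a..b} (\<lambda>x. norm (f x)))"
  using integral_linear[OF locally_L1_integrable[OF locally_L1_norm[OF assms]] bounded_linear_of_real]
  by (simp add: o_def)

lemma steklov_norm_eq:
  fixes f :: "real \<Rightarrow> complex"
  assumes L1: "locally_L1 f" and h: "h > 0"
  shows "norm (steklov h (\<lambda>x. of_real (norm (f x))) x) = (1/h) * integral {x - h/2..x + h/2} (\<lambda>x. norm (f x))"
proof -
  have "0 \<le> integral {x - h/2..x + h/2} (\<lambda>x. norm (f x))"
    by (rule Henstock_Kurzweil_Integration.integral_nonneg)
       (use locally_L1_integrable[OF locally_L1_norm[OF L1]] in auto)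
  then show ?thesis
    using h by (simp add: steklov_eq_integral locally_L1_of_real_norm integral_of_real_norm L1)
qed

text \<open>Assumption A speaks of centred averages only.  The one-sided window of length \<open>h\<close> lies in the
  centred one of length \<open>2h\<close>, which costs the factor \<open>2\<close>; this is how forward averages, which are
  translates of centred ones, are controlled in a space without translation invariance.\<close>

lemma norm_forward_steklov_le:
  fixes f :: "real \<Rightarrow> complex"
  assumes L1: "locally_L1 f" and h: "h > 0"
  shows "norm (forward_steklov h f x) \<le> 2 * norm (steklov (2*h) (\<lambda>x. of_real (norm (f x))) x)"
proof -
  have nf: "locally_L1 (\<lambda>x. norm (f x))" by (rule locally_L1_norm[OF L1])
  have "norm (integral {x..x+h} f) \<le> integral {x..x+h} (\<lambda>x. norm (f x))"
    by (intro integral_norm_bound_integral locally_L1_integrable L1 nf) auto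
  also have "\<dots> \<le> integral {x-h..x+h} (\<lambda>x. norm (f x))"
    using nf h by (intro integral_Icc_mono_nonneg) auto
  finally have "norm (forward_steklov h f x) \<le> (1/h) * integral {x-h..x+h} (\<lambda>x. norm (f x))"
    using h by (simp add: forward_steklov_eq_integral[OF L1] divide_right_mono)
  then show ?thesis using h by (simp add: steklov_norm_eq[OF L1])
qed

section \<open>Fourier coefficients of Steklov averages\<close>

definition fourier_coeff :: "(real \<Rightarrow> complex) \<Rightarrow> int \<Rightarrow> complex" where
  "fourier_coeff f k = (1/(2*pi)) *\<^sub>R integral {-pi..pi} (\<lambda>y. cis (- (of_int k * y)) * f y)"

text \<open>Coefficients outside \<open>[-M, M]\<close> are ignored, so that a coefficient function need not be cut off
  by hand.\<close>

definition trig_sum :: "nat \<Rightarrow> (int \<Rightarrow> complex) \<Rightarrow> real \<Rightarrow> complex" where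
  "trig_sum M c x = (\<Sum>k=-int M..int M. c k * cis (of_int k * x))"

definition fourier_multiplier :: "nat \<Rightarrow> (int \<Rightarrow> complex) \<Rightarrow> (real \<Rightarrow> complex) \<Rightarrow> real \<Rightarrow> complex" where
  "fourier_multiplier M p f = trig_sum M (\<lambda>k. p k * fourier_coeff f k)"

lemma cis_int_periodic: "cis (of_int k * (x + 2*pi)) = cis (of_int k * x)"
proof -
  have "cis (of_int k * (x + 2*pi)) = cis (of_int k * x) * cis (2 * pi * of_int k)"
    by (simp add: cis_mult algebra_simps)
  then show ?thesis by (simp add: cis_multiple_2pi)
qed

lemma continuous_cis_mult: "continuous_on S (\<lambda>y. cis (c * y))"
  by (intro continuous_intros)

lemma locally_L1_cis_mult: "locally_L1 f \<Longrightarrow> locally_L1 (\<lambda>y. cis (c * y) * f y)"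
  by (intro locally_L1_mult_continuous continuous_cis_mult)

lemma locally_L1_cis_neg: "locally_L1 f \<Longrightarrow> locally_L1 (\<lambda>y. cis (- (c * y)) * f y)"
  using locally_L1_cis_mult[of f "-c"] by simp

lemma fourier_coeff_diff:
  assumes "locally_L1 f" "locally_L1 g"
  shows "fourier_coeff (\<lambda>x. f x - g x) k = fourier_coeff f k - fourier_coeff g k"
  unfolding fourier_coeff_def right_diff_distrib
  using assms locally_L1_cis_neg
  by (simp add: Henstock_Kurzweil_Integration.integral_diff locally_L1_integrable scaleR_diff_right)

lemma fourier_coeff_cmult:
  "fourier_coeff (\<lambda>x. c * f x) k = c * fourier_coeff f k"
proof -
  have "(\<lambda>y. cis (- (of_int k * y)) * (c * f y)) = (\<lambda>y. c * (cis (- (of_int k * y)) * f y))"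
    by (simp add: fun_eq_iff)
  then show ?thesis by (simp add: fourier_coeff_def)
qed

lemma fourier_coeff_sum:
  assumes "finite A" "\<And>i. i \<in> A \<Longrightarrow> locally_L1 (F i)"
  shows "fourier_coeff (\<lambda>x. \<Sum>i\<in>A. F i x) k = (\<Sum>i\<in>A. fourier_coeff (F i) k)"
  unfolding fourier_coeff_def sum_distrib_left
  by (subst Henstock_Kurzweil_Integration.integral_sum)
     (use assms locally_L1_cis_neg in \<open>auto simp: locally_L1_integrable scaleR_sum_right\<close>)

lemma fourier_coeff_window:
  assumes "circle_periodic f" "locally_L1 f"
  shows "integral {a..a+2*pi} (\<lambda>y. cis (- (of_int k * y)) * f y) = 2 * pi * fourier_coeff f k"
proof -
  have "circle_periodic (\<lambda>y. cis (- (of_int k * y)) * f y)"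
    using cis_int_periodic[of "-k"] assms by simp
  then show ?thesis
    using integral_over_period[OF _ locally_L1_cis_neg[OF assms(2), of "of_int k"]]
    by (simp add: fourier_coeff_def scaleR_conv_of_real)
qed

lemma integral_cis_int:
  "integral {-pi..pi} (\<lambda>y. cis (of_int m * y)) = (if m = 0 then 2 * pi else 0)"
proof (cases "m = 0")
  case True then show ?thesis by (simp add: scaleR_conv_of_real)
next
  case False
  have "((\<lambda>y. cis (of_int m * y)) has_integral
      (cis (of_int m * pi) / (\<i> * of_int m) - cis (of_int m * (-pi)) / (\<i> * of_int m))) {-pi..pi}"
  proof (rule fundamental_theorem_of_calculus)
    fix x :: real
    have "((\<lambda>y. exp (\<i> * of_int m * of_real y) / (\<i> * of_int m)) has_vector_derivative
        exp (\<i> * of_int m * of_real x)) (at x within {-pi..pi})"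
      by (rule has_vector_derivative_real_field) (use False in \<open>auto intro!: derivative_eq_intros\<close>)
    then show "((\<lambda>y. cis (of_int m * y) / (\<i> * of_int m)) has_vector_derivative cis (of_int m * x))
        (at x within {-pi..pi})"
      by (simp add: cis_conv_exp mult.assoc)
  qed auto
  moreover have "cis (of_int m * pi) = cis (of_int m * (-pi))"
    using cis_int_periodic[of m "-pi"] by simp
  ultimately show ?thesis using False by (simp add: integral_unique)
qed

lemma fourier_coeff_cis: "fourier_coeff (\<lambda>x. cis (of_int j * x)) k = (if j = k then 1 else 0)"
proof -
  have "(\<lambda>y. cis (- (of_int k * y)) * cis (of_int j * y)) = (\<lambda>y. cis (of_int (j - k) * y))"
    by (simp add: cis_mult fun_eq_iff algebra_simps)
  then show ?thesis using integral_cis_int[of "j - k"]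
    by (simp add: fourier_coeff_def scaleR_conv_of_real)
qed

lemma locally_L1_trig_term: "locally_L1 (\<lambda>x. c * cis (d * x))"
  by (intro locally_L1_continuous continuous_intros)

lemma continuous_trig_sum: "continuous_on S (trig_sum M c)"
  unfolding trig_sum_def by (intro continuous_intros)

lemma trig_sum_periodic: "circle_periodic (trig_sum M c)"
  unfolding trig_sum_def cis_int_periodic by simp

lemma locally_L1_trig_sum: "locally_L1 (trig_sum M c)"
  by (intro locally_L1_continuous continuous_trig_sum)

lemma fourier_coeff_trig_sum:
  "fourier_coeff (trig_sum M c) j = (if \<bar>j\<bar> \<le> int M then c j else 0)"
proof -
  have "fourier_coeff (trig_sum M c) j = (\<Sum>k=-int M..int M. c k * (if k = j then 1 else 0))"
    unfolding trig_sum_def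
    by (subst fourier_coeff_sum) (simp_all add: locally_L1_trig_term fourier_coeff_cmult fourier_coeff_cis)
  then show ?thesis by (auto simp: if_distrib sum.delta cong: if_cong split: if_splits)
qed

text \<open>Fubini on the product needs Borel functions, whereas elements of the space are only Lebesgue
  measurable.  This lemma passes from a Borel representative \<open>g\<close> back to \<open>f\<close> inside a translated
  window.\<close>

lemma lborel_window_integral:
  fixes f g q :: "real \<Rightarrow> 'b::{euclidean_space,real_normed_field}"
  assumes f: "locally_L1 f" and g: "g \<in> borel_measurable borel" and ae: "AE y in lborel. f y = g y"
    and q: "continuous_on UNIV q"
  shows "has_bochner_integral lborel (\<lambda>x. indicator {c..d} x *\<^sub>R (q x * g (z + x)))
           (integral {c+z..d+z} (\<lambda>y. q (y - z) * f y))"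
proof -
  have q': "continuous_on UNIV (\<lambda>y. q (y - z))"
    by (rule continuous_on_compose2[OF q]) (auto intro!: continuous_intros)
  define F where "F y = indicator {c+z..d+z} y *\<^sub>R (q (y - z) * f y)" for y
  define G where "G y = indicator {c+z..d+z} y *\<^sub>R (q (y - z) * g y)" for y
  have ai: "(\<lambda>y. q (y - z) * f y) absolutely_integrable_on {c+z..d+z}"
    using locally_L1_mult_continuous[OF f q'] by (simp add: locally_L1_def)
  then have iF: "integrable lebesgue F"
    unfolding set_integrable_def F_def .
  have F: "integral\<^sup>L lebesgue F = integral {c+z..d+z} (\<lambda>y. q (y - z) * f y)"
    using set_lebesgue_integral_eq_integral(2)[OF ai] unfolding set_lebesgue_integral_def F_def .
  have qm: "(\<lambda>y. q (y - z)) \<in> borel_measurable borel"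
    using q' borel_measurable_continuous_onI by blast
  have mG: "G \<in> borel_measurable lborel"
    unfolding G_def using qm g by measurable
  have ae': "AE y in lebesgue. F y = G y"
    using AE_completion[OF ae] by (auto simp: F_def G_def)
  have mG': "G \<in> borel_measurable lebesgue" using mG measurable_completion by blast
  have "integrable lebesgue G"
    using iF ae' mG' integrable_cong_AE[of F lebesgue G] borel_measurable_integrable by blast
  then have iG: "integrable lborel G" using integrable_completion[OF mG] by simp
  have "integral\<^sup>L lborel G = integral\<^sup>L lebesgue G" using integral_completion[OF mG] by simp
  also have "\<dots> = integral\<^sup>L lebesgue F"
    using ae' iF mG' by (intro integral_cong_AE) auto
  finally have "has_bochner_integral lborel G (integral {c+z..d+z} (\<lambda>y. q (y - z) * f y))"
    using iG F has_bochner_integral_iff by metis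
  then have "has_bochner_integral lborel (\<lambda>x. G (z + 1 * x))
     (integral {c+z..d+z} (\<lambda>y. q (y - z) * f y) /\<^sub>R \<bar>1\<bar>)"
    using lborel_has_bochner_integral_real_affine_iff[of 1 G _ z] by simp
  moreover have "G (z + 1 * x) = indicator {c..d} x *\<^sub>R (q x * g (z + x))" for x
    by (auto simp: G_def indicator_def algebra_simps)
  ultimately show ?thesis by simp
qed

lemma borel_representative:
  fixes f :: "real \<Rightarrow> complex"
  assumes "f \<in> borel_measurable lebesgue"
  obtains g where "g \<in> borel_measurable borel" "AE y in lborel. f y = g y"
proof -
  have "(\<lambda>x. Re (f x)) \<in> borel_measurable lebesgue" "(\<lambda>x. Im (f x)) \<in> borel_measurable lebesgue"
    using assms by measurable
  then obtain u v where u: "u \<in> borel_measurable lborel" "AE x in lborel. Re (f x) = u x"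
    and v: "v \<in> borel_measurable lborel" "AE x in lborel. Im (f x) = v x"
    using completion_ex_borel_measurable_real by metis
  have "(\<lambda>x. complex_of_real (u x) + \<i> * complex_of_real (v x)) \<in> borel_measurable borel"
    using u(1) v(1) by simp
  moreover have "AE y in lborel. f y = complex_of_real (u y) + \<i> * complex_of_real (v y)"
    using u(2) v(2)
  proof eventually_elim
    case (elim x) then show ?case by (simp add: complex_eq_iff)
  qed
  ultimately show ?thesis using that by blast
qed

lemma lborel_integral_Icc_continuous:
  fixes f :: "real \<Rightarrow> 'b::euclidean_space"
  assumes "continuous_on {a..b} f"
  shows "(\<integral>x. indicator {a..b} x *\<^sub>R f x \<partial>lborel) = integral {a..b} f"
  using set_borel_integral_eq_integral(2)[OF borel_integrable_atLeastAtMost'[OF assms]]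
  by (simp add: set_lebesgue_integral_def)

text \<open>The eigenvalue of the forward average of length \<open>h\<close> on \<open>x \<mapsto> cis (k * x)\<close> is
  \<open>exp_average (k * h)\<close>.\<close>

definition exp_average :: "real \<Rightarrow> complex" where
  "exp_average t = integral {0..1} (\<lambda>u. cis (t * u))"

lemma integral_cis_window:
  assumes "h > 0"
  shows "integral {0..h} (\<lambda>u. cis (c * u)) = h * exp_average (c * h)"
proof -
  have "((\<lambda>u. cis (c * h * u)) has_integral exp_average (c*h)) {0..1}"
    unfolding exp_average_def by (intro integrable_integral integrable_continuous_real continuous_intros)
  from has_integral_affinity'[of "\<lambda>u. cis (c * h * u)" "exp_average (c*h)" 0 1 "1/h" 0]
  have "((\<lambda>u. cis (c * u)) has_integral (h * exp_average (c*h))) {0..h}"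
    using \<open>((\<lambda>u. cis (c * h * u)) has_integral exp_average (c*h)) {0..1}\<close> assms
    by (simp add: scaleR_conv_of_real field_simps)
  then show ?thesis by (rule integral_unique)
qed

text \<open>By Fubini the coefficient is the average over \<open>u \<in> [0, h]\<close> of the coefficients of the translates
  \<open>x \<mapsto> f (x + u)\<close>, and each of these is \<open>cis (k * u)\<close> times that of \<open>f\<close> by periodicity.\<close>

lemma fourier_coeff_forward_steklov:
  assumes per: "circle_periodic f" and L1: "locally_L1 f" and meas: "f \<in> borel_measurable lebesgue"
    and h: "h > 0"
  shows "fourier_coeff (forward_steklov h f) k = exp_average (of_int k * h) * fourier_coeff f k"
proof -
  obtain g where g: "g \<in> borel_measurable borel" and ae: "AE y in lborel. f y = g y"
    using borel_representative[OF meas] by blast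
  \<comment> \<open>The kernel of the iterated integral, with both windows built in so that it lives on the plane.\<close>
  define H where "H x u = indicator {-pi..pi} x *\<^sub>R (indicator {0..h} u *\<^sub>R (cis (- (of_int k * x)) * g (x + u)))" for x u
  have cm: "(\<lambda>x. cis (- (of_int k * x))) \<in> borel_measurable borel"
    by (intro borel_measurable_continuous_onI continuous_intros)
  have mH: "case_prod H \<in> borel_measurable (lborel \<Otimes>\<^sub>M lborel)"
    unfolding H_def split_beta using g cm by measurable
  have w1: "has_bochner_integral lborel (\<lambda>u. indicator {0..h} u *\<^sub>R (1 * g (x + u)))
      (integral {0+x..h+x} (\<lambda>y. 1 * f y))" for x
    by (rule lborel_window_integral[OF L1 g ae]) (intro continuous_intros)
  have Hx: "has_bochner_integral lborel (H x)
      (indicator {-pi..pi} x *\<^sub>R (cis (- (of_int k * x)) * integral {x..x+h} f))" for x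
  proof -
    have "has_bochner_integral lborel (\<lambda>u. (indicator {-pi..pi} x *\<^sub>R cis (- (of_int k * x))) * (indicator {0..h} u *\<^sub>R (1 * g (x + u))))
      ((indicator {-pi..pi} x *\<^sub>R cis (- (of_int k * x))) * (integral {0+x..h+x} (\<lambda>y. 1 * f y)))"
      using w1 by (rule has_bochner_integral_mult_right)
    then show ?thesis by (simp add: H_def[abs_def] add.commute mult.commute)
  qed
  have gn: "(\<lambda>y. norm (g y)) \<in> borel_measurable borel" using g by measurable
  have aen: "AE y in lborel. norm (f y) = norm (g y)" using ae by auto
  have w2: "has_bochner_integral lborel (\<lambda>u. indicator {0..h} u *\<^sub>R (1 * norm (g (x + u))))
      (integral {0+x..h+x} (\<lambda>y. 1 * norm (f y)))" for x
    by (rule lborel_window_integral[OF locally_L1_norm[OF L1] gn aen]) (intro continuous_intros)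
  have Hn: "(\<integral>u. norm (H x u) \<partial>lborel) = indicator {-pi..pi} x *\<^sub>R integral {x..x+h} (\<lambda>y. norm (f y))" for x
  proof -
    have "has_bochner_integral lborel (\<lambda>u. indicator {-pi..pi} x * (indicator {0..h} u *\<^sub>R (1 * norm (g (x + u)))))
      (indicator {-pi..pi} x * (integral {0+x..h+x} (\<lambda>y. 1 * norm (f y))))"
      using w2 by (rule has_bochner_integral_mult_right)
    moreover have "norm (H x u) = indicator {-pi..pi} x * (indicator {0..h} u *\<^sub>R (1 * norm (g (x + u))))" for u
      by (simp add: H_def norm_mult)
    ultimately show ?thesis
      using has_bochner_integral_integral_eq by (simp only: real_scaleR_def mult_1 add_0 add.commute)
  qed
  have "continuous_on UNIV (\<lambda>x. complex_of_real (integral {x..x+h} (\<lambda>y. norm (f y))))"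
    using continuous_integral_window[OF locally_L1_of_real_norm[OF L1], of h 0] h
    by (simp add: integral_of_real_norm[OF L1])
  then have cn: "continuous_on UNIV (\<lambda>x. integral {x..x+h} (\<lambda>y. norm (f y)))"
    using continuous_on_Re by fastforce
  have iH: "integrable (lborel \<Otimes>\<^sub>M lborel) (case_prod H)"
  proof (rule lborel_pair.Fubini_integrable[OF mH])
    have "integrable lborel (\<lambda>x. indicator {-pi..pi} x *\<^sub>R integral {x..x+h} (\<lambda>y. norm (f y)))"
      using cn by (intro borel_integrable_compact) (auto intro: continuous_on_subset)
    then show "integrable lborel (\<lambda>x. \<integral>y. norm (case_prod H (x, y)) \<partial>lborel)"
      by (simp add: Hn)
    show "AE x in lborel. integrable lborel (\<lambda>y. case_prod H (x, y))"
      using Hx by (simp add: has_bochner_integral_iff)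
  qed
  have w3: "has_bochner_integral lborel (\<lambda>x. indicator {-pi..pi} x *\<^sub>R (cis (- (of_int k * x)) * g (u + x)))
      (integral {-pi+u..pi+u} (\<lambda>y. cis (- (of_int k * (y - u))) * f y))" for u
    by (rule lborel_window_integral[OF L1 g ae]) (intro continuous_intros)
  have w3': "integral {-pi+u..pi+u} (\<lambda>y. cis (- (of_int k * (y - u))) * f y)
     = cis (of_int k * u) * (2 * pi * fourier_coeff f k)" for u
  proof -
    have "(\<lambda>y. cis (- (of_int k * (y - u))) * f y) = (\<lambda>y. cis (of_int k * u) * (cis (- (of_int k * y)) * f y))"
      by (simp add: fun_eq_iff cis_mult algebra_simps flip: mult.assoc)
    moreover have "integral {-pi+u..pi+u} (\<lambda>y. cis (- (of_int k * y)) * f y) = 2 * pi * fourier_coeff f k"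
      using fourier_coeff_window[OF per L1, of "-pi+u" k] by (simp add: add.commute)
    ultimately show ?thesis by simp
  qed
  have Hu: "(\<integral>x. H x u \<partial>lborel) = indicator {0..h} u *\<^sub>R (cis (of_int k * u) * (2 * pi * fourier_coeff f k))" for u
  proof -
    have "has_bochner_integral lborel (\<lambda>x. indicator {0..h} u * (indicator {-pi..pi} x *\<^sub>R (cis (- (of_int k * x)) * g (u + x))))
      (indicator {0..h} u * (integral {-pi+u..pi+u} (\<lambda>y. cis (- (of_int k * (y - u))) * f y)))"
      using w3 by (rule has_bochner_integral_mult_right)
    moreover have "H x u = indicator {0..h} u * (indicator {-pi..pi} x *\<^sub>R (cis (- (of_int k * x)) * g (u + x)))" for x
      by (simp add: H_def add.commute indicator_def)
    ultimately have "(\<integral>x. H x u \<partial>lborel) = indicator {0..h} u * (cis (of_int k * u) * (2 * pi * fourier_coeff f k))"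
      using has_bochner_integral_integral_eq unfolding w3' by simp
    then show ?thesis by (simp add: indicator_def)
  qed
  have "(\<integral>u. (\<integral>x. H x u \<partial>lborel) \<partial>lborel) = (\<integral>x. (\<integral>u. H x u \<partial>lborel) \<partial>lborel)"
    using lborel_pair.Fubini_integral[OF iH] .
  moreover have "(\<integral>u. (\<integral>x. H x u \<partial>lborel) \<partial>lborel) = h * exp_average (of_int k * h) * (2 * pi * fourier_coeff f k)"
  proof -
    have c: "continuous_on {0..h} (\<lambda>u. cis (of_int k * u) * (2 * pi * fourier_coeff f k))"
      by (intro continuous_intros)
    have "(\<integral>u. (\<integral>x. H x u \<partial>lborel) \<partial>lborel) = integral {0..h} (\<lambda>u. cis (of_int k * u) * (2 * pi * fourier_coeff f k))"
      unfolding Hu by (rule lborel_integral_Icc_continuous[OF c])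
    then show ?thesis using integral_cis_window[OF h, of "of_int k"] by simp
  qed
  moreover have "(\<integral>x. (\<integral>u. H x u \<partial>lborel) \<partial>lborel) = h * (2 * pi * fourier_coeff (forward_steklov h f) k)"
  proof -
    have e: "integral {x..x+h} f = h * forward_steklov h f x" for x
      using h by (simp add: forward_steklov_eq_integral[OF L1] scaleR_conv_of_real)
    have c: "continuous_on {-pi..pi} (\<lambda>x. cis (- (of_int k * x)) * (h * forward_steklov h f x))"
      using forward_steklov_continuous[OF L1 h]
      by (intro continuous_intros) (auto intro: continuous_on_subset)
    have "(\<integral>x. (\<integral>u. H x u \<partial>lborel) \<partial>lborel)
        = (\<integral>x. indicator {-pi..pi} x *\<^sub>R (cis (- (of_int k * x)) * (h * forward_steklov h f x)) \<partial>lborel)"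
      using Hx by (simp add: has_bochner_integral_iff e)
    also have "\<dots> = integral {-pi..pi} (\<lambda>x. cis (- (of_int k * x)) * (h * forward_steklov h f x))"
      by (rule lborel_integral_Icc_continuous[OF c])
    also have "\<dots> = integral {-pi..pi} (\<lambda>x. h * (cis (- (of_int k * x)) * forward_steklov h f x))"
      by (simp add: mult.left_commute)
    also have "\<dots> = h * (2 * pi * fourier_coeff (forward_steklov h f) k)"
      by (simp add: fourier_coeff_def scaleR_conv_of_real)
    finally show ?thesis .
  qed
  ultimately show ?thesis using h by simp
qed

lemma forward_steklov_trig_sum:
  assumes h: "h > 0"
  shows "forward_steklov h (trig_sum M c) x = trig_sum M (\<lambda>k. exp_average (of_int k * h) * c k) x"
proof -
  have 1: "integral {x..x+h} (\<lambda>y. c k * cis (of_int k * y)) = h * (exp_average (of_int k * h) * c k * cis (of_int k * x))" for k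
  proof -
    have "integral {x..x+h} (\<lambda>y. c k * cis (of_int k * y)) = integral {0..h} (\<lambda>u. c k * cis (of_int k * (u + x)))"
      using integral_shift_real_ivl[of x x "x+h" "\<lambda>y. c k * cis (of_int k * y)", symmetric] by simp
    also have "(\<lambda>u. c k * cis (of_int k * (u + x))) = (\<lambda>u. (c k * cis (of_int k * x)) * cis (of_int k * u))"
      by (simp add: fun_eq_iff algebra_simps cis_mult flip: mult.assoc)
    also have "integral {0..h} (\<lambda>u. (c k * cis (of_int k * x)) * cis (of_int k * u))
        = (c k * cis (of_int k * x)) * (h * exp_average (of_int k * h))"
      by (simp add: integral_cis_window[OF h])
    finally show ?thesis by (simp only: mult_ac)
  qed
  have "integral {x..x+h} (trig_sum M c) = (\<Sum>k=-int M..int M. integral {x..x+h} (\<lambda>y. c k * cis (of_int k * y)))"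
    unfolding trig_sum_def
    by (rule Henstock_Kurzweil_Integration.integral_sum) (auto intro!: integrable_continuous_real continuous_intros)
  also have "\<dots> = h * trig_sum M (\<lambda>k. exp_average (of_int k * h) * c k) x"
    unfolding 1 by (simp add: trig_sum_def sum_distrib_left)
  finally show ?thesis
    using h by (simp add: forward_steklov_eq_integral[OF locally_L1_trig_sum] scaleR_conv_of_real)
qed

section \<open>Kernels of Fourier multipliers\<close>

text \<open>The window is centred at \<open>x\<close>, which periodicity allows: there \<open>\<bar>x - y\<bar> \<le> \<pi>\<close>, the range where the
  kernel has a good majorant.\<close>

lemma fourier_multiplier_kernel:
  assumes per: "circle_periodic f" and L1: "locally_L1 f"
  shows "fourier_multiplier M p f x =
    (1/(2*pi)) *\<^sub>R integral {x - pi..x + pi} (\<lambda>y. trig_sum M p (x - y) * f y)"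
proof -
  have eq: "trig_sum M p (x - y) * f y =
      (\<Sum>k=-int M..int M. p k * cis (of_int k * x) * (cis (- (of_int k * y)) * f y))" for y
  proof -
    have "cis (of_int k * (x - y)) = cis (of_int k * x) * cis (- (of_int k * y))" for k
      by (simp add: cis_mult algebra_simps)
    then show ?thesis by (simp add: trig_sum_def sum_distrib_right mult.assoc)
  qed
  have w: "integral {x - pi..x + pi} (\<lambda>y. cis (- (of_int k * y)) * f y) = 2 * pi * fourier_coeff f k" for k
    using fourier_coeff_window[OF per L1, of "x - pi" k] by (simp add: add.commute)
  have i: "(\<lambda>y. cis (- (of_int k * y)) * f y) integrable_on {x - pi..x + pi}" for k
    using locally_L1_integrable[OF locally_L1_cis_neg[OF L1]] .
  have "integral {x - pi..x + pi} (\<lambda>y. trig_sum M p (x - y) * f y)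
    = (\<Sum>k=-int M..int M. integral {x - pi..x + pi} (\<lambda>y. p k * cis (of_int k * x) * (cis (- (of_int k * y)) * f y)))"
    unfolding eq by (rule Henstock_Kurzweil_Integration.integral_sum) (use i in \<open>auto intro: integrable_on_mult_right\<close>)
  also have "\<dots> = (\<Sum>k=-int M..int M. p k * cis (of_int k * x) * (2 * pi * fourier_coeff f k))"
    by (simp add: w)
  finally show ?thesis
    by (simp add: fourier_multiplier_def trig_sum_def scaleR_conv_of_real sum_distrib_left field_simps)
qed

text \<open>Below, \<open>K\<close> is the value at \<open>z\<close> of a function bounded by \<open>C / (1 + (n z)\<^sup>2)\<close>; it is compared with the
  indicators of the intervals \<open>\<bar>z\<bar> \<le> 2\<^sup>j / n\<close>.  Already the first interval that contains \<open>z\<close>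
  gives enough.\<close>

lemma dyadic_majorant:
  fixes z n C K :: real
  assumes K: "K * (1 + (n * z)\<^sup>2) \<le> C" and K0: "0 \<le> K" and C: "0 \<le> C" and z: "n * \<bar>z\<bar> \<le> 2 ^ J"
  shows "K \<le> (\<Sum>j\<le>J. 4 * C / 4 ^ j * (if n * \<bar>z\<bar> \<le> 2 ^ j then 1 else 0))"
proof -
  define j where "j = (LEAST j. n * \<bar>z\<bar> \<le> 2 ^ j)"
  have j: "n * \<bar>z\<bar> \<le> 2 ^ j" "j \<le> J"
    using z unfolding j_def by (auto intro: LeastI Least_le)
  have "K \<le> 4 * C / 4 ^ j"
  proof (cases j)
    case 0
    have "K * 1 \<le> K * (1 + (n * z)\<^sup>2)" using K0 by (intro mult_left_mono) auto
    then show ?thesis using K C 0 by simp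
  next
    case (Suc i)
    have "\<not> n * \<bar>z\<bar> \<le> 2 ^ i"
      using not_less_Least[of i "\<lambda>j. n * \<bar>z\<bar> \<le> 2 ^ j"] Suc unfolding j_def by auto
    then have "2 ^ i \<le> n * \<bar>z\<bar>" by simp
    then have "(2 ^ i)\<^sup>2 \<le> (n * \<bar>z\<bar>)\<^sup>2" by (rule power_mono) auto
    then have "(4::real) ^ i \<le> (n * z)\<^sup>2"
      by (simp add: power_mult_distrib power2_eq_square flip: power_mult_distrib)
    then have "K * 4 ^ i \<le> K * (1 + (n * z)\<^sup>2)" using K0 by (intro mult_left_mono) auto
    then have "K * 4 ^ i \<le> C" using K by linarith
    then show ?thesis using Suc by (simp add: field_simps)
  qed
  also have "\<dots> = 4 * C / 4 ^ j * (if n * \<bar>z\<bar> \<le> 2 ^ j then 1 else 0)" using j by simp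
  also have "\<dots> \<le> (\<Sum>j\<le>J. 4 * C / 4 ^ j * (if n * \<bar>z\<bar> \<le> 2 ^ j then 1 else 0))"
    by (rule member_le_sum) (use j C in auto)
  finally show ?thesis .
qed

text \<open>The indicator of \<open>\<bar>z\<bar> \<le> 2\<^sup>j / n\<close> convolved with \<open>\<bar>f\<bar>\<close> is a centred average times the length
  \<open>2 * 2\<^sup>j / n\<close>, and its coefficient is of order \<open>n / 4\<^sup>j\<close>.  The sum is finite because the dyadic
  intervals soon cover a whole period, so that no infinite superposition in the lattice occurs.\<close>

lemma fourier_multiplier_pointwise:
  fixes f :: "real \<Rightarrow> complex"
  assumes per: "circle_periodic f" and L1: "locally_L1 f" and n: "n > 0" and C: "0 \<le> C"
    and K: "\<And>z. \<bar>z\<bar> \<le> pi \<Longrightarrow> norm (trig_sum M p z) * (1 + (n * z)\<^sup>2) \<le> C * n"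
    and J: "pi * n \<le> 2 ^ J"
  shows "norm (fourier_multiplier M p f x)
    \<le> (\<Sum>j\<le>J. 2 * C / 2 ^ j * norm (steklov (2 * 2 ^ j / n) (\<lambda>x. of_real (norm (f x))) x))"
proof -
  let ?I = "{x - pi..x + pi}"
  let ?s = "\<lambda>j. norm (steklov (2 * 2 ^ j / n) (\<lambda>x. of_real (norm (f x))) x)"
  define \<rho> where "\<rho> j = 2 ^ j / n" for j :: nat
  have \<rho>0: "\<rho> j > 0" for j using n by (simp add: \<rho>_def)
  have nf: "locally_L1 (\<lambda>y. norm (f y))" using L1 locally_L1_norm by blast
  define g where "g j y = (if y \<in> {x - \<rho> j..x + \<rho> j} then norm (f y) else 0)" for j y
  have gi: "g j integrable_on ?I" for j
    unfolding g_def integrable_restrict_Int by (simp add: locally_L1_integrable[OF nf])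
  have cont: "continuous_on UNIV (\<lambda>y. trig_sum M p (x - y))"
    by (rule continuous_on_compose2[OF continuous_trig_sum[of UNIV]]) (auto intro!: continuous_intros)
  have Ki: "(\<lambda>y. trig_sum M p (x - y) * f y) integrable_on ?I"
    by (intro locally_L1_integrable locally_L1_mult_continuous L1 cont)
  have bound: "norm (trig_sum M p (x - y) * f y) \<le> (\<Sum>j\<le>J. 4 * (C * n) / 4 ^ j * g j y)" if "y \<in> ?I" for y
  proof -
    have z: "\<bar>x - y\<bar> \<le> pi" using that by auto
    have "n * \<bar>x - y\<bar> \<le> n * pi" using z n by (intro mult_left_mono) auto
    then have zJ: "n * \<bar>x - y\<bar> \<le> 2 ^ J" using J by (simp add: mult.commute)
    then have "norm (trig_sum M p (x - y)) \<le> (\<Sum>j\<le>J. 4 * (C * n) / 4 ^ j * (if n * \<bar>x - y\<bar> \<le> 2 ^ j then 1 else 0))"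
      using C n by (intro dyadic_majorant K z zJ) auto
    then have "norm (trig_sum M p (x - y)) * norm (f y)
       \<le> (\<Sum>j\<le>J. 4 * (C * n) / 4 ^ j * (if n * \<bar>x - y\<bar> \<le> 2 ^ j then 1 else 0)) * norm (f y)"
      by (rule mult_right_mono) simp
    also have "\<dots> = (\<Sum>j\<le>J. 4 * (C * n) / 4 ^ j * ((if n * \<bar>x - y\<bar> \<le> 2 ^ j then 1 else 0) * norm (f y)))"
      by (simp add: sum_distrib_right mult.assoc)
    also have "\<dots> = (\<Sum>j\<le>J. 4 * (C * n) / 4 ^ j * g j y)"
    proof (intro sum.cong refl arg_cong2[where f="(*)"])
      fix j
      have "n * \<bar>x - y\<bar> \<le> 2 ^ j \<longleftrightarrow> \<bar>x - y\<bar> \<le> \<rho> j" using n by (simp add: \<rho>_def field_simps)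
      also have "\<dots> \<longleftrightarrow> y \<in> {x - \<rho> j..x + \<rho> j}" by auto
      finally show "(if n * \<bar>x - y\<bar> \<le> 2 ^ j then 1 else 0) * norm (f y) = g j y" by (simp add: g_def)
    qed
    finally show ?thesis by (simp add: norm_mult)
  qed
  have gle: "integral ?I (g j) \<le> 2 * \<rho> j * ?s j" for j
  proof -
    have "integral ?I (g j) = integral ({x - \<rho> j..x + \<rho> j} \<inter> ?I) (\<lambda>y. norm (f y))"
      unfolding g_def by (rule integral_restrict_Int)
    also have "\<dots> \<le> integral {x - \<rho> j..x + \<rho> j} (\<lambda>y. norm (f y))"
      by (rule integral_subset_le) (auto simp: locally_L1_integrable[OF nf])
    also have "\<dots> = 2 * \<rho> j * norm (steklov (2 * \<rho> j) (\<lambda>x. of_real (norm (f x))) x)"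
      using \<rho>0[of j] by (subst steklov_norm_eq) (simp_all add: L1)
    finally show ?thesis by (simp add: \<rho>_def)
  qed
  have "norm (integral ?I (\<lambda>y. trig_sum M p (x - y) * f y)) \<le> integral ?I (\<lambda>y. \<Sum>j\<le>J. 4 * (C * n) / 4 ^ j * g j y)"
    by (rule integral_norm_bound_integral) (use Ki gi bound in \<open>auto intro!: integrable_sum integrable_on_mult_right\<close>)
  also have "\<dots> = (\<Sum>j\<le>J. 4 * (C * n) / 4 ^ j * integral ?I (g j))"
    by (subst Henstock_Kurzweil_Integration.integral_sum) (use gi in \<open>auto intro!: integrable_on_mult_right\<close>)
  also have "\<dots> \<le> (\<Sum>j\<le>J. 4 * (C * n) / 4 ^ j * (2 * \<rho> j * ?s j))"
    using C n gle by (intro sum_mono mult_left_mono) auto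
  also have "\<dots> = (\<Sum>j\<le>J. 4 * (2 * C / 2 ^ j * ?s j))"
  proof (intro sum.cong refl)
    fix j
    have "(4::real) ^ j = 2 ^ j * 2 ^ j" by (simp flip: power_mult_distrib)
    then show "4 * (C * n) / 4 ^ j * (2 * \<rho> j * ?s j) =
      4 * (2 * C / 2 ^ j * ?s j)"
      using n by (simp add: \<rho>_def)
  qed
  also have "\<dots> = 4 * (\<Sum>j\<le>J. 2 * C / 2 ^ j * ?s j)" (is "_ = 4 * ?S")
    by (simp add: sum_distrib_left)
  finally have "norm (integral ?I (\<lambda>y. trig_sum M p (x - y) * f y)) \<le> 4 * ?S" .
  also have "\<dots> \<le> 2 * pi * ?S"
    using C pi_gt3 by (intro mult_right_mono sum_nonneg) auto
  finally show ?thesis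
    by (simp add: fourier_multiplier_kernel[OF per L1] field_simps)
qed

text \<open>The discrete form of \<open>\<bar>P\<bar>, \<bar>P''\<bar> \<le> C / (1 + t\<^sup>2)\<close> for \<open>p k = P (k / n)\<close>.\<close>

definition decaying_symbol :: "nat \<Rightarrow> real \<Rightarrow> (int \<Rightarrow> complex) \<Rightarrow> bool" where
  "decaying_symbol n C p \<longleftrightarrow> (\<forall>k. (1 + (of_int k / real n)\<^sup>2) * norm (p k) \<le> C \<and>
     (real n)\<^sup>2 * (1 + (of_int k / real n)\<^sup>2) * norm (p (k + 2) - 2 * p (k + 1) + p k) \<le> C)"

lemma decaying_symbol_nonneg:
  assumes "decaying_symbol n C p" shows "0 \<le> C"
proof -
  have "norm (p 0) \<le> C" using assms[unfolded decaying_symbol_def, rule_format, of 0] by simp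
  then show ?thesis by (rule order_trans[OF norm_ge_zero])
qed

text \<open>The subtracted term makes the induction work: it telescopes by
  \<open>1 / (n\<^sup>2 + k\<^sup>2) \<le> 2 / (n + k)\<^sup>2 \<le> 2 / (n + k - 1) - 2 / (n + k)\<close>.\<close>

lemma sum_decay_le:
  assumes n: "n \<ge> 1"
  shows "(\<Sum>k=-int L..int L. 1 / (1 + (of_int k / real n)\<^sup>2)) \<le> 5 * real n - 4 * (real n)\<^sup>2 / (real n + real L)"
proof (induction L)
  case 0 then show ?case using n by (simp add: power2_eq_square)
next
  case (Suc L)
  let ?w = "\<lambda>k. 1 / (1 + (of_int k / real n)\<^sup>2) :: real"
  have "{-int (Suc L)..int (Suc L)} = insert (-int (Suc L)) (insert (int (Suc L)) {-int L..int L})" by auto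
  then have "(\<Sum>k=-int (Suc L)..int (Suc L). ?w k) = 2 * ?w (int (Suc L)) + (\<Sum>k=-int L..int L. ?w k)"
    by (simp add: power_divide power2_minus[of "1 + real L", simplified])
  moreover have "?w (int (Suc L)) \<le> 2 * (real n)\<^sup>2 / (real n + real L) - 2 * (real n)\<^sup>2 / (real n + real (Suc L))"
  proof -
    define a where "a = real n"
    define b where "b = real L + 1"
    have a: "a \<ge> 1" "b \<ge> 1" using n by (auto simp: a_def b_def)
    have "0 \<le> (a - b)\<^sup>2" by simp
    then have "(a + b)\<^sup>2 \<le> 2 * (a\<^sup>2 + b\<^sup>2)" by (simp add: power2_eq_square algebra_simps)
    moreover have "(a + b - 1) * (a + b) \<le> (a + b)\<^sup>2" using a by (simp add: power2_eq_square mult_right_mono)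
    ultimately have le: "(a + b - 1) * (a + b) \<le> 2 * (a\<^sup>2 + b\<^sup>2)" by linarith
    have pos: "(a + b - 1) * (a + b) > 0" using a by (intro mult_pos_pos) auto
    have "?w (int (Suc L)) = a\<^sup>2 / (a\<^sup>2 + b\<^sup>2)"
      using a unfolding a_def b_def by (simp add: field_simps)
    also have "\<dots> = 2 * a\<^sup>2 / (2 * (a\<^sup>2 + b\<^sup>2))" by (subst mult_divide_mult_cancel_left) auto
    also have "\<dots> \<le> 2 * a\<^sup>2 / ((a + b - 1) * (a + b))"
      using le pos by (intro divide_left_mono) auto
    also have "\<dots> = 2 * a\<^sup>2 / (a + b - 1) - 2 * a\<^sup>2 / (a + b)"
      using a by (simp add: field_simps)
    finally show ?thesis by (simp add: a_def b_def add.assoc add.commute[of 1])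
  qed
  ultimately show ?case using Suc by linarith
qed

lemma sum_shift_int: "(\<Sum>k=a..b. g (k + c)) = (\<Sum>k=a + c..b + c. g (k::int))"
  by (rule sum.reindex_bij_witness[where i="\<lambda>k. k - c" and j="\<lambda>k. k + c"]) auto

lemma trig_sum_wider:
  assumes "\<And>k. \<bar>k\<bar> > int M \<Longrightarrow> p k = 0" "a \<le> -int M" "int M \<le> b"
  shows "(\<Sum>k=a..b. p k * cis (of_int k * z)) = trig_sum M p z"
  unfolding trig_sum_def by (rule sum.mono_neutral_right) (use assms in auto)

text \<open>Summation by parts, twice.  The range of summation is enlarged by two on each side, so that the
  shifted sums carry no boundary terms.\<close>

lemma trig_sum_abel:
  assumes "\<And>k. \<bar>k\<bar> > int M \<Longrightarrow> p k = 0"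
  shows "(1 - cis z)\<^sup>2 * trig_sum M p z
     = (\<Sum>k=-int (M+2)..int (M+2). (p (k + 2) - 2 * p (k + 1) + p k) * cis (of_int (k + 2) * z))"
proof -
  let ?A = "{-int (M+2)..int (M+2)}"
  have s: "(\<Sum>k\<in>?A. p (k + c) * cis (of_int (k + c) * z)) = trig_sum M p z" if "0 \<le> c" "c \<le> 2" for c
    unfolding sum_shift_int[of "\<lambda>k. p k * cis (of_int k * z)"]
    by (rule trig_sum_wider) (use assms that in auto)
  have c: "cis (of_int (k + 2) * z) = cis z * cis (of_int (k + 1) * z)"
       "cis (of_int (k + 2) * z) = (cis z)\<^sup>2 * cis (of_int (k + 0) * z)" for k
    by (simp_all add: cis_mult power2_eq_square algebra_simps)
  have "(\<Sum>k\<in>?A. (p (k + 2) - 2 * p (k + 1) + p k) * cis (of_int (k + 2) * z))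
     = (\<Sum>k\<in>?A. p (k + 2) * cis (of_int (k + 2) * z))
       - 2 * cis z * (\<Sum>k\<in>?A. p (k + 1) * cis (of_int (k + 1) * z))
       + (cis z)\<^sup>2 * (\<Sum>k\<in>?A. p (k + 0) * cis (of_int (k + 0) * z))"
    unfolding sum_distrib_left sum_subtractf[symmetric] sum.distrib[symmetric]
  proof (intro sum.cong refl)
    fix k
    show "(p (k + 2) - 2 * p (k + 1) + p k) * cis (of_int (k + 2) * z) =
       p (k + 2) * cis (of_int (k + 2) * z) - 2 * cis z * (p (k + 1) * cis (of_int (k + 1) * z))
       + (cis z)\<^sup>2 * (p (k + 0) * cis (of_int (k + 0) * z))"
      using c[of k] by (simp add: algebra_simps)
  qed
  then show ?thesis by (simp only: s) (simp add: power2_eq_square algebra_simps s)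
qed

text \<open>A Jordan-type inequality for \<open>\<bar>1 - e\<^bsup>iz\<^esup>\<bar> = 2 \<bar>sin (z/2)\<bar>\<close>: near \<open>0\<close> by the mean value theorem, and
  elsewhere because the sine stays above \<open>sin (\<pi>/4)\<close>.\<close>

lemma norm_one_minus_cis:
  assumes z: "\<bar>z\<bar> \<le> pi"
  shows "z\<^sup>2 \<le> 8 * (norm (1 - cis z))\<^sup>2"
proof -
  have "norm (1 - cis z) = 2 * \<bar>sin (z/2)\<bar>"
    using dist_exp_i_1[of z] by (simp add: cis_conv_exp norm_minus_commute)
  then have *: "(norm (1 - cis z))\<^sup>2 = 4 * (sin \<bar>z/2\<bar>)\<^sup>2"
    by (simp add: power_mult_distrib abs_if)
  define y where "y = \<bar>z/2\<bar>"
  have y: "0 \<le> y" "y \<le> pi/2" using z by (auto simp: y_def)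
  have "y\<^sup>2 \<le> 8 * (sin y)\<^sup>2"
  proof (cases "y \<le> pi/4")
    case True
    have "y * cos (pi/4) \<le> sin y"
    proof (cases "y = 0")
      case False
      then have "0 < y" using y by simp
      then obtain \<xi> where "0 < \<xi>" "\<xi> < y" "sin y - sin 0 = (y - 0) * cos \<xi>"
        using MVT2[of 0 y sin cos] by auto
      moreover have "cos (pi/4) \<le> cos \<xi>"
        using calculation True by (intro cos_monotone_0_pi_le) auto
      ultimately show ?thesis using y by (simp add: mult_left_mono)
    qed simp
    then have "(y * cos (pi/4))\<^sup>2 \<le> (sin y)\<^sup>2"
      using y by (intro power_mono mult_nonneg_nonneg) (auto simp: cos_45)
    then have "y\<^sup>2 \<le> 2 * (sin y)\<^sup>2" by (simp add: power_mult_distrib cos_45 power_divide)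
    then show ?thesis using zero_le_power2[of "sin y"] by linarith
  next
    case False
    have "sin (pi/4) \<le> sin y" using False y by (intro sin_monotone_2pi_le) auto
    then have "(sin (pi/4))\<^sup>2 \<le> (sin y)\<^sup>2" by (intro power_mono) (auto simp: sin_45)
    then have "1/2 \<le> (sin y)\<^sup>2" by (simp add: sin_45 power_divide)
    moreover have "y\<^sup>2 \<le> 2\<^sup>2" using y pi_less_4 by (intro power_mono) auto
    ultimately show ?thesis by simp
  qed
  then have "(z/2)\<^sup>2 \<le> 8 * (sin \<bar>z/2\<bar>)\<^sup>2" unfolding y_def power2_abs .
  then show ?thesis unfolding * by (simp add: power_divide)
qed

text \<open>The trivial estimate by the sum of the absolute values handles \<open>\<bar>z\<bar> \<le> 1/n\<close>; summation by parts
  handles the rest.\<close>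

lemma decaying_symbol_kernel:
  assumes n: "n \<ge> 1" and d: "decaying_symbol n C p" and supp: "\<And>k. \<bar>k\<bar> > int M \<Longrightarrow> p k = 0"
    and z: "\<bar>z\<bar> \<le> pi"
  shows "norm (trig_sum M p z) * (1 + (real n * z)\<^sup>2) \<le> 45 * C * real n"
proof -
  let ?w = "\<lambda>k. 1 / (1 + (of_int k / real n)\<^sup>2) :: real"
  have w0: "1 + (of_int k / real n)\<^sup>2 > 0" for k :: int by (simp add: add_pos_nonneg)
  have C: "0 \<le> C" by (rule decaying_symbol_nonneg[OF d])
  have sw: "(\<Sum>k=-int L..int L. ?w k) \<le> 5 * real n" for L
  proof -
    have "0 \<le> 4 * (real n)\<^sup>2 / (real n + real L)" by simp
    then show ?thesis using sum_decay_le[OF n, of L] by linarith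
  qed
  have p1: "norm (p k) \<le> C * ?w k" for k
    using d w0[of k] unfolding decaying_symbol_def by (simp add: field_simps)
  have p2: "norm (p (k + 2) - 2 * p (k + 1) + p k) \<le> C / (real n)\<^sup>2 * ?w k" for k
  proof -
    have "(real n)\<^sup>2 * (1 + (of_int k / real n)\<^sup>2) > 0" using w0[of k] n by simp
    moreover have "(real n)\<^sup>2 * (1 + (of_int k / real n)\<^sup>2) * norm (p (k + 2) - 2 * p (k + 1) + p k) \<le> C"
      using d unfolding decaying_symbol_def by blast
    ultimately have "norm (p (k + 2) - 2 * p (k + 1) + p k) \<le> C / ((real n)\<^sup>2 * (1 + (of_int k / real n)\<^sup>2))"
      by (simp add: pos_le_divide_eq mult.commute)
    then show ?thesis by simp
  qed
  have "norm (trig_sum M p z) \<le> (\<Sum>k=-int M..int M. C * ?w k)"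
    unfolding trig_sum_def by (rule sum_norm_le) (use p1 in \<open>simp add: norm_mult\<close>)
  also have "\<dots> \<le> C * (5 * real n)"
    unfolding sum_distrib_left[symmetric] using C sw by (rule mult_left_mono[rotated])
  finally have A: "norm (trig_sum M p z) \<le> 5 * C * real n" by simp
  have abel: "(1 - cis z)\<^sup>2 * trig_sum M p z
     = (\<Sum>k=-int (M+2)..int (M+2). (p (k + 2) - 2 * p (k + 1) + p k) * cis (of_int (k + 2) * z))"
    by (rule trig_sum_abel) (rule supp)
  have "(norm (1 - cis z))\<^sup>2 * norm (trig_sum M p z) = norm ((1 - cis z)\<^sup>2 * trig_sum M p z)"
    by (simp add: norm_mult norm_power)
  also have "\<dots> \<le> (\<Sum>k=-int (M+2)..int (M+2). C / (real n)\<^sup>2 * ?w k)"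
    unfolding abel by (rule sum_norm_le) (use p2 in \<open>simp add: norm_mult\<close>)
  also have "\<dots> \<le> C / (real n)\<^sup>2 * (5 * real n)"
    unfolding sum_distrib_left[symmetric] by (rule mult_left_mono[OF sw]) (use C in simp)
  finally have B: "(norm (1 - cis z))\<^sup>2 * norm (trig_sum M p z) \<le> C / (real n)\<^sup>2 * (5 * real n)" .
  have "norm (trig_sum M p z) * (real n * z)\<^sup>2 = (real n)\<^sup>2 * (z\<^sup>2 * norm (trig_sum M p z))"
    by (simp add: power_mult_distrib)
  also have "\<dots> \<le> (real n)\<^sup>2 * ((8 * (norm (1 - cis z))\<^sup>2) * norm (trig_sum M p z))"
    by (intro mult_left_mono mult_right_mono norm_one_minus_cis z) auto
  also have "\<dots> \<le> (real n)\<^sup>2 * (8 * (C / (real n)\<^sup>2 * (5 * real n)))"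
    using B by (intro mult_left_mono) auto
  also have "\<dots> = 40 * C * real n" using n by simp
  finally have "norm (trig_sum M p z) * (real n * z)\<^sup>2 \<le> 40 * C * real n" .
  moreover have "0 \<le> C * real n" using C by simp
  ultimately show ?thesis using A by (simp add: distrib_left)
qed

section \<open>Slowly varying symbols\<close>

text \<open>The model is \<open>p k = P (k / n)\<close> with \<open>P\<close> bounded together with its first derivative and with a
  Lipschitz first derivative.\<close>

definition varies_slowly :: "nat \<Rightarrow> real \<Rightarrow> (int \<Rightarrow> complex) \<Rightarrow> bool" where
  "varies_slowly n C p \<longleftrightarrow> (\<forall>k. norm (p k) \<le> C \<and> real n * norm (p (k + 1) - p k) \<le> C \<and>
     (real n)\<^sup>2 * norm (p (k + 2) - 2 * p (k + 1) + p k) \<le> C)"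

text \<open>The parameter \<open>M\<close> serves to truncate a symbol at a frequency much larger than the scale \<open>n\<close>, with
  estimates uniform in the truncation.\<close>

definition slowly_varying :: "(nat \<Rightarrow> nat \<Rightarrow> int \<Rightarrow> complex) \<Rightarrow> bool" where
  "slowly_varying p \<longleftrightarrow> (\<exists>C\<ge>0. \<forall>n M. 1 \<le> n \<longrightarrow> n \<le> M \<longrightarrow> varies_slowly n C (p n M))"

lemma varies_slowlyD:
  assumes "varies_slowly n C p"
  shows "norm (p k) \<le> C" "real n * norm (p (k + 1) - p k) \<le> C"
    "(real n)\<^sup>2 * norm (p (k + 2) - 2 * p (k + 1) + p k) \<le> C"
  using assms by (auto simp: varies_slowly_def)

lemma slowly_varyingI:
  assumes "\<And>n M k. 1 \<le> n \<Longrightarrow> n \<le> M \<Longrightarrow> norm (p n M k) \<le> A"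
    and "\<And>n M k. 1 \<le> n \<Longrightarrow> n \<le> M \<Longrightarrow> real n * norm (p n M (k + 1) - p n M k) \<le> B"
    and "\<And>n M k. 1 \<le> n \<Longrightarrow> n \<le> M \<Longrightarrow>
       (real n)\<^sup>2 * norm (p n M (k + 2) - 2 * p n M (k + 1) + p n M k) \<le> C"
  shows "slowly_varying p"
  unfolding slowly_varying_def varies_slowly_def
  by (rule exI[of _ "max 0 (max A (max B C))"]) (use assms in \<open>auto simp: le_max_iff_disj\<close>)

text \<open>The step \<open>\<sigma> n M\<close> is \<open>\<gamma> / n\<close> for the symbols of averages and also \<open>1 / M\<close> for truncations.\<close>

lemma slowly_varying_sample:
  fixes P :: "real \<Rightarrow> complex"
  assumes P: "\<And>t. norm (P t) \<le> K" "\<And>s t. norm (P s - P t) \<le> K * \<bar>s - t\<bar>"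
      "\<And>t d. norm (P (t + 2 * d) - 2 * P (t + d) + P t) \<le> K * d\<^sup>2"
    and \<sigma>: "\<And>n M. 1 \<le> n \<Longrightarrow> n \<le> M \<Longrightarrow> real n * \<bar>\<sigma> n M\<bar> \<le> A"
  shows "slowly_varying (\<lambda>n M k. P (c + of_int k * \<sigma> n M))"
proof (rule slowly_varyingI[where A=K and B="K * A" and C="K * A\<^sup>2"])
  fix n M :: nat and k :: int assume n: "1 \<le> n" "n \<le> M"
  have K: "0 \<le> K" using P(1)[of 0] order_trans[OF norm_ge_zero] by blast
  define x where "x = c + of_int k * \<sigma> n M"
  define d where "d = \<sigma> n M"
  have nd: "real n * \<bar>d\<bar> \<le> A" using \<sigma>[OF n] by (simp add: d_def)
  have e: "c + of_int (k + 1) * \<sigma> n M = x + d" "c + of_int (k + 2) * \<sigma> n M = x + 2 * d"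
    "c + of_int k * \<sigma> n M = x"
    by (simp_all add: x_def d_def algebra_simps)
  have "real n * norm (P (x + d) - P x) \<le> real n * (K * \<bar>d\<bar>)"
    using P(2)[of "x + d" x] by (intro mult_left_mono) auto
  also have "\<dots> \<le> K * A" using mult_left_mono[OF nd K] by (simp add: mult_ac)
  finally show "real n * norm (P (c + of_int (k + 1) * \<sigma> n M) - P (c + of_int k * \<sigma> n M)) \<le> K * A"
    unfolding e .
  have "(real n)\<^sup>2 * norm (P (x + 2 * d) - 2 * P (x + d) + P x) \<le> (real n)\<^sup>2 * (K * d\<^sup>2)"
    by (intro mult_left_mono P) auto
  also have "\<dots> = K * (real n * \<bar>d\<bar>)\<^sup>2" by (simp add: power_mult_distrib)
  also have "\<dots> \<le> K * A\<^sup>2" using nd K by (intro mult_left_mono power_mono) auto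
  finally show "(real n)\<^sup>2 * norm (P (c + of_int (k + 2) * \<sigma> n M) - 2 * P (c + of_int (k + 1) * \<sigma> n M) + P (c + of_int k * \<sigma> n M)) \<le> K * A\<^sup>2"
    unfolding e .
qed (rule P(1))

lemma slowly_varying_const: "slowly_varying (\<lambda>n M k. c)"
  by (rule slowly_varyingI[where A="norm c" and B=0 and C=0]) auto

lemma slowly_varying_add:
  assumes "slowly_varying p" "slowly_varying q"
  shows "slowly_varying (\<lambda>n M k. p n M k + q n M k)"
proof -
  obtain C where C0: "C \<ge> 0" "\<And>n M. 1 \<le> n \<Longrightarrow> n \<le> M \<Longrightarrow> varies_slowly n C (p n M)"
    using assms(1) unfolding slowly_varying_def by blast
  note C = C0(1) varies_slowlyD(1)[OF C0(2)] varies_slowlyD(2)[OF C0(2)] varies_slowlyD(3)[OF C0(2)]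
  obtain D where D0: "D \<ge> 0" "\<And>n M. 1 \<le> n \<Longrightarrow> n \<le> M \<Longrightarrow> varies_slowly n D (q n M)"
    using assms(2) unfolding slowly_varying_def by blast
  note D = D0(1) varies_slowlyD(1)[OF D0(2)] varies_slowlyD(2)[OF D0(2)] varies_slowlyD(3)[OF D0(2)]
  have tri: "w * norm (x + y) \<le> a + b"
    if "w * norm x \<le> a" "w * norm y \<le> b" "0 \<le> w" for w a b and x y :: complex
  proof -
    have "w * norm (x + y) \<le> w * (norm x + norm y)"
      using that(3) by (intro mult_left_mono norm_triangle_ineq)
    then show ?thesis using that by (simp add: distrib_left)
  qed
  show ?thesis
  proof (rule slowly_varyingI[where A="C+D" and B="C+D" and C="C+D"])
    fix n M :: nat and k :: int assume n: "1 \<le> n" "n \<le> M"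
    show "norm (p n M k + q n M k) \<le> C + D"
      using tri[of 1] C(2) D(2) n by simp
    show "real n * norm (p n M (k + 1) + q n M (k + 1) - (p n M k + q n M k)) \<le> C + D"
      using tri[OF C(3)[OF n, of k] D(3)[OF n, of k]] by (simp add: algebra_simps)
    show "(real n)\<^sup>2 * norm (p n M (k + 2) + q n M (k + 2) - 2 * (p n M (k + 1) + q n M (k + 1)) + (p n M k + q n M k)) \<le> C + D"
      using tri[OF C(4)[OF n, of k] D(4)[OF n, of k]] by (simp add: algebra_simps)
  qed
qed

text \<open>With \<open>\<Delta>\<close> the forward difference, the discrete Leibniz rule reads
  \<open>\<Delta>\<^sup>2 (p q)\<^sub>k = p\<^sub>k\<^sub>+\<^sub>2 \<Delta>\<^sup>2 q\<^sub>k + 2 \<Delta> p\<^sub>k\<^sub>+\<^sub>1 \<Delta> q\<^sub>k + \<Delta>\<^sup>2 p\<^sub>k q\<^sub>k\<close>.\<close>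

lemma slowly_varying_mult:
  assumes "slowly_varying p" "slowly_varying q"
  shows "slowly_varying (\<lambda>n M k. p n M k * q n M k)"
proof -
  obtain C where C0: "C \<ge> 0" "\<And>n M. 1 \<le> n \<Longrightarrow> n \<le> M \<Longrightarrow> varies_slowly n C (p n M)"
    using assms(1) unfolding slowly_varying_def by blast
  note C = C0(1) varies_slowlyD(1)[OF C0(2)] varies_slowlyD(2)[OF C0(2)] varies_slowlyD(3)[OF C0(2)]
  obtain D where D0: "D \<ge> 0" "\<And>n M. 1 \<le> n \<Longrightarrow> n \<le> M \<Longrightarrow> varies_slowly n D (q n M)"
    using assms(2) unfolding slowly_varying_def by blast
  note D = D0(1) varies_slowlyD(1)[OF D0(2)] varies_slowlyD(2)[OF D0(2)] varies_slowlyD(3)[OF D0(2)]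
  show ?thesis
  proof (rule slowly_varyingI[where A="C*D" and B="2*(C*D)" and C="4*(C*D)"])
    fix n M :: nat and k :: int assume n: "1 \<le> n" "n \<le> M"
    show "norm (p n M k * q n M k) \<le> C * D"
      using C D n by (simp add: norm_mult mult_mono)
    define \<nu> where "\<nu> = real n"
    have \<nu>: "\<nu> \<ge> 0" by (simp add: \<nu>_def)
    define P0 P1 P2 Q0 Q1 Q2 where defs: "P0 = p n M k" "P1 = p n M (k+1)" "P2 = p n M (k+2)"
       "Q0 = q n M k" "Q1 = q n M (k+1)" "Q2 = q n M (k+2)"
    have b: "norm P0 \<le> C" "norm P1 \<le> C" "norm P2 \<le> C" "norm Q0 \<le> D" "norm Q1 \<le> D"
      using C(2) D(2) n by (auto simp: defs)
    have d: "\<nu> * norm (P1 - P0) \<le> C" "\<nu> * norm (P2 - P1) \<le> C" "\<nu> * norm (Q1 - Q0) \<le> D"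
      using C(3)[OF n, of k] C(3)[OF n, of "k+1"] D(3)[OF n, of k] by (auto simp: defs \<nu>_def add.commute)
    have dd: "\<nu>\<^sup>2 * norm (P2 - 2 * P1 + P0) \<le> C" "\<nu>\<^sup>2 * norm (Q2 - 2 * Q1 + Q0) \<le> D"
      using C(4)[OF n, of k] D(4)[OF n, of k] by (auto simp: defs \<nu>_def)
    have "\<nu> * norm (P1 * Q1 - P0 * Q0) = \<nu> * norm (P1 * (Q1 - Q0) + (P1 - P0) * Q0)"
      by (simp add: algebra_simps)
    also have "\<dots> \<le> \<nu> * (norm P1 * norm (Q1 - Q0) + norm (P1 - P0) * norm Q0)"
      using \<nu> by (intro mult_left_mono) (metis norm_mult norm_triangle_ineq)
    also have "\<dots> = norm P1 * (\<nu> * norm (Q1 - Q0)) + (\<nu> * norm (P1 - P0)) * norm Q0"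
      by (simp add: algebra_simps)
    also have "\<dots> \<le> C * D + C * D"
      by (intro add_mono mult_mono) (use b d C(1) D(1) \<nu> in auto)
    finally show "real n * norm (p n M (k + 1) * q n M (k + 1) - p n M k * q n M k) \<le> 2 * (C * D)"
      by (simp add: defs \<nu>_def)
    have "\<nu>\<^sup>2 * norm (P2 * Q2 - 2 * (P1 * Q1) + P0 * Q0)
       = \<nu>\<^sup>2 * norm (P2 * (Q2 - 2 * Q1 + Q0) + 2 * ((P2 - P1) * (Q1 - Q0)) + (P2 - 2 * P1 + P0) * Q0)"
      by (simp add: algebra_simps)
    also have "\<dots> \<le> \<nu>\<^sup>2 * (norm P2 * norm (Q2 - 2 * Q1 + Q0) + 2 * (norm (P2 - P1) * norm (Q1 - Q0)) + norm (P2 - 2 * P1 + P0) * norm Q0)"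
      by (intro mult_left_mono norm_triangle_le add_mono) (auto simp: norm_mult)
    also have "\<dots> = norm P2 * (\<nu>\<^sup>2 * norm (Q2 - 2 * Q1 + Q0)) + 2 * ((\<nu> * norm (P2 - P1)) * (\<nu> * norm (Q1 - Q0))) + (\<nu>\<^sup>2 * norm (P2 - 2 * P1 + P0)) * norm Q0"
      by (simp add: algebra_simps power2_eq_square)
    also have "\<dots> \<le> C * D + 2 * (C * D) + C * D"
      by (intro add_mono mult_mono) (use b d dd C(1) D(1) \<nu> in auto)
    finally show "(real n)\<^sup>2 * norm (p n M (k + 2) * q n M (k + 2) - 2 * (p n M (k + 1) * q n M (k + 1)) + p n M k * q n M k) \<le> 4 * (C * D)"
      by (simp add: defs \<nu>_def)
  qed
qed

lemma slowly_varying_cmult: "slowly_varying p \<Longrightarrow> slowly_varying (\<lambda>n M k. c * p n M k)"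
  by (intro slowly_varying_mult slowly_varying_const)

lemma slowly_varying_diff:
  assumes "slowly_varying p" "slowly_varying q"
  shows "slowly_varying (\<lambda>n M k. p n M k - q n M k)"
  using slowly_varying_add[OF assms(1) slowly_varying_cmult[OF assms(2), of "-1"]] by simp

lemma slowly_varying_power: "slowly_varying p \<Longrightarrow> slowly_varying (\<lambda>n M k. p n M k ^ s)"
  by (induction s) (simp_all add: slowly_varying_const slowly_varying_mult)

text \<open>For \<open>q = 1 / p\<close> the Leibniz rule applied to \<open>p q = 1\<close> has left-hand side \<open>0\<close> and can be solved for \<open>\<Delta>\<^sup>2 q\<close>.\<close>

lemma slowly_varying_inverse:
  assumes "slowly_varying p" and c: "c > 0"
    and low: "\<And>n M k. 1 \<le> n \<Longrightarrow> n \<le> M \<Longrightarrow> c \<le> norm (p n M k)"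
  shows "slowly_varying (\<lambda>n M k. 1 / p n M k)"
proof -
  obtain C where C0: "C \<ge> 0" "\<And>n M. 1 \<le> n \<Longrightarrow> n \<le> M \<Longrightarrow> varies_slowly n C (p n M)"
    using assms(1) unfolding slowly_varying_def by blast
  note C = C0(1) varies_slowlyD(1)[OF C0(2)] varies_slowlyD(2)[OF C0(2)] varies_slowlyD(3)[OF C0(2)]
  define D where "D = C / c\<^sup>2"
  show ?thesis
  proof (rule slowly_varyingI[where A="1/c" and B=D and C="(2 * (C * D) + C * (1/c)) / c"])
    fix n M :: nat and k :: int assume n: "1 \<le> n" "n \<le> M"
    have inv: "norm (1 / p n M j) \<le> 1 / c" for j
      using low[OF n, of j] c by (simp add: norm_divide frac_le)
    then show "norm (1 / p n M k) \<le> 1 / c" .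
    define \<nu> where "\<nu> = real n"
    have \<nu>: "\<nu> \<ge> 0" by (simp add: \<nu>_def)
    have nz: "p n M j \<noteq> 0" for j using low[OF n, of j] c by auto
    have first: "\<nu> * norm (1 / p n M (j+1) - 1 / p n M j) \<le> D" for j
    proof -
      have "\<nu> * norm (1 / p n M (j+1) - 1 / p n M j)
          = (\<nu> * norm (p n M (j+1) - p n M j)) * (norm (1 / p n M (j+1)) * norm (1 / p n M j))"
        using nz[of j] nz[of "j+1"] by (simp add: diff_frac_eq norm_divide norm_mult norm_minus_commute)
      also have "\<dots> \<le> C * ((1/c) * (1/c))"
        using C(3)[OF n, of j] inv[of j] inv[of "j+1"] c C(1) \<nu>
        by (intro mult_mono) (auto simp: \<nu>_def)
      finally show ?thesis by (simp add: D_def power2_eq_square)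
    qed
    show "real n * norm (1 / p n M (k + 1) - 1 / p n M k) \<le> D"
      using first[of k] by (simp add: \<nu>_def)
    define P0 P1 P2 Q0 Q1 Q2 where defs: "P0 = p n M k" "P1 = p n M (k+1)" "P2 = p n M (k+2)"
       "Q0 = 1 / p n M k" "Q1 = 1 / p n M (k+1)" "Q2 = 1 / p n M (k+2)"
    have one: "P0 * Q0 = 1" "P1 * Q1 = 1" "P2 * Q2 = 1" using nz by (auto simp: defs)
    have "P2 * (Q2 - 2 * Q1 + Q0) = - (2 * ((P2 - P1) * (Q1 - Q0)) + (P2 - 2 * P1 + P0) * Q0)"
      using one by algebra
    then have "c * norm (Q2 - 2 * Q1 + Q0) \<le> norm (2 * ((P2 - P1) * (Q1 - Q0)) + (P2 - 2 * P1 + P0) * Q0)"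
      using low[OF n, of "k+2"] by (metis defs(3) mult_right_mono norm_ge_zero norm_minus_cancel norm_mult)
    also have "\<dots> \<le> 2 * (norm (P2 - P1) * norm (Q1 - Q0)) + norm (P2 - 2 * P1 + P0) * norm Q0"
      by (intro norm_triangle_le add_mono) (auto simp: norm_mult)
    finally have "\<nu>\<^sup>2 * (c * norm (Q2 - 2 * Q1 + Q0)) \<le> \<nu>\<^sup>2 * (2 * (norm (P2 - P1) * norm (Q1 - Q0)) + norm (P2 - 2 * P1 + P0) * norm Q0)"
      by (intro mult_left_mono) auto
    also have "\<dots> = 2 * ((\<nu> * norm (P2 - P1)) * (\<nu> * norm (Q1 - Q0))) + (\<nu>\<^sup>2 * norm (P2 - 2 * P1 + P0)) * norm Q0"
      by (simp add: algebra_simps power2_eq_square)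
    also have "\<dots> \<le> 2 * (C * D) + C * (1/c)"
    proof (intro add_mono mult_mono)
      show "\<nu> * norm (P2 - P1) \<le> C" using C(3)[OF n, of "k+1"] by (simp add: defs \<nu>_def add.commute)
      show "\<nu> * norm (Q1 - Q0) \<le> D" using first[of k] by (simp add: defs)
      show "\<nu>\<^sup>2 * norm (P2 - 2 * P1 + P0) \<le> C" using C(4)[OF n, of k] by (simp add: defs \<nu>_def)
      show "norm Q0 \<le> 1/c" using inv by (simp add: defs)
    qed (use C(1) \<nu> in auto)
    finally have "\<nu>\<^sup>2 * norm (Q2 - 2 * Q1 + Q0) * c \<le> 2 * (C * D) + C * (1/c)"
      by (simp add: algebra_simps)
    then show "(real n)\<^sup>2 * norm (1 / p n M (k + 2) - 2 * (1 / p n M (k + 1)) + 1 / p n M k)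
        \<le> (2 * (C * D) + C * (1/c)) / c"
      unfolding pos_le_divide_eq[OF c] by (simp add: defs \<nu>_def)
  qed
qed

text \<open>The second difference of \<open>t\<^sup>2 p\<close>, where \<open>t = k / n\<close>, is \<open>t\<^sup>2\<close> times that of \<open>p\<close> up to terms controlled
  by \<open>p\<close> and by the first difference of \<open>t p\<close>.\<close>

lemma decaying_symbol_of_slowly_varying:
  assumes "slowly_varying p" "slowly_varying (\<lambda>n M k. (of_int k / of_nat n) * p n M k)"
    "slowly_varying (\<lambda>n M k. (of_int k / of_nat n)\<^sup>2 * p n M k)"
  shows "\<exists>C. \<forall>n\<ge>1. \<forall>M\<ge>n. decaying_symbol n C (p n M)"
proof -
  define t :: "nat \<Rightarrow> int \<Rightarrow> complex" where "t n k = of_int k / of_nat n" for n k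
  obtain C where C0: "C \<ge> 0" "\<And>n M. 1 \<le> n \<Longrightarrow> n \<le> M \<Longrightarrow> varies_slowly n C (p n M)"
    using assms(1) unfolding slowly_varying_def by blast
  note C = C0(1) varies_slowlyD(1)[OF C0(2)] varies_slowlyD(3)[OF C0(2)]
  obtain D where D0: "D \<ge> 0" "\<And>n M. 1 \<le> n \<Longrightarrow> n \<le> M \<Longrightarrow> varies_slowly n D (\<lambda>k. t n k * p n M k)"
    using assms(2) unfolding slowly_varying_def t_def by blast
  note D = D0(1) varies_slowlyD(2)[OF D0(2)]
  obtain E where E0: "E \<ge> 0" "\<And>n M. 1 \<le> n \<Longrightarrow> n \<le> M \<Longrightarrow> varies_slowly n E (\<lambda>k. (t n k)\<^sup>2 * p n M k)"
    using assms(3) unfolding slowly_varying_def t_def by blast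
  note E = E0(1) varies_slowlyD(1)[OF E0(2)] varies_slowlyD(3)[OF E0(2)]
  have "decaying_symbol n (E + 4 * D + 20 * C) (p n M)" if n: "1 \<le> n" "n \<le> M" for n M
    unfolding decaying_symbol_def
  proof (intro allI conjI)
    fix k
    define r where "r = (of_int k / real n)\<^sup>2"
    have r: "r = (norm (t n k))\<^sup>2" by (simp add: r_def t_def norm_divide power_divide)
    have "(1 + r) * norm (p n M k) = norm (p n M k) + norm ((t n k)\<^sup>2 * p n M k)"
      by (simp add: r norm_mult norm_power algebra_simps)
    also have "\<dots> \<le> C + E" using C(2) E(2) n by (intro add_mono) auto
    finally show "(1 + r) * norm (p n M k) \<le> E + 4 * D + 20 * C" using C(1) D(1) by linarith
    define \<nu> where "\<nu> = real n"
    have \<nu>: "\<nu> > 0" using n by (simp add: \<nu>_def)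
    define P0 P1 P2 where defs: "P0 = p n M k" "P1 = p n M (k+1)" "P2 = p n M (k+2)"
    have t12: "t n (k+1) = t n k + 1 / \<nu>" "t n (k+2) = t n k + 2 / \<nu>"
      using n by (simp_all add: t_def \<nu>_def add_divide_distrib)
    let ?u = "complex_of_real (1 / \<nu>)"
    define X where "X = (t n (k+2))\<^sup>2 * P2 - 2 * ((t n (k+1))\<^sup>2 * P1) + (t n k)\<^sup>2 * P0"
    define Y where "Y = t n (k+2) * P2 - t n (k+1) * P1"
    define DD where "DD = P2 - 2 * P1 + P0"
    have t12': "t n (k+1) = t n k + ?u" "t n (k+2) = t n k + 2 * ?u" using t12 by simp_all
    have id: "(t n k)\<^sup>2 * DD = X - 4 * ?u * Y + ?u\<^sup>2 * (4 * P2 - 2 * P1)"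
      unfolding X_def Y_def DD_def t12' by (simp add: power2_eq_square algebra_simps)
    have "\<nu>\<^sup>2 * (r * norm DD) = \<nu>\<^sup>2 * norm ((t n k)\<^sup>2 * DD)"
      by (simp add: r norm_mult norm_power)
    also have "\<dots> \<le> \<nu>\<^sup>2 * (norm X + norm (4 * ?u * Y) + norm (?u\<^sup>2 * (4 * P2 - 2 * P1)))"
      unfolding id by (intro mult_left_mono order_trans[OF norm_triangle_ineq] add_mono norm_triangle_ineq4) auto
    also have "\<dots> = \<nu>\<^sup>2 * norm X + 4 * (\<nu> * norm Y) + norm (4 * P2 - 2 * P1)"
      using \<nu> by (simp add: norm_mult norm_power norm_divide power_divide power2_eq_square field_simps)
    also have "\<dots> \<le> E + 4 * D + 6 * C"
    proof (intro add_mono mult_left_mono)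
      show "\<nu>\<^sup>2 * norm X \<le> E" using E(3)[OF n, of k] by (simp add: X_def defs \<nu>_def)
      show "\<nu> * norm Y \<le> D" using D(2)[OF n, of "k+1"] by (simp add: Y_def defs \<nu>_def add.commute)
      have "norm (4 * P2 - 2 * P1) \<le> 4 * norm P2 + 2 * norm P1"
        by (rule order_trans[OF norm_triangle_ineq4]) (simp add: norm_mult)
      also have "\<dots> \<le> 6 * C" using C(2)[OF n, of "k+1"] C(2)[OF n, of "k+2"] by (simp add: defs)
      finally show "norm (4 * P2 - 2 * P1) \<le> 6 * C" .
    qed auto
    finally have "\<nu>\<^sup>2 * (r * norm DD) \<le> E + 4 * D + 6 * C" .
    moreover have "\<nu>\<^sup>2 * norm DD \<le> C" using C(3)[OF n, of k] by (simp add: DD_def defs \<nu>_def)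
    ultimately have "\<nu>\<^sup>2 * (1 + r) * norm DD \<le> E + 4 * D + 20 * C"
      using C(1) by (simp add: algebra_simps)
    then show "(real n)\<^sup>2 * (1 + r) * norm (p n M (k + 2) - 2 * p n M (k + 1) + p n M k) \<le> E + 4 * D + 20 * C"
      by (simp add: DD_def defs \<nu>_def)
  qed
  then show ?thesis by blast
qed

text \<open>On the support, enlarged by two for the second difference, \<open>\<bar>k / n\<bar> \<le> 3\<close>, so that the weight
  \<open>1 + (k / n)\<^sup>2\<close> is at most \<open>10\<close>.\<close>

lemma decaying_symbol_of_band_limited:
  assumes "slowly_varying p" and supp: "\<And>n M k. 1 \<le> n \<Longrightarrow> n \<le> M \<Longrightarrow> \<bar>k\<bar> > int n \<Longrightarrow> p n M k = 0"
  shows "\<exists>C. \<forall>n\<ge>1. \<forall>M\<ge>n. decaying_symbol n C (p n M)"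
proof -
  obtain C where C0: "C \<ge> 0" "\<And>n M. 1 \<le> n \<Longrightarrow> n \<le> M \<Longrightarrow> varies_slowly n C (p n M)"
    using assms(1) unfolding slowly_varying_def by blast
  note C = C0(1) varies_slowlyD(1)[OF C0(2)] varies_slowlyD(3)[OF C0(2)]
  have "decaying_symbol n (10 * C) (p n M)" if n: "1 \<le> n" "n \<le> M" for n M
    unfolding decaying_symbol_def
  proof (intro allI conjI)
    fix k
    have w: "1 + (of_int k / real n)\<^sup>2 \<le> 10" if "\<bar>k\<bar> \<le> int n + 2"
    proof -
      have "\<bar>of_int k / real n\<bar> \<le> 3"
        using that n by (simp add: field_simps)
      then have "\<bar>of_int k / real n\<bar>\<^sup>2 \<le> 3\<^sup>2" by (intro power_mono) auto
      then show ?thesis unfolding power2_abs by simp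
    qed
    show "(1 + (of_int k / real n)\<^sup>2) * norm (p n M k) \<le> 10 * C"
    proof (cases "\<bar>k\<bar> \<le> int n + 2")
      case True
      show ?thesis by (intro mult_mono w True C(2) n) auto
    next
      case False
      then show ?thesis using supp[OF n, of k] C(1) by simp
    qed
    show "(real n)\<^sup>2 * (1 + (of_int k / real n)\<^sup>2) * norm (p n M (k + 2) - 2 * p n M (k + 1) + p n M k) \<le> 10 * C"
    proof (cases "\<bar>k\<bar> \<le> int n + 2")
      case True
      have "(1 + (of_int k / real n)\<^sup>2) * ((real n)\<^sup>2 * norm (p n M (k + 2) - 2 * p n M (k + 1) + p n M k)) \<le> 10 * C"
        by (intro mult_mono w True C(3) n) auto
      then show ?thesis by (simp add: algebra_simps)
    next
      case False
      then show ?thesis using supp[OF n, of k] supp[OF n, of "k+1"] supp[OF n, of "k+2"] C(1) by simp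
    qed
  qed
  then show ?thesis by blast
qed

section \<open>Averages of exponentials and smooth cutoffs\<close>

lemma norm_cis_diff_le: "norm (cis x - cis y) \<le> \<bar>x - y\<bar>"
proof -
  have "cis x - cis y = cis y * (cis (x - y) - 1)" by (simp add: right_diff_distrib cis_mult)
  moreover have "norm (cis (x - y) - 1) = 2 * \<bar>sin ((x - y)/2)\<bar>"
    using dist_exp_i_1[of "x - y"] by (simp add: cis_conv_exp)
  moreover have "\<bar>sin ((x - y)/2)\<bar> \<le> \<bar>(x - y)/2\<bar>" by (rule abs_sin_x_le_abs_x)
  ultimately show ?thesis by (simp add: norm_mult)
qed

lemma norm_cis_second_diff_le: "norm (cis (x + 2 * d) - 2 * cis (x + d) + cis x) \<le> d\<^sup>2"
proof -
  have "cis (x + 2 * d) - 2 * cis (x + d) + cis x = cis x * (cis d - 1)\<^sup>2"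
    by (simp add: power2_eq_square algebra_simps cis_mult flip: mult.assoc)
  moreover have "norm (cis d - 1) \<le> \<bar>d\<bar>" using norm_cis_diff_le[of d 0] by simp
  then have "(norm (cis d - 1))\<^sup>2 \<le> \<bar>d\<bar>\<^sup>2" by (intro power_mono) auto
  ultimately show ?thesis by (simp add: norm_mult norm_power)
qed

lemma slowly_varying_cis: "slowly_varying (\<lambda>n M k. cis (of_int k * (\<gamma> / real n)))"
  using slowly_varying_sample[of cis 1 "\<lambda>n M. \<gamma> / real n" "\<bar>\<gamma>\<bar>" 0]
    norm_cis_diff_le norm_cis_second_diff_le by simp

lemma norm_weighted_integral_le:
  fixes g :: "real \<Rightarrow> complex"
  assumes \<rho>: "continuous_on {0..1} \<rho>" "\<And>u. u \<in> {0..1} \<Longrightarrow> \<bar>\<rho> u\<bar> \<le> 1"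
    and g: "continuous_on {0..1} g" "\<And>u. u \<in> {0..1} \<Longrightarrow> norm (g u) \<le> c"
  shows "norm (integral {0..1} (\<lambda>u. of_real (\<rho> u) * g u)) \<le> c"
proof -
  have "norm (integral {0..1} (\<lambda>u. of_real (\<rho> u) * g u)) \<le> c * (1 - 0)"
  proof (rule integral_bound)
    show "continuous_on {0..1} (\<lambda>u. of_real (\<rho> u) * g u)" by (intro continuous_intros \<rho> g)
    fix u :: real assume u: "u \<in> {0..1}"
    have "\<bar>\<rho> u\<bar> * norm (g u) \<le> 1 * c"
      by (rule mult_mono) (use \<rho>(2)[OF u] g(2)[OF u] in auto)
    then show "norm (of_real (\<rho> u) * g u) \<le> c" by (simp add: norm_mult)
  qed simp
  then show ?thesis by simp
qed

text \<open>The weights \<open>1\<close> and \<open>1 - u\<close> give the symbol of the forward average and the quotient of its defect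
  by the frequency.\<close>

definition weighted_exp_average :: "(real \<Rightarrow> real) \<Rightarrow> real \<Rightarrow> complex" where
  "weighted_exp_average \<rho> t = integral {0..1} (\<lambda>u. of_real (\<rho> u) * cis (t * u))"

lemma exp_average_weighted: "exp_average = weighted_exp_average (\<lambda>_. 1)"
  by (simp add: fun_eq_iff exp_average_def weighted_exp_average_def)

context
  fixes \<rho> :: "real \<Rightarrow> real"
  assumes \<rho>: "continuous_on {0..1} \<rho>" "\<And>u. u \<in> {0..1} \<Longrightarrow> \<bar>\<rho> u\<bar> \<le> 1"
begin

lemma weighted_exp_integrable: "(\<lambda>u. of_real (\<rho> u) * cis (t * u)) integrable_on {0..1}"
  by (intro integrable_continuous_real continuous_intros \<rho>)

lemma norm_weighted_exp_average: "norm (weighted_exp_average \<rho> t) \<le> 1"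
  unfolding weighted_exp_average_def
  by (rule norm_weighted_integral_le[OF \<rho>]) (auto intro!: continuous_intros)

lemma weighted_exp_average_lipschitz:
  "norm (weighted_exp_average \<rho> s - weighted_exp_average \<rho> t) \<le> \<bar>s - t\<bar>"
proof -
  have "weighted_exp_average \<rho> s - weighted_exp_average \<rho> t
     = integral {0..1} (\<lambda>u. of_real (\<rho> u) * (cis (s * u) - cis (t * u)))"
    unfolding weighted_exp_average_def right_diff_distrib
    by (rule Henstock_Kurzweil_Integration.integral_diff[symmetric]) (rule weighted_exp_integrable)+
  also have "norm \<dots> \<le> \<bar>s - t\<bar>"
  proof (rule norm_weighted_integral_le[OF \<rho>])
    fix u :: real assume u: "u \<in> {0..1}"
    have "norm (cis (s * u) - cis (t * u)) \<le> \<bar>s - t\<bar> * u"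
      using norm_cis_diff_le[of "s * u" "t * u"] u by (simp add: abs_mult flip: left_diff_distrib)
    also have "\<dots> \<le> \<bar>s - t\<bar> * 1" using u by (intro mult_left_mono) auto
    finally show "norm (cis (s * u) - cis (t * u)) \<le> \<bar>s - t\<bar>" by simp
  qed (auto intro!: continuous_intros)
  finally show ?thesis .
qed

text \<open>The second difference is taken under the integral sign.\<close>

lemma weighted_exp_average_second_diff:
  "norm (weighted_exp_average \<rho> (t + 2 * d) - 2 * weighted_exp_average \<rho> (t + d) + weighted_exp_average \<rho> t) \<le> d\<^sup>2"
proof -
  note i = weighted_exp_integrable
  have "((\<lambda>u. of_real (\<rho> u) * cis ((t + 2 * d) * u) - 2 * (of_real (\<rho> u) * cis ((t + d) * u)) + of_real (\<rho> u) * cis (t * u))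
    has_integral (weighted_exp_average \<rho> (t + 2 * d) - 2 * weighted_exp_average \<rho> (t + d) + weighted_exp_average \<rho> t)) {0..1}"
    unfolding weighted_exp_average_def
    by (intro has_integral_add has_integral_diff has_integral_mult_right integrable_integral i)
  then have "weighted_exp_average \<rho> (t + 2 * d) - 2 * weighted_exp_average \<rho> (t + d) + weighted_exp_average \<rho> t
    = integral {0..1} (\<lambda>u. of_real (\<rho> u) * (cis (t * u + 2 * (d * u)) - 2 * cis (t * u + d * u) + cis (t * u)))"
    by (simp add: has_integral_iff algebra_simps)
  also have "norm \<dots> \<le> d\<^sup>2"
  proof (rule norm_weighted_integral_le[OF \<rho>])
    fix u :: real assume u: "u \<in> {0..1}"
    have "norm (cis (t * u + 2 * (d * u)) - 2 * cis (t * u + d * u) + cis (t * u)) \<le> (d * u)\<^sup>2"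
      by (rule norm_cis_second_diff_le)
    also have "\<dots> \<le> d\<^sup>2 * 1" unfolding power_mult_distrib using u by (intro mult_left_mono power_le_one) auto
    finally show "norm (cis (t * u + 2 * (d * u)) - 2 * cis (t * u + d * u) + cis (t * u)) \<le> d\<^sup>2" by simp
  qed (auto intro!: continuous_intros)
  finally show ?thesis .
qed

lemma slowly_varying_weighted_exp_average:
  "slowly_varying (\<lambda>n M k. weighted_exp_average \<rho> (of_int k * (\<gamma> / real n)))"
  using slowly_varying_sample[of "weighted_exp_average \<rho>" 1 "\<lambda>n M. \<gamma> / real n" "\<bar>\<gamma>\<bar>" 0]
    norm_weighted_exp_average weighted_exp_average_lipschitz weighted_exp_average_second_diff by simp

end

definition exp_moment :: "real \<Rightarrow> complex" where
  "exp_moment = weighted_exp_average (\<lambda>u. 1 - u)"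

text \<open>The fundamental theorem of calculus for \<open>u \<mapsto> cis (t * u)\<close>.  The identity exhibits the decay of the symbol:
  the right-hand side is bounded.\<close>

lemma exp_average_times: "\<i> * t * exp_average t = cis t - 1"
proof -
  have "((\<lambda>u. \<i> * t * cis (t * u)) has_integral (cis (t * 1) - cis (t * 0))) {0..1}"
  proof (rule fundamental_theorem_of_calculus)
    fix x :: real
    have "((\<lambda>u. exp (\<i> * t * of_real u)) has_vector_derivative (\<i> * t * exp (\<i> * t * of_real x))) (at x within {0..1})"
      by (rule has_vector_derivative_real_field) (auto intro!: derivative_eq_intros)
    then show "((\<lambda>u. cis (t * u)) has_vector_derivative \<i> * t * cis (t * x)) (at x within {0..1})"
      by (simp add: cis_conv_exp mult.assoc)
  qed simp
  then have "integral {0..1} (\<lambda>u. \<i> * t * cis (t * u)) = cis (t * 1) - cis (t * 0)"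
    by (rule integral_unique)
  then show ?thesis by (simp add: exp_average_def)
qed

text \<open>Integration by parts.  The identity exhibits the simple zero of the symbol of \<open>I - \<dot>A\<^sub>h\<close> at
  frequency \<open>0\<close>.\<close>

lemma one_minus_exp_average: "1 - exp_average t = - \<i> * t * exp_moment t"
proof -
  have "((\<lambda>u. \<i> * t * (of_real (1 - u) * cis (t * u)) - cis (t * u)) has_integral
      (of_real (1 - 1) * cis (t * 1) - of_real (1 - 0) * cis (t * 0))) {0..1}"
  proof (rule fundamental_theorem_of_calculus)
    fix x :: real
    have "((\<lambda>u. (1 - of_real u) * exp (\<i> * t * of_real u)) has_vector_derivative
       (\<i> * t * ((1 - of_real x) * exp (\<i> * t * of_real x)) - exp (\<i> * t * of_real x))) (at x within {0..1})"
      by (rule has_vector_derivative_real_field) (auto intro!: derivative_eq_intros simp: algebra_simps)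
    then show "((\<lambda>u. of_real (1 - u) * cis (t * u)) has_vector_derivative
        \<i> * t * (of_real (1 - x) * cis (t * x)) - cis (t * x)) (at x within {0..1})"
      by (simp add: cis_conv_exp mult.assoc)
  qed simp
  then have 1: "integral {0..1} (\<lambda>u. \<i> * t * (of_real (1 - u) * cis (t * u)) - cis (t * u)) = -1"
    by (simp add: integral_unique)
  have "integral {0..1} (\<lambda>u. \<i> * t * (of_real (1 - u) * cis (t * u)) - cis (t * u))
     = \<i> * t * exp_moment t - exp_average t"
    unfolding exp_moment_def weighted_exp_average_def exp_average_def
    by (subst Henstock_Kurzweil_Integration.integral_diff)
       (auto intro!: integrable_continuous_real continuous_intros simp del: of_real_diff)
  with 1 show ?thesis by (simp add: algebra_simps) 
qed

lemma Re_exp_average: "t \<noteq> 0 \<Longrightarrow> Re (exp_average t) = sin t / t"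
  using arg_cong[OF exp_average_times[of t], of Im] by (simp add: field_simps)

lemma exp_average_0: "exp_average 0 = 1"
  by (simp add: exp_average_def)

lemma sin_less_self: "0 < x \<Longrightarrow> sin x < x" for x :: real
proof (cases "x \<le> 1")
  case True
  assume x: "0 < x"
  then obtain \<xi> where \<xi>: "0 < \<xi>" "\<xi> < x" "sin x - sin 0 = (x - 0) * cos \<xi>"
    using MVT2[of 0 x sin cos] by auto
  have "cos \<xi> < cos 0" using \<xi> True pi_gt3 by (intro cos_monotone_0_pi) auto
  then have "x * cos \<xi> < x * 1" using x by (intro mult_strict_left_mono) auto
  then show ?thesis using \<xi>(3) by simp
next
  case False
  then show ?thesis using sin_le_one[of x] by linarith
qed

lemma Re_exp_average_less: "t \<noteq> 0 \<Longrightarrow> Re (exp_average t) < 1"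
proof -
  assume t: "t \<noteq> 0"
  have "sin \<bar>t\<bar> < \<bar>t\<bar>" using t by (intro sin_less_self) auto
  moreover have "sin t / t = sin \<bar>t\<bar> / \<bar>t\<bar>" by (simp add: abs_if)
  ultimately show ?thesis using t by (simp add: Re_exp_average)
qed

lemma Re_exp_average_le_1: "Re (exp_average t) \<le> 1"
  using Re_exp_average_less[of t] by (cases "t = 0") (auto simp: exp_average_0)

text \<open>Since \<open>sin t / t\<close> is less than \<open>1\<close> off the origin, compactness gives the gap on bounded sets, and
  beyond \<open>2\<close> the quotient is at most \<open>1/2\<close>.\<close>

lemma Re_exp_average_away_from_0:
  assumes "\<epsilon> > 0"
  shows "\<exists>c>0. \<forall>t. \<epsilon> \<le> \<bar>t\<bar> \<longrightarrow> Re (exp_average t) \<le> 1 - c"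
proof -
  define R where "R = max 2 \<epsilon>"
  have "\<exists>x\<in>{\<epsilon>..R}. \<forall>y\<in>{\<epsilon>..R}. sin y / y \<le> sin x / x"
    by (rule continuous_attains_sup) (use assms in \<open>auto simp: R_def intro!: continuous_intros\<close>)
  then obtain x where x: "x \<in> {\<epsilon>..R}" "\<And>y. y \<in> {\<epsilon>..R} \<Longrightarrow> sin y / y \<le> sin x / x" by blast
  define c where "c = min (1/2) (1 - sin x / x)"
  have x0: "x > 0" using x assms by auto
  then have "sin x / x < 1" by (simp add: sin_less_self)
  then have "c > 0" by (simp add: c_def)
  moreover have "Re (exp_average t) \<le> 1 - c" if t: "\<epsilon> \<le> \<bar>t\<bar>" for t
  proof -
    have "t \<noteq> 0" using t assms by auto
    then have *: "Re (exp_average t) = sin \<bar>t\<bar> / \<bar>t\<bar>" by (simp add: Re_exp_average abs_if)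
    show ?thesis
    proof (cases "\<bar>t\<bar> \<le> R")
      case True
      then have "sin \<bar>t\<bar> / \<bar>t\<bar> \<le> sin x / x" using t by (intro x(2)) auto
      moreover have "c \<le> 1 - sin x / x" unfolding c_def by (rule min.cobounded2)
      ultimately show ?thesis using * by linarith
    next
      case False
      then have "2 \<le> \<bar>t\<bar>" by (simp add: R_def)
      then have "sin \<bar>t\<bar> / \<bar>t\<bar> \<le> 1 / 2" by (intro frac_le) auto
      moreover have "c \<le> 1/2" unfolding c_def by (rule min.cobounded1)
      ultimately show ?thesis using * by linarith
    qed
  qed
  ultimately show ?thesis by blast
qed

lemma exp_moment_0: "exp_moment 0 = 1/2"
proof -
  have "((\<lambda>u. complex_of_real (1 - u)) has_integral (of_real (1 - 1\<^sup>2 / 2) - of_real (0 - 0\<^sup>2 / 2))) {0..1}"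
  proof (rule fundamental_theorem_of_calculus)
    fix x :: real
    have "((\<lambda>u. of_real u - (of_real u)\<^sup>2 / 2) has_vector_derivative (1 - complex_of_real x)) (at x within {0..1})"
      by (rule has_vector_derivative_real_field) (auto intro!: derivative_eq_intros)
    then show "((\<lambda>u. complex_of_real (u - u\<^sup>2 / 2)) has_vector_derivative complex_of_real (1 - x)) (at x within {0..1})"
      by simp
  qed simp
  then have "integral {0..1} (\<lambda>u. complex_of_real (1 - u)) = of_real (1 - 1\<^sup>2 / 2) - of_real (0 - 0\<^sup>2 / 2)"
    by (rule integral_unique)
  moreover have "exp_moment 0 = integral {0..1} (\<lambda>u. complex_of_real (1 - u))"
    by (simp add: exp_moment_def weighted_exp_average_def del: of_real_diff)
  ultimately have "exp_moment 0 = of_real (1 - 1\<^sup>2 / 2) - of_real (0 - 0\<^sup>2 / 2)" by metis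
  then show ?thesis by (simp add: field_simps)
qed

text \<open>The real part is \<open>(1 - cos t) / t\<^sup>2\<close>, which the two identities above give without another integral.\<close>

lemma Re_exp_moment_nonneg: "0 \<le> Re (exp_moment t)"
proof (cases "t = 0")
  case False
  have "t * Im (exp_average t) = 1 - cos t"
    using arg_cong[OF exp_average_times[of t], of Re] by simp
  moreover have "Im (exp_average t) = t * Re (exp_moment t)"
    using arg_cong[OF one_minus_exp_average[of t], of Im] by simp
  ultimately have "t\<^sup>2 * Re (exp_moment t) = 1 - cos t" by (simp add: power2_eq_square)
  then have "0 \<le> t\<^sup>2 * Re (exp_moment t)" by simp
  then show ?thesis using False by (simp add: zero_le_mult_iff)
qed (simp add: exp_moment_0)

lemma exp_moment_nonzero: "exp_moment t \<noteq> 0"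
proof (cases "t = 0")
  case True
  then show ?thesis by (simp add: exp_moment_0)
next
  case False
  then have "1 - exp_average t \<noteq> 0" using Re_exp_average_less[OF False] by auto
  then show ?thesis unfolding one_minus_exp_average by auto
qed

lemma exp_moment_lower:
  "\<exists>c>0. \<forall>t. \<bar>t\<bar> \<le> R \<longrightarrow> c \<le> norm (exp_moment t)"
proof (cases "R \<ge> 0")
  case True
  have "continuous_on {-R..R} exp_moment"
    unfolding exp_moment_def
    by (rule lipschitz_on_continuous_on[where L=1], rule lipschitz_onI)
       (auto simp: dist_norm dist_real_def intro!: weighted_exp_average_lipschitz continuous_intros)
  then have "\<exists>x\<in>{-R..R}. \<forall>y\<in>{-R..R}. norm (exp_moment x) \<le> norm (exp_moment y)"
    using True by (intro continuous_attains_inf) (auto intro!: continuous_intros)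
  then obtain x where x: "\<And>y. y \<in> {-R..R} \<Longrightarrow> norm (exp_moment x) \<le> norm (exp_moment y)" by blast
  have "norm (exp_moment x) \<le> norm (exp_moment t)" if "\<bar>t\<bar> \<le> R" for t
    using that by (intro x) auto
  moreover have "norm (exp_moment x) > 0" using exp_moment_nonzero by simp
  ultimately show ?thesis by blast
next
  case False
  then show ?thesis by (intro exI[of _ 1]) auto
qed

lemma slowly_varying_exp_average:
  "slowly_varying (\<lambda>n M k. exp_average (of_int k * (\<gamma> / real n)))"
  unfolding exp_average_weighted by (rule slowly_varying_weighted_exp_average) auto

lemma slowly_varying_exp_moment:
  "slowly_varying (\<lambda>n M k. exp_moment (of_int k * (\<gamma> / real n)))"
  unfolding exp_moment_def
  by (rule slowly_varying_weighted_exp_average) (auto intro!: continuous_intros)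

text \<open>A quadratic spline that rises from \<open>0\<close> at \<open>0\<close> to \<open>1\<close> at \<open>1\<close>; a Lipschitz derivative is just enough
  smoothness for the bound on second differences.\<close>

definition smooth_step :: "real \<Rightarrow> real" where
  "smooth_step s = 2 * (max 0 s)\<^sup>2 - 4 * (max 0 (s - 1/2))\<^sup>2 + 2 * (max 0 (s - 1))\<^sup>2"

definition smooth_step_deriv :: "real \<Rightarrow> real" where
  "smooth_step_deriv s = 4 * max 0 s - 8 * max 0 (s - 1/2) + 4 * max 0 (s - 1)"

lemma has_real_derivative_max_square:
  "((\<lambda>s. (max 0 (s - c))\<^sup>2) has_real_derivative 2 * max 0 (x - c)) (at x)" for x c :: real
proof -
  consider "x < c" | "x > c" | "x = c" by linarith
  then show ?thesis
  proof cases
    case 1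
    have "((\<lambda>s. 0) has_real_derivative 2 * max 0 (x - c)) (at x)" using 1 by simp
    then show ?thesis
      by (rule has_field_derivative_transform_within_open[of _ _ _ "{..<c}"]) (use 1 in auto)
  next
    case 2
    have "((\<lambda>s. (s - c)\<^sup>2) has_real_derivative 2 * max 0 (x - c)) (at x)"
      using 2 by (auto intro!: derivative_eq_intros)
    then show ?thesis
      by (rule has_field_derivative_transform_within_open[of _ _ _ "{c<..}"]) (use 2 in auto)
  next
    case 3
    have "((\<lambda>h. (max 0 h)\<^sup>2 / h) \<longlongrightarrow> 0) (at (0::real))"
    proof (rule Lim_null_comparison)
      show "\<forall>\<^sub>F h in at (0::real). norm ((max 0 h)\<^sup>2 / h) \<le> \<bar>h\<bar>"
        by (intro always_eventually allI) (auto simp: max_def power2_eq_square)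
      show "((\<lambda>h::real. \<bar>h\<bar>) \<longlongrightarrow> 0) (at 0)" by (intro tendsto_rabs_zero tendsto_ident_at)
    qed
    then show ?thesis unfolding DERIV_def using 3 by simp
  qed
qed

lemma smooth_step_has_derivative: "(smooth_step has_real_derivative smooth_step_deriv s) (at s)"
proof -
  have "((\<lambda>s. 2 * (max 0 (s - 0))\<^sup>2 - 4 * (max 0 (s - 1/2))\<^sup>2 + 2 * (max 0 (s - 1))\<^sup>2)
     has_real_derivative 2 * (2 * max 0 (s - 0)) - 4 * (2 * max 0 (s - 1/2)) + 2 * (2 * max 0 (s - 1))) (at s)"
    by (intro derivative_intros DERIV_cmult has_real_derivative_max_square)
  then show ?thesis unfolding smooth_step_def[abs_def] smooth_step_deriv_def by simp
qed

lemma smooth_step_deriv_bound: "\<bar>smooth_step_deriv s\<bar> \<le> 2"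
  unfolding smooth_step_deriv_def by (auto simp: max_def)

lemma smooth_step_deriv_lipschitz: "\<bar>smooth_step_deriv s - smooth_step_deriv t\<bar> \<le> 16 * \<bar>s - t\<bar>"
  unfolding smooth_step_deriv_def by (auto simp: max_def abs_if)

lemma smooth_step_eq_0: "s \<le> 0 \<Longrightarrow> smooth_step s = 0"
  by (simp add: smooth_step_def)

lemma smooth_step_eq_1: "s \<ge> 1 \<Longrightarrow> smooth_step s = 1"
  by (simp add: smooth_step_def power2_eq_square field_simps)

lemma smooth_step_bounds: "0 \<le> smooth_step s" "smooth_step s \<le> 1"
proof -
  consider "s \<le> 0" | "0 \<le> s" "s \<le> 1/2" | "1/2 \<le> s" "s \<le> 1" | "1 \<le> s" by linarith
  then have "0 \<le> smooth_step s \<and> smooth_step s \<le> 1"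
  proof cases
    case 2
    then have "smooth_step s = 2 * s\<^sup>2" by (simp add: smooth_step_def)
    moreover have "s\<^sup>2 \<le> (1/2)\<^sup>2" using 2 by (intro power_mono) auto
    ultimately show ?thesis by (simp add: power2_eq_square)
  next
    case 3
    then have "smooth_step s = 1 - 2 * (1 - s)\<^sup>2" by (simp add: smooth_step_def power2_eq_square field_simps)
    moreover have "(1 - s)\<^sup>2 \<le> (1/2)\<^sup>2" using 3 by (intro power_mono) auto
    ultimately show ?thesis by (simp add: power2_eq_square)
  qed (auto simp: smooth_step_eq_0 smooth_step_eq_1)
  then show "0 \<le> smooth_step s" "smooth_step s \<le> 1" by auto
qed

lemma smooth_step_lipschitz: "\<bar>smooth_step x - smooth_step y\<bar> \<le> 2 * \<bar>x - y\<bar>"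
  using field_differentiable_bound[of UNIV smooth_step smooth_step_deriv 2 x y] smooth_step_deriv_bound smooth_step_has_derivative
  by (auto simp: has_field_derivative_at_within)

text \<open>The mean value inequality, applied to the first difference of the step.\<close>

lemma smooth_step_second_diff: "\<bar>smooth_step (x + 2 * d) - 2 * smooth_step (x + d) + smooth_step x\<bar> \<le> 16 * d\<^sup>2"
proof -
  define g where "g y = smooth_step (y + d) - smooth_step y" for y
  have "(g has_real_derivative (smooth_step_deriv (y + d) - smooth_step_deriv y)) (at y within UNIV)" for y
    unfolding g_def
    by (intro derivative_intros DERIV_shift[THEN iffD1] smooth_step_has_derivative)
  moreover have "norm (smooth_step_deriv (y + d) - smooth_step_deriv y) \<le> 16 * \<bar>d\<bar>" for y
    using smooth_step_deriv_lipschitz[of "y + d" y] by simp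
  ultimately have "norm (g (x + d) - g x) \<le> 16 * \<bar>d\<bar> * norm (x + d - x)"
    by (intro field_differentiable_bound[where S=UNIV]) auto
  then show ?thesis by (simp add: g_def power2_eq_square algebra_simps)
qed

lemma slowly_varying_smooth_step:
  assumes \<sigma>: "\<And>n M. 1 \<le> n \<Longrightarrow> n \<le> M \<Longrightarrow> real n * \<bar>\<sigma> n M\<bar> \<le> A"
  shows "slowly_varying (\<lambda>n M k. of_real (smooth_step (c + of_int k * \<sigma> n M)))"
proof (rule slowly_varying_sample[where K=16, OF _ _ _ \<sigma>])
  fix s t d :: real
  show "norm (complex_of_real (smooth_step t)) \<le> 16" using smooth_step_bounds[of t] by simp
  show "norm (complex_of_real (smooth_step s) - of_real (smooth_step t)) \<le> 16 * \<bar>s - t\<bar>"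
    using smooth_step_lipschitz[of s t] by (simp flip: of_real_diff)
  have "complex_of_real (smooth_step (t + 2 * d)) - 2 * of_real (smooth_step (t + d)) + of_real (smooth_step t)
     = of_real (smooth_step (t + 2 * d) - 2 * smooth_step (t + d) + smooth_step t)" by simp
  then show "norm (complex_of_real (smooth_step (t + 2 * d)) - 2 * of_real (smooth_step (t + d)) + of_real (smooth_step t)) \<le> 16 * d\<^sup>2"
    using smooth_step_second_diff by (simp only: norm_of_real)
qed

text \<open>A rising and a falling step: \<open>1\<close> on \<open>[-1/2, 1/2]\<close> and \<open>0\<close> outside \<open>[-1, 1]\<close>.\<close>

definition cutoff :: "real \<Rightarrow> real" where
  "cutoff t = smooth_step (2 - 2 * t) * smooth_step (2 + 2 * t)"

lemma cutoff_eq_1: "\<bar>t\<bar> \<le> 1/2 \<Longrightarrow> cutoff t = 1"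
  by (simp add: cutoff_def smooth_step_eq_1 abs_le_iff)

lemma cutoff_eq_0: "\<bar>t\<bar> \<ge> 1 \<Longrightarrow> cutoff t = 0"
  by (cases "t \<ge> 0") (auto simp: cutoff_def smooth_step_eq_0)

lemma cutoff_bounds: "0 \<le> cutoff t" "cutoff t \<le> 1"
  using smooth_step_bounds by (auto simp: cutoff_def intro: mult_le_one)

lemma slowly_varying_cutoff:
  assumes \<sigma>: "\<And>n M. 1 \<le> n \<Longrightarrow> n \<le> M \<Longrightarrow> real n * \<bar>\<sigma> n M\<bar> \<le> A"
  shows "slowly_varying (\<lambda>n M k. of_real (cutoff (of_int k * \<sigma> n M)))"
proof -
  have "slowly_varying (\<lambda>n M k. of_real (smooth_step (2 + of_int k * (-2 * \<sigma> n M))) * of_real (smooth_step (2 + of_int k * (2 * \<sigma> n M))))"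
    by (intro slowly_varying_mult slowly_varying_smooth_step[where A="2 * A"]) (use \<sigma> in \<open>auto simp: abs_mult\<close>)
  then show ?thesis by (simp add: cutoff_def algebra_simps)
qed

section \<open>The symbols of the approximation argument\<close>

lemma decaying_symbol_low_pass:
  "\<exists>C. \<forall>n\<ge>1. decaying_symbol n C (\<lambda>k. of_real (cutoff (of_int k / real n)))"
proof -
  have "\<exists>C. \<forall>n\<ge>1. \<forall>M\<ge>n. decaying_symbol n C (\<lambda>k. of_real (cutoff (of_int k * (1 / real n))))"
  proof (rule decaying_symbol_of_band_limited)
    show "slowly_varying (\<lambda>n M k. of_real (cutoff (of_int k * (1 / real n))))"
      by (rule slowly_varying_cutoff[where A=1]) auto
    show "complex_of_real (cutoff (of_int k * (1 / real n))) = 0"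
      if "1 \<le> n" "n \<le> M" "\<bar>k\<bar> > int n" for n M k
      using that by (simp add: cutoff_eq_0 field_simps)
  qed
  then show ?thesis by auto
qed

text \<open>The symbol that turns \<open>(I - \<dot>A\<^sub>h)\<^sup>s f\<close> into \<open>n\<^bsup>-s\<^esup> T\<^sup>(\<^sup>s\<^sup>)\<close>.  With \<open>b\<close> the moment of the
  exponential, \<open>1 - a = -i h k b\<close>, so that \<open>(ik/n) / (1 - a) = -1 / (\<gamma> b)\<close>; only the band \<open>\<bar>k\<bar> \<le> n\<close> matters,
  and there \<open>b\<close> is bounded away from \<open>0\<close>.\<close>

lemma decaying_symbol_derivative:
  assumes \<gamma>: "\<gamma> > 0"
  shows "\<exists>C. \<forall>n\<ge>1. \<exists>\<mu>. decaying_symbol n C \<mu> \<and> (\<forall>k. \<bar>k\<bar> > int n \<longrightarrow> \<mu> k = 0) \<and>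
    (\<forall>k. \<mu> k * (1 - exp_average (of_int k * (\<gamma> / real n))) ^ s
       = (\<i> * of_int k / of_nat n) ^ s * (1 - (1 - of_real (cutoff (of_int k / real n))) ^ s))"
proof -
  \<comment> \<open>The moment tends to zero at infinity.  Adding \<open>1\<close> minus a wide cutoff keeps the denominator away
    from \<open>0\<close> everywhere and changes nothing on the band.\<close>
  define B where "B n k = exp_moment (of_int k * (\<gamma> / real n)) + (1 - of_real (cutoff (of_int k * (1 / (2 * real n)))))"
    for n :: nat and k :: int
  define \<omega> where "\<omega> n k = 1 - (1 - complex_of_real (cutoff (of_int k * (1 / real n)))) ^ s" for n :: nat and k :: int
  define \<mu> where "\<mu> n k = \<omega> n k * (- (1/\<gamma>) * (1 / B n k)) ^ s" for n :: nat and k :: int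
  obtain c where c: "c > 0" "\<And>t. \<bar>t\<bar> \<le> 2 * \<gamma> \<Longrightarrow> c \<le> norm (exp_moment t)"
    using exp_moment_lower by blast
  have low: "min c 1 \<le> norm (B n k)" if n: "n \<ge> 1" for n k
  proof (cases "\<bar>of_int k / real n\<bar> \<le> 2")
    case True
    define b r where "b = exp_moment (of_int k * (\<gamma> / real n))" and "r = 1 - cutoff (of_int k * (1 / (2 * real n)))"
    have "\<bar>of_int k * (\<gamma> / real n)\<bar> = \<gamma> * \<bar>of_int k / real n\<bar>" using \<gamma> by (simp add: abs_mult)
    also have "\<dots> \<le> \<gamma> * 2" using True \<gamma> by (intro mult_left_mono) auto
    finally have "c \<le> norm b" unfolding b_def by (intro c(2)) simp
    moreover have "norm b \<le> norm (b + of_real r)"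
    proof -
      have "0 \<le> Re b" "0 \<le> r" using Re_exp_moment_nonneg cutoff_bounds by (auto simp: b_def r_def)
      then have "(Re b)\<^sup>2 \<le> (Re b + r)\<^sup>2" by (intro power_mono) auto
      then show ?thesis by (simp add: cmod_def)
    qed
    ultimately show ?thesis by (simp add: B_def b_def r_def)
  next
    case False
    have "cutoff (of_int k * (1 / (2 * real n))) = 0"
      using False n by (intro cutoff_eq_0) (auto simp: abs_mult field_simps)
    then have "1 \<le> Re (B n k)" using Re_exp_moment_nonneg by (simp add: B_def)
    then show ?thesis using complex_Re_le_cmod[of "B n k"] by simp
  qed
  have "slowly_varying (\<lambda>n M k. \<mu> n k)"
    unfolding \<mu>_def \<omega>_def
  proof (intro slowly_varying_mult slowly_varying_power slowly_varying_diff slowly_varying_const)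
    show "slowly_varying (\<lambda>n M k. of_real (cutoff (of_int k * (1 / real n))))"
      by (rule slowly_varying_cutoff[where A=1]) auto
    show "slowly_varying (\<lambda>n M k. 1 / B n k)"
    proof (rule slowly_varying_inverse[where c="min c 1"])
      show "slowly_varying (\<lambda>n M. B n)"
        unfolding B_def
        by (intro slowly_varying_add slowly_varying_diff slowly_varying_const slowly_varying_exp_moment
            slowly_varying_cutoff[where A=1]) auto
    qed (use low c(1) in auto)
  qed
  moreover have supp: "\<mu> n k = 0" if "1 \<le> n" "\<bar>k\<bar> > int n" for n k
  proof -
    have "cutoff (of_int k * (1 / real n)) = 0" using that by (simp add: cutoff_eq_0 field_simps)
    then show ?thesis by (simp add: \<mu>_def \<omega>_def)
  qed
  ultimately obtain C where C: "\<And>n M. n \<ge> 1 \<Longrightarrow> M \<ge> n \<Longrightarrow> decaying_symbol n C (\<mu> n)"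
    using decaying_symbol_of_band_limited[of "\<lambda>n M k. \<mu> n k"] by blast
  have "\<mu> n k * (1 - exp_average (of_int k * (\<gamma> / real n))) ^ s
       = (\<i> * of_int k / of_nat n) ^ s * (1 - (1 - of_real (cutoff (of_int k / real n))) ^ s)"
    if n: "n \<ge> 1" for n k
  proof (cases "\<bar>of_int k / real n\<bar> \<le> 1")
    case True
    have "cutoff (of_int k * (1 / (2 * real n))) = 1"
      using True n by (intro cutoff_eq_1) (auto simp: abs_mult field_simps)
    then have "- (1/\<gamma>) * (1 / B n k) * (1 - exp_average (of_int k * (\<gamma> / real n))) = \<i> * of_int k / of_nat n"
      using \<gamma> n exp_moment_nonzero by (simp add: B_def one_minus_exp_average)
    then have "(- (1/\<gamma>) * (1 / B n k)) ^ s * (1 - exp_average (of_int k * (\<gamma> / real n))) ^ s = (\<i> * of_int k / of_nat n) ^ s"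
      by (metis power_mult_distrib)
    then show ?thesis by (simp add: \<mu>_def \<omega>_def mult.assoc mult.commute)
  next
    case False
    then have "cutoff (of_int k * (1 / real n)) = 0" by (simp add: cutoff_eq_0)
    then show ?thesis by (simp add: \<mu>_def \<omega>_def)
  qed
  then show ?thesis using C supp by (intro exI[of _ C] allI impI, rule_tac x="\<mu> n" in exI) auto
qed

lemma frequency_times_exp_average:
  assumes "\<gamma> > 0"
  shows "(of_int k / of_nat n) * exp_average (of_int k * (\<gamma> / real n)) = (1 / (\<i> * \<gamma>)) * (cis (of_int k * (\<gamma> / real n)) - 1)"
  unfolding exp_average_times[symmetric] using assms by simp

text \<open>With \<open>a\<close> the symbol of the forward average, this symbol sends \<open>(I - \<dot>A\<^sub>h) f\<close> to the part of
  \<open>\<dot>A\<^sub>h\<^sup>2 f\<close> with frequencies between \<open>n / 2\<close> and \<open>M\<close>.  Two factors \<open>a\<close> supply the decay \<open>(n / k)\<^sup>2\<close>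
  that makes the bound uniform in the truncation \<open>M\<close>.\<close>

lemma decaying_symbol_high_pass:
  assumes \<gamma>: "\<gamma> > 0"
  shows "\<exists>C. \<forall>n\<ge>1. \<forall>M\<ge>n. \<exists>\<mu>. decaying_symbol n C \<mu> \<and> (\<forall>k. \<bar>k\<bar> > int M \<longrightarrow> \<mu> k = 0) \<and>
    (\<forall>k. \<mu> k * (1 - exp_average (of_int k * (\<gamma> / real n)))
       = (of_real (cutoff (of_int k / real M)) - of_real (cutoff (of_int k / real n))) * (exp_average (of_int k * (\<gamma> / real n)))\<^sup>2)"
proof -
  define a where "a n k = exp_average (of_int k * (\<gamma> / real n))" for n :: nat and k :: int
  \<comment> \<open>The zero of \<open>1 - a\<close> at frequency \<open>0\<close> is removed by a cutoff that vanishes for \<open>\<bar>k\<bar> \<ge> n / 2\<close>, where the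
    numerator lives.\<close>
  define D where "D n k = 1 - a n k + of_real (cutoff (of_int k * (2 / real n)))" for n :: nat and k :: int
  define \<delta> where "\<delta> n M k = complex_of_real (cutoff (of_int k * (1 / real M))) - of_real (cutoff (of_int k * (1 / real n)))"
    for n M :: nat and k :: int
  \<comment> \<open>The product of the frequency and the symbol of the average.\<close>
  define e where "e n k = (1 / (\<i> * \<gamma>)) * (cis (of_int k * (\<gamma> / real n)) - 1)" for n :: nat and k :: int
  define \<mu> where "\<mu> n M k = \<delta> n M k * (1 / D n k) * (a n k)\<^sup>2" for n M k
  obtain c where c: "c > 0" "\<And>t. \<gamma> / 4 \<le> \<bar>t\<bar> \<Longrightarrow> Re (exp_average t) \<le> 1 - c"
    using Re_exp_average_away_from_0[of "\<gamma> / 4"] \<gamma> by auto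
  have low: "min c 1 \<le> norm (D n k)" if n: "n \<ge> 1" for n k
  proof -
    have "min c 1 \<le> Re (D n k)"
    proof (cases "\<bar>of_int k / real n\<bar> \<le> 1/4")
      case True
      then have "cutoff (of_int k * (2 / real n)) = 1" by (intro cutoff_eq_1) (auto simp: abs_mult mult.commute)
      then have "1 \<le> Re (D n k)"
        using Re_exp_average_le_1[of "of_int k * (\<gamma> / real n)"] by (simp add: D_def a_def)
      then show ?thesis by linarith
    next
      case False
      have "\<gamma> * (1/4) \<le> \<gamma> * \<bar>of_int k / real n\<bar>" using False \<gamma> by (intro mult_left_mono) auto
      also have "\<dots> = \<bar>of_int k * (\<gamma> / real n)\<bar>" using \<gamma> by (simp add: abs_mult)
      finally have "Re (a n k) \<le> 1 - c" unfolding a_def by (intro c(2)) simp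
      then show ?thesis using cutoff_bounds(1)[of "of_int k * (2 / real n)"] by (simp add: D_def)
    qed
    then show ?thesis using complex_Re_le_cmod[of "D n k"] by linarith
  qed
  have sa: "slowly_varying (\<lambda>n M k. a n k)" unfolding a_def by (rule slowly_varying_exp_average)
  have s\<delta>: "slowly_varying \<delta>"
    unfolding \<delta>_def[abs_def]
    by (intro slowly_varying_diff slowly_varying_cutoff[where A=1]) (auto simp: field_simps)
  have sD: "slowly_varying (\<lambda>n M k. 1 / D n k)"
  proof (rule slowly_varying_inverse[where c="min c 1"])
    show "slowly_varying (\<lambda>n M. D n)"
      unfolding D_def
      by (intro slowly_varying_add slowly_varying_diff slowly_varying_const sa slowly_varying_cutoff[where A=2]) auto
  qed (use low c(1) in auto)
  have se: "slowly_varying (\<lambda>n M k. e n k)"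
    unfolding e_def by (intro slowly_varying_mult slowly_varying_diff slowly_varying_const slowly_varying_cis)
  have ta: "(of_int k / of_nat n) * a n k = e n k" for n k
    unfolding a_def e_def by (rule frequency_times_exp_average[OF \<gamma>])
  have "\<exists>C. \<forall>n\<ge>1. \<forall>M\<ge>n. decaying_symbol n C (\<mu> n M)"
  proof (rule decaying_symbol_of_slowly_varying)
    show "slowly_varying \<mu>"
      unfolding \<mu>_def[abs_def] by (intro slowly_varying_mult slowly_varying_power s\<delta> sD sa)
    have "(of_int k / of_nat n) * \<mu> n M k = \<delta> n M k * (1 / D n k) * (a n k * e n k)" for n M k
      unfolding \<mu>_def ta[symmetric] by (simp add: power2_eq_square mult_ac)
    then show "slowly_varying (\<lambda>n M k. (of_int k / of_nat n) * \<mu> n M k)"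
      by (simp only:) (intro slowly_varying_mult s\<delta> sD sa se)
    have "(of_int k / of_nat n)\<^sup>2 * \<mu> n M k = \<delta> n M k * (1 / D n k) * (e n k * e n k)" for n M k
      unfolding \<mu>_def ta[symmetric] by (simp add: power2_eq_square mult_ac)
    then show "slowly_varying (\<lambda>n M k. (of_int k / of_nat n)\<^sup>2 * \<mu> n M k)"
      by (simp only:) (intro slowly_varying_mult s\<delta> sD se)
  qed
  then obtain C where C: "\<And>n M. n \<ge> 1 \<Longrightarrow> M \<ge> n \<Longrightarrow> decaying_symbol n C (\<mu> n M)" by blast
  have supp: "\<mu> n M k = 0" if "1 \<le> n" "n \<le> M" "\<bar>k\<bar> > int M" for n M k
  proof -
    have "real M \<le> real_of_int \<bar>k\<bar>" "real n \<le> real_of_int \<bar>k\<bar>" using that by linarith+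
    then have "cutoff (of_int k * (1 / real M)) = 0" "cutoff (of_int k * (1 / real n)) = 0"
      using that by (auto intro!: cutoff_eq_0 simp: abs_mult field_simps)
    then show ?thesis by (simp add: \<mu>_def \<delta>_def)
  qed
  have "\<mu> n M k * (1 - a n k) = \<delta> n M k * (a n k)\<^sup>2" if n: "1 \<le> n" "n \<le> M" for n M k
  proof (cases "\<bar>of_int k / real n\<bar> \<le> 1/2")
    case True
    have "\<bar>of_int k / real M\<bar> \<le> \<bar>of_int k / real n\<bar>"
      using n by (simp add: frac_le)
    then have M: "\<bar>of_int k / real M\<bar> \<le> 1/2" using True by linarith
    then have "cutoff (of_int k * (1 / real M)) = 1" "cutoff (of_int k * (1 / real n)) = 1"
      using cutoff_eq_1[OF M] cutoff_eq_1[OF True] by auto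
    then show ?thesis by (simp add: \<mu>_def \<delta>_def)
  next
    case False
    then have "cutoff (of_int k * (2 / real n)) = 0" by (intro cutoff_eq_0) (auto simp: abs_mult)
    then have "D n k = 1 - a n k" by (simp add: D_def)
    moreover have "D n k \<noteq> 0" using low[of n k] n c(1) by auto
    ultimately show ?thesis by (simp add: \<mu>_def)
  qed
  then show ?thesis using C supp
    by (intro exI[of _ C] allI impI, rule_tac x="\<mu> n M" in exI) (auto simp: \<delta>_def a_def)
qed

section \<open>Low-pass filters and the defect of an average\<close>

text \<open>The operator \<open>I - \<dot>A\<^sub>h\<close>, separated from its powers.\<close>

definition defect :: "real \<Rightarrow> (real \<Rightarrow> complex) \<Rightarrow> real \<Rightarrow> complex" where
  "defect h f = (\<lambda>x. f x - forward_steklov h f x)"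

lemma defect_power_eq_steklov_difference: "defect h ^^ s = steklov_difference h s"
  by (simp add: steklov_difference_def defect_def[abs_def])

definition low_pass :: "nat \<Rightarrow> (real \<Rightarrow> complex) \<Rightarrow> real \<Rightarrow> complex" where
  "low_pass n = fourier_multiplier n (\<lambda>k. of_real (cutoff (of_int k / real n)))"

definition high_pass :: "nat \<Rightarrow> (real \<Rightarrow> complex) \<Rightarrow> real \<Rightarrow> complex" where
  "high_pass n f = (\<lambda>x. f x - low_pass n f x)"

lemma cutoff_beyond: "n \<ge> 1 \<Longrightarrow> \<bar>k\<bar> > int n \<Longrightarrow> cutoff (of_int k / real n) = 0"
proof -
  assume "n \<ge> 1" "\<bar>k\<bar> > int n"
  then have "real n \<le> real_of_int \<bar>k\<bar>" by linarith
  then show ?thesis using \<open>n \<ge> 1\<close> by (intro cutoff_eq_0) simp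
qed

text \<open>Every point differs from one in \<open>[-\<pi>, \<pi>]\<close> by a multiple of the period.\<close>

lemma circle_periodic_bounded:
  fixes f :: "real \<Rightarrow> 'b::real_normed_vector"
  assumes per: "circle_periodic f" and c: "continuous_on UNIV f"
  obtains B where "B > 0" "\<And>x. norm (f x) \<le> B"
proof -
  have "bounded (f ` {-pi..pi})"
    using c by (intro compact_imp_bounded compact_continuous_image) (auto intro: continuous_on_subset)
  then obtain B where B: "B > 0" "\<And>x. x \<in> {-pi..pi} \<Longrightarrow> norm (f x) \<le> B"
    unfolding bounded_pos by auto
  have nat: "f (x + 2 * pi * real n) = f x" for x and n :: nat
  proof (induction n)
    case (Suc n)
    have "f (x + 2 * pi * real (Suc n)) = f (x + 2 * pi * real n + 2 * pi)" by (simp add: algebra_simps)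
    then show ?case using per Suc by simp
  qed simp
  have int: "f (x + 2 * pi * of_int j) = f x" for x and j :: int
  proof (cases "j \<ge> 0")
    case True
    then show ?thesis using nat[of x "nat j"] by simp
  next
    case False
    then show ?thesis using nat[of "x + 2 * pi * of_int j" "nat (-j)"] by simp
  qed
  have "norm (f x) \<le> B" for x
  proof -
    define j where "j = \<lfloor>(x + pi) / (2 * pi)\<rfloor>"
    have "of_int j \<le> (x + pi) / (2 * pi)" "(x + pi) / (2 * pi) \<le> of_int j + 1"
      unfolding j_def by linarith+
    then have "of_int j * (2 * pi) \<le> x + pi" "x + pi \<le> (of_int j + 1) * (2 * pi)"
      by (simp_all add: pos_le_divide_eq pos_divide_le_eq)
    then have "x + 2 * pi * of_int (-j) \<in> {-pi..pi}" by (auto simp: algebra_simps)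
    then show ?thesis using B(2) int by metis
  qed
  then show ?thesis using that B(1) by blast
qed

text \<open>Two windows of equal length differ by two intervals of length \<open>\<bar>x - y\<bar>\<close>.\<close>

lemma forward_steklov_lipschitz:
  assumes L1: "locally_L1 f" and B: "\<And>x. norm (f x) \<le> B" and h: "h > 0"
  shows "norm (forward_steklov h f x - forward_steklov h f y) \<le> (2 * B / h) * \<bar>x - y\<bar>"
proof -
  have le: "norm (forward_steklov h f x - forward_steklov h f y) \<le> (2 * B / h) * (y - x)" if "x \<le> y" for x y
  proof -
    note i = locally_L1_integrable[OF L1]
    have ib: "norm (integral {u..v} f) \<le> B * (v - u)" if "u \<le> v" for u v
    proof -
      have "norm (integral {u..v} f) \<le> integral {u..v} (\<lambda>_. B)"
        by (rule integral_norm_bound_integral) (use i B in auto)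
      then show ?thesis using that by (simp add: mult.commute)
    qed
    have 1: "integral {x..x+h} f + integral {x+h..y+h} f = integral {x..y+h} f"
      by (rule Henstock_Kurzweil_Integration.integral_combine) (use that h i in auto)
    have 2: "integral {x..y} f + integral {y..y+h} f = integral {x..y+h} f"
      by (rule Henstock_Kurzweil_Integration.integral_combine) (use that h i in auto)
    have "integral {x..x+h} f - integral {y..y+h} f = integral {x..y} f - integral {x+h..y+h} f"
      using trans[OF 1 2[symmetric]] by (simp add: algebra_simps)
    then have "forward_steklov h f x - forward_steklov h f y = (1/h) *\<^sub>R (integral {x..y} f - integral {x+h..y+h} f)"
      by (simp add: forward_steklov_eq_integral[OF L1] flip: scaleR_diff_right)
    then have "norm (forward_steklov h f x - forward_steklov h f y) = (1/h) * norm (integral {x..y} f - integral {x+h..y+h} f)"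
      using h by simp
    also have "\<dots> \<le> (1/h) * (B * (y - x) + B * (y - x))"
      using h ib[of x y] ib[of "x+h" "y+h"] that
      by (intro mult_left_mono order_trans[OF norm_triangle_ineq4] add_mono) auto
    finally show ?thesis by simp
  qed
  show ?thesis
    using le[of x y] le[of y x] by (cases "x \<le> y") (auto simp: norm_minus_commute)
qed

text \<open>The kernel has mean value \<open>1\<close>, so the error at \<open>x\<close> is the multiplier applied to \<open>y \<mapsto> F y - F x\<close>,
  whose average over a window of length \<open>h\<close> around \<open>x\<close> is at most \<open>L h / 2\<close>.  Each of the \<open>i + 3\<close> dyadic
  scales contributes equally; taking powers of two for the cutoff frequency makes their number explicit.\<close>

lemma low_pass_approximates_lipschitz:
  fixes F :: "real \<Rightarrow> complex"
  assumes per: "circle_periodic F" and lip: "\<And>x y. norm (F x - F y) \<le> L * \<bar>x - y\<bar>"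
    and C: "\<And>n. n \<ge> 1 \<Longrightarrow> decaying_symbol n C (\<lambda>k. of_real (cutoff (of_int k / real n)))"
  shows "norm (F x - fourier_multiplier (2^i) (\<lambda>k. of_real (cutoff (of_int k / real (2^i)))) F x)
     \<le> 90 * C * L * (real i + 3) / 2^i"
proof -
  define M :: nat where "M = 2^i"
  define v where "v k = complex_of_real (cutoff (of_int k / real M))" for k :: int
  have M: "M \<ge> 1" by (simp add: M_def)
  have C0: "0 \<le> C" by (rule decaying_symbol_nonneg[OF C[of 1]]) simp
  have supp: "v k = 0" if "\<bar>k\<bar> > int M" for k
  proof -
    have "real M \<le> real_of_int \<bar>k\<bar>" using that by linarith
    then show ?thesis using M by (simp add: v_def cutoff_eq_0 field_simps)
  qed
  have L0: "0 \<le> L" using lip[of 0 1] order_trans[OF norm_ge_zero] by simp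
  have "continuous_on UNIV F"
    by (rule lipschitz_on_continuous_on[where L=L], rule lipschitz_onI)
       (use lip L0 in \<open>auto simp: dist_norm dist_real_def\<close>)
  then have FL1: "locally_L1 F" by (rule locally_L1_continuous)
  have cL1: "locally_L1 (\<lambda>y::real. F x)" by (intro locally_L1_continuous continuous_intros)
  define f where "f y = F y - F x" for y
  have fper: "circle_periodic f" using per by (simp add: f_def)
  have fL1: "locally_L1 f" unfolding f_def by (intro locally_L1_diff FL1 cL1)
  have fc: "fourier_coeff f k = fourier_coeff F k - (if k = 0 then F x else 0)" for k
  proof -
    have "fourier_coeff (\<lambda>y. F x) k = (if k = 0 then F x else 0)"
      using fourier_coeff_cmult[of "F x" "\<lambda>y. cis (of_int 0 * y)" k] by (simp add: fourier_coeff_cis[of 0, simplified])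
    then show ?thesis unfolding f_def by (simp add: fourier_coeff_diff[OF FL1 cL1])
  qed
  have "fourier_multiplier M v f x = (\<Sum>k=-int M..int M. v k * fourier_coeff F k * cis (of_int k * x)
      - (if k = 0 then F x else 0))"
    unfolding fourier_multiplier_def trig_sum_def fc
    by (intro sum.cong refl) (auto simp: algebra_simps v_def cutoff_eq_1)
  then have eq: "fourier_multiplier M v f x = fourier_multiplier M v F x - F x"
    by (simp add: sum_subtractf fourier_multiplier_def trig_sum_def)
  have K: "norm (trig_sum M v z) * (1 + (real M * z)\<^sup>2) \<le> 45 * C * real M" if "\<bar>z\<bar> \<le> pi" for z
    by (rule decaying_symbol_kernel[OF M _ _ that]) (use C[OF M] supp in \<open>auto simp: v_def[abs_def]\<close>)
  have "pi * real M \<le> 4 * real M" using pi_less_4 by (intro mult_right_mono) auto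
  then have J: "pi * real M \<le> 2 ^ (i + 2)" by (simp add: M_def)
  have s: "norm (steklov h (\<lambda>y. of_real (norm (f y))) x) \<le> L * h / 2" if h: "h > 0" for h
  proof -
    have "integral {x - h/2..x + h/2} (\<lambda>y. norm (f y)) \<le> integral {x - h/2..x + h/2} (\<lambda>y. L * (h/2))"
    proof (rule integral_le)
      show "(\<lambda>y. norm (f y)) integrable_on {x - h/2..x + h/2}"
        by (rule locally_L1_integrable[OF locally_L1_norm[OF fL1]])
      fix y assume "y \<in> {x - h/2..x + h/2}"
      then have "x - h/2 \<le> y" "y \<le> x + h/2" by auto
      then have "\<bar>y - x\<bar> \<le> h/2" by linarith
      then show "norm (f y) \<le> L * (h/2)"
        using lip[of y x] L0 mult_left_mono[of "\<bar>y - x\<bar>" "h/2" L] unfolding f_def by linarith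
    qed auto
    also have "\<dots> = h * (L * h / 2)" using h by simp
    finally have "(1/h) * integral {x - h/2..x + h/2} (\<lambda>y. norm (f y)) \<le> (1/h) * (h * (L * h / 2))"
      using h by (intro mult_left_mono) auto
    then show ?thesis using h by (simp add: steklov_norm_eq[OF fL1 h])
  qed
  have "norm (fourier_multiplier M v f x)
     \<le> (\<Sum>j\<le>i+2. 2 * (45 * C) / 2 ^ j * norm (steklov (2 * 2 ^ j / real M) (\<lambda>x. of_real (norm (f x))) x))"
    by (rule fourier_multiplier_pointwise[OF fper fL1 _ _ K J]) (use M C0 in auto)
  also have "\<dots> \<le> (\<Sum>j\<le>i+2. 2 * (45 * C) / 2 ^ j * (L * (2 * 2 ^ j / real M) / 2))"
    using C0 M by (intro sum_mono mult_left_mono s) auto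
  also have "\<dots> = (\<Sum>j\<le>i+2. 90 * C * L / real M)" by (intro sum.cong refl) simp
  also have "\<dots> = 90 * C * L * (real i + 3) / 2^i" by (simp add: M_def field_simps)
  finally show ?thesis unfolding eq by (simp add: M_def v_def[abs_def] norm_minus_commute)
qed

section \<open>Derivatives of averages and of trigonometric sums\<close>

lemma trig_sum_has_vector_derivative:
  "(trig_sum M c has_vector_derivative trig_sum M (\<lambda>k. \<i> * of_int k * c k) x) (at x)"
proof -
  have "((\<lambda>y. cis (of_int k * y)) has_vector_derivative (\<i> * of_int k * cis (of_int k * x))) (at x)" for k
  proof -
    have "((\<lambda>y. exp (\<i> * of_int k * of_real y)) has_vector_derivative (\<i> * of_int k * exp (\<i> * of_int k * of_real x))) (at x)"
      by (rule has_vector_derivative_real_field) (auto intro!: derivative_eq_intros)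
    then show ?thesis by (simp add: cis_conv_exp mult.assoc)
  qed
  then have "((\<lambda>y. \<Sum>k=-int M..int M. c k * cis (of_int k * y)) has_vector_derivative
      (\<Sum>k=-int M..int M. c k * (\<i> * of_int k * cis (of_int k * x)))) (at x)"
    by (intro has_vector_derivative_sum has_vector_derivative_mult_right)
  then show ?thesis unfolding trig_sum_def[abs_def] by (simp add: mult_ac)
qed

lemma nth_derivative_Suc: "nth_derivative (Suc k) g = (\<lambda>x. vector_derivative (nth_derivative k g) (at x))"
  by (simp add: nth_derivative_def)

lemma nth_derivative_trig_sum:
  "nth_derivative s (trig_sum M c) = trig_sum M (\<lambda>k. (\<i> * of_int k) ^ s * c k)"
proof (induction s)
  case 0 then show ?case by (simp add: nth_derivative_def)
next
  case (Suc s)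
  have "nth_derivative (Suc s) (trig_sum M c) = (\<lambda>x. vector_derivative (nth_derivative s (trig_sum M c)) (at x))"
    by (simp add: nth_derivative_def)
  also have "\<dots> = trig_sum M (\<lambda>k. \<i> * of_int k * ((\<i> * of_int k) ^ s * c k))"
    unfolding Suc using vector_derivative_at[OF trig_sum_has_vector_derivative] by blast
  finally show ?case by (simp add: mult.assoc)
qed

lemma trig_sum_in_trig_polys: "trig_sum n c \<in> trig_polys n"
  unfolding trig_polys_def trig_sum_def[abs_def] by blast

text \<open>Near \<open>x\<close> the window integral is a difference of two values of one primitive of \<open>g\<close>.\<close>

lemma forward_steklov_has_vector_derivative:
  fixes g :: "real \<Rightarrow> complex"
  assumes g: "continuous_on UNIV g" and h: "h > 0"
  shows "(forward_steklov h g has_vector_derivative (1/h) *\<^sub>R (g (x + h) - g x)) (at x)"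
proof -
  have L1: "locally_L1 g" by (rule locally_L1_continuous[OF g])
  define a where "a = x - 1"
  define b where "b = x + h + 1"
  define G where "G u = integral {a..u} g" for u
  have G: "(G has_vector_derivative g y) (at y)" if "a < y" "y < b" for y
  proof -
    have "(G has_vector_derivative g y) (at y within {a..b})"
      unfolding G_def by (rule integral_has_vector_derivative) (use g that in \<open>auto intro: continuous_on_subset\<close>)
    moreover have "at y within {a..b} = at y" using that by (intro at_within_interior) (auto simp: interior_atLeastAtMost_real)
    ultimately show ?thesis by simp
  qed
  have G1: "(G has_vector_derivative g x) (at x)" by (rule G) (use h in \<open>auto simp: a_def b_def\<close>)
  have G2: "((\<lambda>y. G (y + h)) has_vector_derivative g (x + h)) (at x)"
  proof -
    have "((\<lambda>y. y + h) has_vector_derivative 1) (at x)" by (auto intro!: derivative_eq_intros)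
    moreover have "(G has_vector_derivative g (x + h)) (at (x + h))"
      by (rule G) (use h in \<open>auto simp: a_def b_def\<close>)
    ultimately show ?thesis using vector_diff_chain_at[of "\<lambda>y. y + h" 1 x G "g (x + h)"] by (simp add: o_def)
  qed
  have "((\<lambda>y. (1/h) *\<^sub>R (G (y + h) - G y)) has_vector_derivative (1/h) *\<^sub>R (g (x + h) - g x)) (at x)"
    by (intro bounded_linear.has_vector_derivative[OF bounded_linear_scaleR_right] has_vector_derivative_diff G1 G2)
  then show ?thesis
  proof (rule has_vector_derivative_transform_within_open[where S="{a<..}"])
    fix y assume y: "y \<in> {a<..}"
    have "G y + integral {y..y+h} g = G (y + h)"
      unfolding G_def by (rule Henstock_Kurzweil_Integration.integral_combine)
        (use y h locally_L1_integrable[OF L1] in auto)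
    then have "integral {y..y+h} g = G (y + h) - G y" by (metis add_diff_cancel_left')
    then show "(1/h) *\<^sub>R (G (y + h) - G y) = forward_steklov h g y"
      by (simp add: forward_steklov_eq_integral[OF L1])
  qed (auto simp: a_def)
qed

lemma integral_vector_derivative:
  fixes g :: "real \<Rightarrow> complex"
  assumes "\<And>x. g differentiable at x" "a \<le> b"
  shows "((\<lambda>x. vector_derivative g (at x)) has_integral (g b - g a)) {a..b}"
  by (rule fundamental_theorem_of_calculus[OF assms(2)])
     (use assms(1) vector_derivative_works has_vector_derivative_at_within in blast)

lemma differentiable_continuous_UNIV:
  fixes g :: "real \<Rightarrow> complex"
  assumes "\<And>x. g differentiable at x" shows "continuous_on UNIV g"
  using assms differentiable_imp_continuous_within by (auto simp: continuous_on_eq_continuous_within)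

text \<open>The derivative of the average, \<open>(g (x + h) - g x) / h\<close>, is the average of the derivative.\<close>

lemma defect_has_vector_derivative:
  assumes d: "\<And>x. g differentiable at x" and L1: "locally_L1 (\<lambda>x. vector_derivative g (at x))" and h: "h > 0"
  shows "(defect h g has_vector_derivative defect h (\<lambda>x. vector_derivative g (at x)) x) (at x)"
proof -
  have "(1/h) *\<^sub>R (g (x + h) - g x) = forward_steklov h (\<lambda>x. vector_derivative g (at x)) x"
    using integral_unique[OF integral_vector_derivative[OF d, of x "x + h"]] h
    by (simp add: forward_steklov_eq_integral[OF L1])
  moreover have "(g has_vector_derivative vector_derivative g (at x)) (at x)"
    using d vector_derivative_works by blast
  ultimately show ?thesis
    unfolding defect_def
    using forward_steklov_has_vector_derivative[OF differentiable_continuous_UNIV[OF d] h, of x]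
    by (intro has_vector_derivative_diff) auto
qed

section \<open>Operators on a Banach lattice on the circle\<close>

lemma continuous_measurable_lebesgue: "continuous_on UNIV (f :: real \<Rightarrow> complex) \<Longrightarrow> f \<in> borel_measurable lebesgue"
  by (simp add: measurable_completion borel_measurable_continuous_onI)

context banach_lattice_on_circle
begin

lemma X_circle: "f \<in> X \<Longrightarrow> f \<in> circle_functions"
  using measurable_periodic by blast

lemma X_periodic: "f \<in> X \<Longrightarrow> circle_periodic f"
  using X_circle by (auto simp: circle_functions_def)

lemma X_measurable: "f \<in> X \<Longrightarrow> f \<in> borel_measurable lebesgue"
  using X_circle by (auto simp: circle_functions_def)

text \<open>The embedding axiom with \<open>E\<close> the whole circle gives integrability over one period.\<close>

lemma X_locally_L1:
  assumes "f \<in> X" shows "locally_L1 f"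
proof (rule locally_L1_periodic)
  have m: "f \<in> borel_measurable lebesgue" using assms by (rule X_measurable)
  have "indicator UNIV \<in> circle_functions" by (simp add: circle_functions_def)
  then obtain c where "(\<integral>\<^sup>+x\<in>UNIV. ennreal (cmod (f x)) \<partial>circle_measure) \<le> ennreal (c * N f)"
    using integrable[of UNIV] assms by blast
  then have "(\<integral>\<^sup>+x. ennreal (cmod (f x)) \<partial>circle_measure) < \<infinity>"
    using ennreal_less_top le_less_trans by (fastforce simp: top.not_eq_extremum)
  then have "(\<integral>\<^sup>+x. ennreal (cmod (f x)) * indicator {-pi..<pi} x \<partial>lebesgue) / emeasure lebesgue {-pi..<pi} < \<infinity>"
    unfolding circle_measure_def using m by (subst (asm) nn_integral_uniform_measure) auto
  moreover have "emeasure lebesgue {-pi..<pi} = ennreal (2 * pi)" by simp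
  ultimately have "(\<integral>\<^sup>+x. ennreal (cmod (f x)) * indicator {-pi..<pi} x \<partial>lebesgue) < \<infinity>"
    by (auto simp: ennreal_divide_eq_top_iff less_top[symmetric])
  moreover have "ennreal (cmod (f x)) * indicator {-pi..<pi} x = ennreal (norm (indicat_real {-pi..<pi} x *\<^sub>R f x))" for x
    by (auto simp: indicator_def)
  ultimately have "(\<integral>\<^sup>+x. ennreal (norm (indicat_real {-pi..<pi} x *\<^sub>R f x)) \<partial>lebesgue) < \<infinity>" by simp
  then have "f absolutely_integrable_on {-pi..<pi}"
    unfolding set_integrable_def
    by (intro integrableI_bounded borel_measurable_scaleR[OF borel_measurable_indicator m]) auto
  then have "f absolutely_integrable_on {-pi<..<pi}"
    by (rule set_integrable_subset) auto
  then show "f absolutely_integrable_on {-pi..pi}"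
    by (simp add: absolutely_integrable_on_Icc_iff_Ioo)
qed (rule X_periodic[OF assms])

lemma X_add: "f \<in> X \<Longrightarrow> g \<in> X \<Longrightarrow> (\<lambda>x. f x + g x) \<in> X"
  using subspace by (auto simp: linear_subspace_def)

lemma X_cmult: "f \<in> X \<Longrightarrow> (\<lambda>x. c * f x) \<in> X"
  using subspace by (auto simp: linear_subspace_def)

lemma X_diff: "f \<in> X \<Longrightarrow> g \<in> X \<Longrightarrow> (\<lambda>x. f x - g x) \<in> X"
  using X_add[of f "\<lambda>x. -1 * g x"] X_cmult[of g "-1"] by simp

lemma X_zero: "(\<lambda>x. 0) \<in> X"
  using subspace by (auto simp: linear_subspace_def)

lemma N_zero: "N (\<lambda>x. 0) = 0"
  using norm_scale[OF X_zero, of 0] by simp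

lemma N_minus_commute: "f \<in> X \<Longrightarrow> g \<in> X \<Longrightarrow> N (\<lambda>x. f x - g x) = N (\<lambda>x. g x - f x)"
  using norm_scale[OF X_diff[of g f], of "-1"] by simp

lemma N_diff: "f \<in> X \<Longrightarrow> g \<in> X \<Longrightarrow> N (\<lambda>x. f x - g x) \<le> N f + N g"
  using norm_triangle[of f "\<lambda>x. -1 * g x"] X_cmult[of g "-1"] norm_scale[of g "-1"] by simp

lemma N_triangle_via:
  assumes "f \<in> X" "g \<in> X" "h \<in> X"
  shows "N (\<lambda>x. f x - h x) \<le> N (\<lambda>x. f x - g x) + N (\<lambda>x. g x - h x)"
  using norm_triangle[OF X_diff[OF assms(1,2)] X_diff[OF assms(2,3)]] by simp

lemma X_sum:
  assumes "finite I" "\<And>i. i \<in> I \<Longrightarrow> F i \<in> X"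
  shows "(\<lambda>x. \<Sum>i\<in>I. F i x) \<in> X \<and> N (\<lambda>x. \<Sum>i\<in>I. F i x) \<le> (\<Sum>i\<in>I. N (F i))"
  using assms
proof (induction I rule: finite_induct)
  case empty
  then show ?case by (simp add: X_zero N_zero)
next
  case (insert i I)
  then have "(\<lambda>x. \<Sum>i\<in>I. F i x) \<in> X" "N (\<lambda>x. \<Sum>i\<in>I. F i x) \<le> (\<Sum>i\<in>I. N (F i))" "F i \<in> X" by auto
  then show ?case
    using insert.hyps norm_triangle[of "F i" "\<lambda>x. \<Sum>i\<in>I. F i x"] X_add[of "F i" "\<lambda>x. \<Sum>i\<in>I. F i x"] by simp
qed

lemma X_dominated:
  assumes "circle_periodic f" "f \<in> borel_measurable lebesgue" "g \<in> X" "\<And>x. cmod (f x) \<le> cmod (g x)"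
  shows "f \<in> X" "N f \<le> N g"
  using ideal[of f g] assms by (auto simp: circle_functions_def)

lemma X_norm:
  assumes "f \<in> X"
  shows "(\<lambda>x. of_real (norm (f x))) \<in> X" "N (\<lambda>x. of_real (norm (f x))) \<le> N f"
proof -
  have "(\<lambda>x. complex_of_real (norm (f x))) \<in> borel_measurable lebesgue"
    using X_measurable[OF assms] by measurable
  then show "(\<lambda>x. of_real (norm (f x))) \<in> X" "N (\<lambda>x. of_real (norm (f x))) \<le> N f"
    using X_dominated[of "\<lambda>x. of_real (norm (f x))" f] X_periodic[OF assms] assms by auto
qed

lemma X_one: "(\<lambda>x. 1) \<in> X"
  using indicator[of UNIV] by (simp add: circle_functions_def indicator_def[abs_def])

lemma X_bounded:
  assumes "circle_periodic f" "continuous_on UNIV f" "\<And>x. norm (f x) \<le> B"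
  shows "f \<in> X" "N f \<le> B * N (\<lambda>x. 1)"
proof -
  have B: "0 \<le> B" using assms(3)[of 0] norm_ge_zero order_trans by blast
  have "f \<in> X \<and> N f \<le> N (\<lambda>x. of_real B * 1)"
    using X_dominated[of f "\<lambda>x. of_real B * 1"] X_cmult[OF X_one, of "of_real B"] assms B
      continuous_measurable_lebesgue by auto
  then show "f \<in> X" "N f \<le> B * N (\<lambda>x. 1)" using norm_scale[OF X_one, of "of_real B"] B by auto
qed

lemma X_continuous:
  assumes "circle_periodic f" "continuous_on UNIV f"
  shows "f \<in> X"
  using circle_periodic_bounded[OF assms] X_bounded[OF assms] by metis

lemma X_trig_sum: "trig_sum M c \<in> X"
  by (rule X_continuous[OF trig_sum_periodic continuous_trig_sum])

text \<open>Assumption A in homogeneous form, for a fixed constant.\<close>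

definition steklov_bound :: "real \<Rightarrow> bool" where
  "steklov_bound A \<longleftrightarrow> 0 \<le> A \<and> (\<forall>h>0. \<forall>f\<in>X. steklov h f \<in> X \<and> N (steklov h f) \<le> A * N f)"

text \<open>Homogeneity, by scaling \<open>f\<close>.  A function of norm \<open>0\<close> can be scaled by any factor, which forces its
  averages to have norm \<open>0\<close>.\<close>

lemma assumption_A_imp_steklov_bound:
  assumes "assumption_A X N"
  obtains A where "steklov_bound A"
proof -
  obtain C where C: "\<And>h f. h > 0 \<Longrightarrow> f \<in> X \<Longrightarrow> N f \<le> 1 \<Longrightarrow> N (steklov h f) \<le> C"
    and X: "\<And>h f. f \<in> X \<Longrightarrow> h > 0 \<Longrightarrow> steklov h f \<in> X"
    using assms unfolding assumption_A_def by blast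
  have "0 \<le> N (steklov 1 (\<lambda>x. 0))" by (intro norm_nonneg X X_zero) simp
  also have "\<dots> \<le> C" by (intro C X_zero) (auto simp: N_zero)
  finally have C0: "0 \<le> C" .
  have "N (steklov h f) \<le> C * N f" if h: "h > 0" and f: "f \<in> X" for h f
  proof -
    have scaled: "c * N (steklov h f) \<le> C" if "c * N f \<le> 1" "c \<ge> 0" for c
    proof -
      have "N (\<lambda>x. of_real c * f x) \<le> 1" using norm_scale[OF f, of "of_real c"] that by simp
      then have "N (steklov h (\<lambda>x. of_real c * f x)) \<le> C" by (intro C h X_cmult f)
      then show ?thesis
        using norm_scale[OF X[OF f h], of "of_real c"] that by (simp add: steklov_cmult[OF X_locally_L1[OF f]])
    qed
    show ?thesis
    proof (cases "N f = 0")
      case True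
      have "N (steklov h f) \<le> 0"
      proof (rule ccontr)
        assume "\<not> N (steklov h f) \<le> 0"
        then have "N (steklov h f) > 0" by simp
        then have "(C + 1) / N (steklov h f) * N (steklov h f) \<le> C"
          using True C0 by (intro scaled) auto
        then show False using \<open>N (steklov h f) > 0\<close> by simp
      qed
      then show ?thesis using True by simp
    next
      case False
      then have "N f > 0" using norm_nonneg[OF f] by simp
      then have "1 / N f * N (steklov h f) \<le> C" by (intro scaled) auto
      then show ?thesis using \<open>N f > 0\<close> by (simp add: field_simps)
    qed
  qed
  then show ?thesis using that[of C] C0 X unfolding steklov_bound_def by blast
qed

lemma X_forward_steklov:
  assumes A: "steklov_bound A" and f: "f \<in> X" and h: "h > 0"
  shows "forward_steklov h f \<in> X" "N (forward_steklov h f) \<le> 2 * A * N f"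
proof -
  let ?g = "steklov (2*h) (\<lambda>x. of_real (norm (f x)))"
  have L1: "locally_L1 f" by (rule X_locally_L1[OF f])
  have g: "?g \<in> X" "N ?g \<le> A * N (\<lambda>x. of_real (norm (f x)))"
    using A h X_norm[OF f] unfolding steklov_bound_def by auto
  have A0: "0 \<le> A" using A by (simp add: steklov_bound_def)
  have c: "continuous_on UNIV (forward_steklov h f)" by (rule forward_steklov_continuous[OF L1 h])
  have "forward_steklov h f \<in> X \<and> N (forward_steklov h f) \<le> N (\<lambda>x. 2 * ?g x)"
    using X_dominated[of "forward_steklov h f" "\<lambda>x. 2 * ?g x"] X_cmult[OF g(1), of 2]
      forward_steklov_periodic[OF X_periodic[OF f] L1] continuous_measurable_lebesgue[OF c]
      norm_forward_steklov_le[OF L1 h] by (simp add: norm_mult)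
  moreover have "N (\<lambda>x. 2 * ?g x) = 2 * N ?g" using norm_scale[OF g(1), of 2] by simp
  moreover have "A * N (\<lambda>x. of_real (norm (f x))) \<le> A * N f"
    using A0 X_norm[OF f] by (intro mult_left_mono) auto
  ultimately show "forward_steklov h f \<in> X" "N (forward_steklov h f) \<le> 2 * A * N f"
    using g by auto
qed

text \<open>The pointwise bound by averages, the lattice property and the boundedness of averages; the
  coefficients of the dyadic sum form a geometric series.\<close>

lemma N_fourier_multiplier:
  assumes A: "steklov_bound A" and f: "f \<in> X" and n: "n \<ge> 1"
    and d: "decaying_symbol n C p" and supp: "\<And>k. \<bar>k\<bar> > int M \<Longrightarrow> p k = 0"
  shows "N (fourier_multiplier M p f) \<le> 180 * C * A * N f"
proof -
  have L1: "locally_L1 f" by (rule X_locally_L1[OF f])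
  have A0: "0 \<le> A" using A by (simp add: steklov_bound_def)
  have C: "0 \<le> C" by (rule decaying_symbol_nonneg[OF d])
  obtain J :: nat where J: "pi * real n \<le> 2 ^ J"
    using real_arch_pow[of 2 "pi * real n"] by (auto intro: less_imp_le)
  define g where "g j = steklov (2 * 2 ^ j / real n) (\<lambda>x. of_real (norm (f x)))" for j :: nat
  define c where "c j = 90 * C / 2 ^ j" for j :: nat
  have c0: "c j \<ge> 0" for j using C by (simp add: c_def)
  have g: "g j \<in> X" "N (g j) \<le> A * N f" for j
  proof -
    have "g j \<in> X \<and> N (g j) \<le> A * N (\<lambda>x. of_real (norm (f x)))"
      unfolding g_def using A n X_norm[OF f] unfolding steklov_bound_def by simp
    moreover have "A * N (\<lambda>x. of_real (norm (f x))) \<le> A * N f"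
      using A0 X_norm[OF f] by (intro mult_left_mono) auto
    ultimately show "g j \<in> X" "N (g j) \<le> A * N f" by auto
  qed
  define G where "G j x = of_real (c j) * complex_of_real (norm (g j x))" for j x
  have G: "G j \<in> X" "N (G j) \<le> c j * (A * N f)" for j
  proof -
    have "N (G j) = c j * N (\<lambda>x. complex_of_real (norm (g j x)))"
      unfolding G_def using norm_scale[OF X_norm(1)[OF g(1)], of "of_real (c j)"] c0 by simp
    also have "\<dots> \<le> c j * (A * N f)"
      using X_norm(2)[OF g(1)[of j]] g(2)[of j] c0 by (intro mult_left_mono) auto
    finally show "N (G j) \<le> c j * (A * N f)" .
    show "G j \<in> X" unfolding G_def by (intro X_cmult X_norm g)
  qed
  have GS: "(\<lambda>x. \<Sum>j\<le>J. G j x) \<in> X" "N (\<lambda>x. \<Sum>j\<le>J. G j x) \<le> (\<Sum>j\<le>J. N (G j))"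
    using X_sum[of "{..J}" G] G by auto
  have K: "norm (trig_sum M p z) * (1 + (real n * z)\<^sup>2) \<le> 45 * C * real n" if "\<bar>z\<bar> \<le> pi" for z
    by (rule decaying_symbol_kernel[OF n d supp that])
  have "norm (fourier_multiplier M p f x) \<le> norm (\<Sum>j\<le>J. G j x)" for x
  proof -
    have "norm (fourier_multiplier M p f x)
        \<le> (\<Sum>j\<le>J. 2 * (45 * C) / 2 ^ j * norm (steklov (2 * 2 ^ j / real n) (\<lambda>x. of_real (norm (f x))) x))"
      by (rule fourier_multiplier_pointwise[OF X_periodic[OF f] L1 _ _ K J]) (use n C in auto)
    also have "\<dots> = (\<Sum>j\<le>J. c j * norm (g j x))" by (simp add: c_def g_def)
    also have "\<dots> = Re (\<Sum>j\<le>J. G j x)" by (simp add: G_def)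
    also have "\<dots> \<le> norm (\<Sum>j\<le>J. G j x)" by (rule complex_Re_le_cmod)
    finally show ?thesis .
  qed
  moreover have "circle_periodic (fourier_multiplier M p f)"
    unfolding fourier_multiplier_def by (rule trig_sum_periodic)
  moreover have "fourier_multiplier M p f \<in> borel_measurable lebesgue"
    unfolding fourier_multiplier_def by (rule continuous_measurable_lebesgue[OF continuous_trig_sum])
  ultimately have "N (fourier_multiplier M p f) \<le> N (\<lambda>x. \<Sum>j\<le>J. G j x)"
    using GS(1) X_dominated(2) by blast
  also have "\<dots> \<le> (\<Sum>j\<le>J. c j * (A * N f))" using GS(2) G(2) by (meson order_trans sum_mono)
  also have "\<dots> = 90 * C * (A * N f) * (\<Sum>j\<le>J. (1/2) ^ j)"
    by (simp add: c_def sum_distrib_left power_divide mult_ac)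
  also have "\<dots> \<le> 90 * C * (A * N f) * 2"
  proof (rule mult_left_mono)
    have "(\<Sum>j\<le>J. (1/2) ^ j) = 2 - 2 * (1/2::real) ^ Suc J" by (simp add: sum_gp0)
    then show "(\<Sum>j\<le>J. (1/2) ^ j) \<le> (2::real)" by simp
    show "0 \<le> 90 * C * (A * N f)" using C A0 norm_nonneg[OF f] by simp
  qed
  finally show ?thesis by simp
qed

lemma X_defect: assumes "steklov_bound A" "f \<in> X" "h > 0" shows "defect h f \<in> X"
  unfolding defect_def by (intro X_diff X_forward_steklov(1)[OF assms] assms)

lemma N_defect: assumes "steklov_bound A" "f \<in> X" "h > 0" shows "N (defect h f) \<le> (1 + 2 * A) * N f"
  using N_diff[of f "forward_steklov h f"] X_forward_steklov[OF assms] assms(2)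
  by (simp add: defect_def algebra_simps)

lemma fourier_coeff_fwd: "f \<in> X \<Longrightarrow> h > 0 \<Longrightarrow>
    fourier_coeff (forward_steklov h f) k = exp_average (of_int k * h) * fourier_coeff f k"
  by (intro fourier_coeff_forward_steklov X_periodic X_locally_L1 X_measurable)

lemma fourier_coeff_defect:
  assumes "steklov_bound A" "f \<in> X" "h > 0"
  shows "fourier_coeff (defect h f) k = (1 - exp_average (of_int k * h)) * fourier_coeff f k"
  unfolding defect_def using assms X_forward_steklov[OF assms]
  by (simp add: fourier_coeff_diff X_locally_L1 fourier_coeff_fwd algebra_simps)

lemma fourier_coeff_defect_power:
  assumes "steklov_bound A" "f \<in> X" "h > 0"
  shows "fourier_coeff ((defect h ^^ s) f) k = (1 - exp_average (of_int k * h)) ^ s * fourier_coeff f k \<and> (defect h ^^ s) f \<in> X"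
  by (induction s) (use assms X_defect fourier_coeff_defect in auto)

section \<open>Smooth functions: averaging costs one derivative\<close>

text \<open>Every difference \<open>g x - g t\<close> with \<open>t\<close> in \<open>[x, x + h]\<close> is at most the integral of \<open>\<bar>g'\<bar>\<close> over the centred
  window of length \<open>2h\<close>, and this passes to their mean.\<close>

lemma N_defect_le_derivative:
  assumes A: "steklov_bound A" and d: "\<And>x. g differentiable at x" and g: "g \<in> X"
    and g': "(\<lambda>x. vector_derivative g (at x)) \<in> X" and h: "h > 0"
  shows "N (defect h g) \<le> 2 * A * h * N (\<lambda>x. vector_derivative g (at x))"
proof -
  define g1 where "g1 x = vector_derivative g (at x)" for x
  have g1X: "g1 \<in> X" using g' by (simp add: g1_def[abs_def])
  have L1: "locally_L1 g1" by (rule X_locally_L1[OF g1X])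
  have c: "continuous_on UNIV g" by (rule differentiable_continuous_UNIV[OF d])
  have gL1: "locally_L1 g" by (rule X_locally_L1[OF g])
  let ?S = "steklov (2*h) (\<lambda>x. of_real (norm (g1 x)))"
  have SX: "?S \<in> X" "N ?S \<le> A * N (\<lambda>x. of_real (norm (g1 x)))"
    using A h X_norm[OF g1X] unfolding steklov_bound_def by auto
  have pw: "norm (defect h g x) \<le> norm (of_real (2*h) * ?S x)" for x
  proof -
    define I where "I = integral {x - h..x + h} (\<lambda>x. norm (g1 x))"
    have nL1: "locally_L1 (\<lambda>x. norm (g1 x))" by (rule locally_L1_norm[OF L1])
    have diff: "norm (g x - g t) \<le> I" if "t \<in> {x..x+h}" for t
    proof -
      have "(g1 has_integral (g t - g x)) {x..t}"
        using integral_vector_derivative[OF d, of x t] that unfolding g1_def by auto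
      then have "norm (g t - g x) = norm (integral {x..t} g1)" by (simp add: integral_unique)
      also have "\<dots> \<le> integral {x..t} (\<lambda>x. norm (g1 x))"
        by (intro integral_norm_bound_integral locally_L1_integrable L1 nL1) auto
      also have "\<dots> \<le> I" unfolding I_def
        by (rule integral_Icc_mono_nonneg[OF nL1]) (use that h in auto)
      finally show ?thesis by (simp add: norm_minus_commute)
    qed
    have gi: "g integrable_on {x..x+h}" by (rule locally_L1_integrable[OF gL1])
    have "integral {x..x+h} (\<lambda>t. g x - g t) = h *\<^sub>R g x - integral {x..x+h} g"
      using h by (subst Henstock_Kurzweil_Integration.integral_diff) (auto simp: gi)
    then have "defect h g x = (1/h) *\<^sub>R integral {x..x+h} (\<lambda>t. g x - g t)"
      using h by (simp add: defect_def forward_steklov_eq_integral[OF gL1] scaleR_diff_right)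
    then have "norm (defect h g x) = (1/h) * norm (integral {x..x+h} (\<lambda>t. g x - g t))" using h by simp
    also have "\<dots> \<le> (1/h) * (I * (x + h - x))"
    proof (intro mult_left_mono integral_bound)
      show "continuous_on {x..x+h} (\<lambda>t. g x - g t)"
        using c by (intro continuous_intros) (auto intro: continuous_on_subset)
    qed (use h diff in auto)
    also have "\<dots> = I" using h by simp
    also have "I = norm (of_real (2*h) * ?S x)"
      using h by (simp add: norm_mult steklov_norm_eq[OF L1] I_def)
    finally show ?thesis .
  qed
  have "N (defect h g) \<le> N (\<lambda>x. of_real (2*h) * ?S x)"
    using X_dominated(2)[OF X_periodic[OF X_defect[OF A g h]] X_measurable[OF X_defect[OF A g h]] X_cmult[OF SX(1), of "of_real (2*h)"] pw] .
  also have "\<dots> = 2 * h * N ?S" using norm_scale[OF SX(1), of "of_real (2*h)"] h by simp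
  also have "\<dots> \<le> 2 * h * (A * N g1)"
  proof (rule mult_left_mono)
    have "0 \<le> A" using A by (simp add: steklov_bound_def)
    then show "N ?S \<le> A * N g1" using SX(2) mult_left_mono[OF X_norm(2)[OF g1X], of A] by linarith
  qed (use h in simp)
  finally show ?thesis by (simp add: g1_def[abs_def] mult_ac)
qed

definition smooth_in_X :: "(real \<Rightarrow> complex) \<Rightarrow> bool" where
  "smooth_in_X g \<longleftrightarrow> (\<forall>k. (\<forall>x. nth_derivative k g differentiable at x) \<and> nth_derivative k g \<in> X)"

lemma nth_derivative_defect:
  assumes "smooth_in_X g" and h: "h > 0"
  shows "nth_derivative k (defect h g) = defect h (nth_derivative k g)"
proof (induction k)
  case 0 then show ?case by (simp add: nth_derivative_def)
next
  case (Suc k)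
  have d: "\<And>x. nth_derivative k g differentiable at x" and X: "nth_derivative (Suc k) g \<in> X"
    using assms(1) unfolding smooth_in_X_def by blast+
  have "vector_derivative (defect h (nth_derivative k g)) (at x) = defect h (nth_derivative (Suc k) g) x" for x
    using defect_has_vector_derivative[OF d X_locally_L1[OF X[unfolded nth_derivative_Suc]] h, of x]
    unfolding nth_derivative_Suc by (rule vector_derivative_at)
  then show ?case unfolding nth_derivative_Suc[of k "defect h g"] Suc by blast
qed

lemma smooth_in_X_defect:
  assumes A: "steklov_bound A" and g: "smooth_in_X g" and h: "h > 0"
  shows "smooth_in_X (defect h g)"
  unfolding smooth_in_X_def nth_derivative_defect[OF g h]
proof (intro allI conjI)
  fix k x
  have d: "\<And>x. nth_derivative k g differentiable at x" and X: "nth_derivative k g \<in> X" "nth_derivative (Suc k) g \<in> X"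
    using g unfolding smooth_in_X_def by blast+
  show "defect h (nth_derivative k g) differentiable at x"
    using defect_has_vector_derivative[OF d X_locally_L1[OF X(2)[unfolded nth_derivative_Suc]] h, of x]
    by (rule differentiableI_vector)
  show "defect h (nth_derivative k g) \<in> X" by (rule X_defect[OF A X(1) h])
qed

text \<open>One factor \<open>h\<close> per power: the defect commutes with differentiation, so the previous estimate can be
  applied \<open>s\<close> times.\<close>

lemma N_defect_power_le_derivative:
  assumes A: "steklov_bound A" and h: "h > 0" and "smooth_in_X g"
  shows "N ((defect h ^^ s) g) \<le> (2 * A * h) ^ s * N (nth_derivative s g)"
  using assms(3)
proof (induction s arbitrary: g)
  case 0 then show ?case by (simp add: nth_derivative_def)
next
  case (Suc s)
  have A0: "0 \<le> A" using A by (simp add: steklov_bound_def)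
  have d: "\<And>x. nth_derivative s g differentiable at x" and X: "nth_derivative s g \<in> X" "nth_derivative (Suc s) g \<in> X"
    using Suc.prems unfolding smooth_in_X_def by blast+
  have "N ((defect h ^^ Suc s) g) = N ((defect h ^^ s) (defect h g))" by (simp only: funpow_Suc_right o_apply)
  also have "\<dots> \<le> (2 * A * h) ^ s * N (nth_derivative s (defect h g))"
    by (rule Suc.IH[OF smooth_in_X_defect[OF A Suc.prems h]])
  also have "nth_derivative s (defect h g) = defect h (nth_derivative s g)" by (rule nth_derivative_defect[OF Suc.prems h])
  also have "(2 * A * h) ^ s * N (defect h (nth_derivative s g)) \<le> (2 * A * h) ^ s * (2 * A * h * N (nth_derivative (Suc s) g))"
    using N_defect_le_derivative[OF A d X(1) X(2)[unfolded nth_derivative_Suc] h] A0 h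
    unfolding nth_derivative_Suc by (intro mult_left_mono) auto
  finally show ?case by (simp add: mult_ac)
qed

lemma N_defect_power:
  assumes A: "steklov_bound A" and h: "h > 0" and f: "f \<in> X"
  shows "N ((defect h ^^ s) f) \<le> (1 + 2 * A) ^ s * N f"
proof (induction s)
  case (Suc s)
  have A0: "0 \<le> A" using A by (simp add: steklov_bound_def)
  have "N ((defect h ^^ Suc s) f) \<le> (1 + 2 * A) * N ((defect h ^^ s) f)"
    using N_defect[OF A _ h] fourier_coeff_defect_power[OF A f h] by simp
  also have "\<dots> \<le> (1 + 2 * A) * ((1 + 2 * A) ^ s * N f)" using Suc A0 by (intro mult_left_mono) auto
  finally show ?case by (simp add: mult_ac)
qed simp

lemma defect_power_diff:
  assumes A: "steklov_bound A" and h: "h > 0" and f: "f \<in> X" and g: "g \<in> X"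
  shows "(defect h ^^ s) (\<lambda>x. f x - g x) = (\<lambda>x. (defect h ^^ s) f x - (defect h ^^ s) g x)"
proof (induction s)
  case (Suc s)
  have "locally_L1 ((defect h ^^ s) f)" "locally_L1 ((defect h ^^ s) g)"
    using X_locally_L1 fourier_coeff_defect_power[OF A _ h] f g by auto
  then have "defect h (\<lambda>x. (defect h ^^ s) f x - (defect h ^^ s) g x) = (\<lambda>x. defect h ((defect h ^^ s) f) x - defect h ((defect h ^^ s) g) x)"
    unfolding defect_def by (simp add: forward_steklov_diff fun_eq_iff)
  then show ?case using Suc by simp
qed simp

section \<open>Realization by trigonometric polynomials\<close>

text \<open>A first-order Jackson inequality with the defect in place of a modulus of continuity.\<close>

lemma low_pass_error:
  assumes A: "steklov_bound A" and \<gamma>: "\<gamma> > 0"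
  shows "\<exists>K\<ge>0. \<forall>n\<ge>1. \<forall>u\<in>X. N (\<lambda>x. u x - low_pass n u x) \<le> K * N (defect (\<gamma> / real n) u)"
proof -
  obtain C where C: "\<And>n. n \<ge> 1 \<Longrightarrow> decaying_symbol n C (\<lambda>k. of_real (cutoff (of_int k / real n)))"
    using decaying_symbol_low_pass by blast
  obtain E where E: "\<And>n M. n \<ge> 1 \<Longrightarrow> M \<ge> n \<Longrightarrow> \<exists>\<mu>. decaying_symbol n E \<mu> \<and> (\<forall>k. \<bar>k\<bar> > int M \<longrightarrow> \<mu> k = 0) \<and>
    (\<forall>k. \<mu> k * (1 - exp_average (of_int k * (\<gamma> / real n)))
       = (of_real (cutoff (of_int k / real M)) - of_real (cutoff (of_int k / real n))) * (exp_average (of_int k * (\<gamma> / real n)))\<^sup>2)"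
    using decaying_symbol_high_pass[OF \<gamma>] by blast
  have C0: "0 \<le> C" by (rule decaying_symbol_nonneg[OF C[of 1]]) simp
  have E0: "0 \<le> E" using E[of 1 1] decaying_symbol_nonneg by auto
  have A0: "0 \<le> A" using A by (simp add: steklov_bound_def)
  define K where "K = (1 + 180 * C * A) * (1 + 2 * A) + 180 * E * A"
  have "N (\<lambda>x. u x - low_pass n u x) \<le> K * N (defect (\<gamma> / real n) u)" if n: "n \<ge> 1" and u: "u \<in> X" for n u
  proof -
    define h where "h = \<gamma> / real n"
    have h: "h > 0" using \<gamma> n by (simp add: h_def)
    define g where "g = defect h u"
    \<comment> \<open>From \<open>u = g + \<dot>A\<^sub>h u\<close>, used twice: \<open>u = W + F\<close>, where \<open>W\<close> is directly bounded by \<open>g\<close> and \<open>F\<close> is smooth enough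
      to be a uniform limit of its low-pass filtrations.\<close>
    define W where "W x = g x + forward_steklov h g x" for x
    define F1 where "F1 = forward_steklov h u"
    define F where "F = forward_steklov h F1"
    have gX: "g \<in> X" unfolding g_def by (rule X_defect[OF A u h])
    note fg = X_forward_steklov[OF A gX h]
    have WX: "W \<in> X" unfolding W_def by (intro X_add gX fg)
    have F1X: "F1 \<in> X" unfolding F1_def by (rule X_forward_steklov(1)[OF A u h])
    have FX: "F \<in> X" unfolding F_def by (rule X_forward_steklov(1)[OF A F1X h])
    have LX: "low_pass m w \<in> X" for m w unfolding low_pass_def fourier_multiplier_def by (rule X_trig_sum)
    have uWF: "u x - F x = W x" for x
    proof -
      have "forward_steklov h g x = F1 x - F x"
        unfolding g_def defect_def F_def F1_def
        by (rule forward_steklov_diff) (use u F1X X_locally_L1 in \<open>auto simp: F1_def\<close>)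
      then show ?thesis by (simp add: W_def g_def defect_def F1_def)
    qed
    have Wc: "fourier_coeff u k - fourier_coeff F k = fourier_coeff W k" for k
      using fourier_coeff_diff[OF X_locally_L1[OF u] X_locally_L1[OF FX], of k] by (simp add: uWF)
    have split: "u x - low_pass n u x = (W x - low_pass n W x) + (F x - low_pass n F x)" for x
    proof -
      have "low_pass n u x - low_pass n F x = low_pass n W x"
        unfolding low_pass_def fourier_multiplier_def trig_sum_def sum_subtractf[symmetric] Wc[symmetric]
        by (intro sum.cong refl) (simp add: algebra_simps)
      then show ?thesis using uWF[of x] by (simp add: algebra_simps)
    qed
    have "N W \<le> N g + N (forward_steklov h g)" unfolding W_def by (intro norm_triangle gX fg)
    then have NW: "N W \<le> (1 + 2 * A) * N g" using fg(2) by (simp add: algebra_simps)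
    have "N (\<lambda>x. W x - low_pass n W x) \<le> N W + N (low_pass n W)" by (intro N_diff WX LX)
    also have "N (low_pass n W) \<le> 180 * C * A * N W"
      unfolding low_pass_def by (rule N_fourier_multiplier[OF A WX n C[OF n]]) (simp add: cutoff_beyond[OF n])
    finally have "N (\<lambda>x. W x - low_pass n W x) \<le> (1 + 180 * C * A) * N W" by (simp add: algebra_simps)
    also have "\<dots> \<le> (1 + 180 * C * A) * ((1 + 2 * A) * N g)"
      using NW C0 A0 by (intro mult_left_mono) auto
    finally have part1: "N (\<lambda>x. W x - low_pass n W x) \<le> (1 + 180 * C * A) * (1 + 2 * A) * N g" by simp

    have F1c: "continuous_on UNIV F1" unfolding F1_def by (rule forward_steklov_continuous[OF X_locally_L1[OF u] h])
    obtain B where B: "B > 0" "\<And>x. norm (F1 x) \<le> B"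
      using circle_periodic_bounded[OF X_periodic[OF F1X] F1c] by blast
    define L where "L = 2 * B / h"
    have lip: "norm (F x - F y) \<le> L * \<bar>x - y\<bar>" for x y
      unfolding F_def L_def by (rule forward_steklov_lipschitz[OF X_locally_L1[OF F1X] B(2) h])
    have Fc: "continuous_on UNIV F" unfolding F_def by (rule forward_steklov_continuous[OF X_locally_L1[OF F1X] h])
    have Fcoef: "fourier_coeff F k = (exp_average (of_int k * h))\<^sup>2 * fourier_coeff u k" for k
      unfolding F_def fourier_coeff_fwd[OF F1X h] unfolding F1_def fourier_coeff_fwd[OF u h] by (simp add: power2_eq_square)
    have gcoef: "fourier_coeff g k = (1 - exp_average (of_int k * h)) * fourier_coeff u k" for k
      unfolding g_def by (rule fourier_coeff_defect[OF A u h])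
    \<comment> \<open>Truncation at frequency \<open>2\<^sup>i\<close>: the tail is uniformly small, and the band between \<open>n\<close> and \<open>2\<^sup>i\<close> comes
      from \<open>g\<close> with a bound that does not depend on \<open>i\<close>.\<close>
    have est: "N (\<lambda>x. F x - low_pass n F x) \<le> 90 * C * L * (real i + 3) / 2^i * N (\<lambda>x. 1) + 180 * E * A * N g"
      if i: "n \<le> 2^i" for i
    proof -
      have tail: "N (\<lambda>x. F x - low_pass (2^i) F x) \<le> 90 * C * L * (real i + 3) / 2^i * N (\<lambda>x. 1)"
      proof (rule X_bounded(2))
        show "circle_periodic (\<lambda>x. F x - low_pass (2^i) F x)"
          using X_periodic[OF X_diff[OF FX LX]] .
        show "continuous_on UNIV (\<lambda>x. F x - low_pass (2^i) F x)"
          unfolding low_pass_def fourier_multiplier_def by (intro continuous_intros Fc continuous_trig_sum)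
        show "norm (F x - low_pass (2^i) F x) \<le> 90 * C * L * (real i + 3) / 2^i" for x
          unfolding low_pass_def by (rule low_pass_approximates_lipschitz[OF X_periodic[OF FX] lip C])
      qed
      obtain \<mu> where \<mu>: "decaying_symbol n E \<mu>" "\<And>k. \<bar>k\<bar> > int (2^i) \<Longrightarrow> \<mu> k = 0"
        "\<And>k. \<mu> k * (1 - exp_average (of_int k * h))
         = (of_real (cutoff (of_int k / real (2^i))) - of_real (cutoff (of_int k / real n))) * (exp_average (of_int k * h))\<^sup>2"
        using E[OF n i] unfolding h_def by blast
      have wide: "low_pass n F x = (\<Sum>k=-int (2^i)..int (2^i). of_real (cutoff (of_int k / real n)) * fourier_coeff F k * cis (of_int k * x))" for x
        unfolding low_pass_def fourier_multiplier_def
      proof (rule trig_sum_wider[symmetric])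
        have "int n \<le> int (2^i)" using i by linarith
        then show "- int (2^i) \<le> - int n" "int n \<le> int (2^i)" by auto
      qed (simp add: cutoff_beyond[OF n])
      have "low_pass (2^i) F x - low_pass n F x = fourier_multiplier (2^i) \<mu> g x" for x
        unfolding wide unfolding low_pass_def fourier_multiplier_def trig_sum_def sum_subtractf[symmetric]
      proof (intro sum.cong refl)
        fix k
        have "\<mu> k * fourier_coeff g k = (of_real (cutoff (of_int k / real (2^i))) - of_real (cutoff (of_int k / real n)))
            * (exp_average (of_int k * h))\<^sup>2 * fourier_coeff u k"
          by (simp only: gcoef mult.assoc[symmetric] \<mu>(3))
        then show "of_real (cutoff (of_int k / real (2^i))) * fourier_coeff F k * cis (of_int k * x) -
            of_real (cutoff (of_int k / real n)) * fourier_coeff F k * cis (of_int k * x)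
          = \<mu> k * fourier_coeff g k * cis (of_int k * x)"
          unfolding Fcoef by (simp only:) (simp add: algebra_simps)
      qed
      then have "N (\<lambda>x. low_pass (2^i) F x - low_pass n F x) = N (fourier_multiplier (2^i) \<mu> g)" by presburger
      also have "\<dots> \<le> 180 * E * A * N g"
        by (rule N_fourier_multiplier[OF A gX n \<mu>(1,2)])
      finally have "N (\<lambda>x. low_pass (2^i) F x - low_pass n F x) \<le> 180 * E * A * N g" .
      then show ?thesis using tail N_triangle_via[OF FX LX[of "2^i" F] LX[of n F]] by linarith
    qed
    have "(\<lambda>i. 90 * C * L * (real i + 3) / 2^i * N (\<lambda>x. 1) + 180 * E * A * N g) \<longlonglongrightarrow> 90 * C * L * 0 * N (\<lambda>x. 1) + 180 * E * A * N g"
    proof -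
      have "(\<lambda>i. real i / 2^i + 3 / 2^i) \<longlonglongrightarrow> 0 + 0"
        by (intro tendsto_add lim_n_over_pown LIMSEQ_divide_realpow_zero) auto
      then have "(\<lambda>i. (real i + 3) / 2^i) \<longlonglongrightarrow> 0"
        by (simp add: add_divide_distrib)
      then have "(\<lambda>i. 90 * C * L * ((real i + 3) / 2^i) * N (\<lambda>x. 1) + 180 * E * A * N g) \<longlonglongrightarrow> 90 * C * L * 0 * N (\<lambda>x. 1) + 180 * E * A * N g"
        by (intro tendsto_intros)
      then show ?thesis by simp
    qed
    moreover have "\<forall>\<^sub>F i in sequentially. N (\<lambda>x. F x - low_pass n F x) \<le> 90 * C * L * (real i + 3) / 2^i * N (\<lambda>x. 1) + 180 * E * A * N g"
    proof (rule eventually_mono[OF eventually_ge_at_top[of n]])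
      fix i assume "n \<le> i"
      also have "i \<le> 2^i" by (rule less_imp_le[OF less_exp])
      finally show "N (\<lambda>x. F x - low_pass n F x) \<le> 90 * C * L * (real i + 3) / 2^i * N (\<lambda>x. 1) + 180 * E * A * N g" by (rule est)
    qed
    ultimately have part2: "N (\<lambda>x. F x - low_pass n F x) \<le> 180 * E * A * N g"
      using tendsto_lowerbound[of _ _ sequentially] by fastforce
    have "N (\<lambda>x. u x - low_pass n u x) \<le> N (\<lambda>x. W x - low_pass n W x) + N (\<lambda>x. F x - low_pass n F x)"
      unfolding split by (intro norm_triangle X_diff WX FX LX)
    then show ?thesis using part1 part2 by (simp add: K_def g_def h_def algebra_simps)
  qed
  moreover have "K \<ge> 0" using A0 C0 E0 by (simp add: K_def)
  ultimately show ?thesis by blast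
qed

lemma X_low_pass: "low_pass n f \<in> X"
  unfolding low_pass_def fourier_multiplier_def by (rule X_trig_sum)

lemma X_high_pass: "f \<in> X \<Longrightarrow> high_pass n f \<in> X"
  unfolding high_pass_def by (intro X_diff X_low_pass)

lemma X_high_pass_power: "f \<in> X \<Longrightarrow> (high_pass n ^^ s) f \<in> X"
  by (induction s) (auto simp: X_high_pass)

text \<open>Both operators are Fourier multipliers.\<close>

lemma defect_high_pass:
  assumes A: "steklov_bound A" and h: "h > 0" and f: "f \<in> X"
  shows "defect h (high_pass n f) = high_pass n (defect h f)"
proof (rule ext)
  fix x
  have fw: "forward_steklov h (high_pass n f) x = forward_steklov h f x - forward_steklov h (low_pass n f) x"
    unfolding high_pass_def by (rule forward_steklov_diff) (use f X_low_pass X_locally_L1 in auto)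
  have "low_pass n (defect h f) x = low_pass n f x - forward_steklov h (low_pass n f) x"
    unfolding low_pass_def fourier_multiplier_def forward_steklov_trig_sum[OF h] fourier_coeff_defect[OF A f h]
    unfolding trig_sum_def sum_subtractf[symmetric]
    by (intro sum.cong refl) (simp add: algebra_simps)
  then show "defect h (high_pass n f) x = high_pass n (defect h f) x"
    unfolding defect_def fw unfolding high_pass_def by (simp add: defect_def)
qed

lemma defect_high_pass_power:
  assumes "steklov_bound A" "h > 0" "f \<in> X"
  shows "defect h ((high_pass n ^^ s) f) = (high_pass n ^^ s) (defect h f)"
  by (induction s) (use assms defect_high_pass X_high_pass_power in auto)

text \<open>Each filter is exchanged for a defect, which then commutes past the remaining filters.\<close>

lemma high_pass_power_le:
  assumes A: "steklov_bound A" and h: "h > 0" and K: "K \<ge> 0"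
    and le: "\<And>u. u \<in> X \<Longrightarrow> N (high_pass n u) \<le> K * N (defect h u)" and f: "f \<in> X"
  shows "N ((high_pass n ^^ s) f) \<le> K ^ s * N ((defect h ^^ s) f)"
  using f
proof (induction s arbitrary: f)
  case (Suc s)
  have "N ((high_pass n ^^ Suc s) f) \<le> K * N (defect h ((high_pass n ^^ s) f))"
    using le[OF X_high_pass_power[OF Suc.prems]] by simp
  also have "\<dots> = K * N ((high_pass n ^^ s) (defect h f))" by (simp add: defect_high_pass_power[OF A h Suc.prems])
  also have "\<dots> \<le> K * (K ^ s * N ((defect h ^^ s) (defect h f)))"
    using K by (intro mult_left_mono Suc.IH X_defect[OF A Suc.prems h])
  also have "(defect h ^^ s) (defect h f) = (defect h ^^ Suc s) f" by (simp only: funpow_Suc_right o_apply)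
  finally show ?case by (simp add: mult_ac)
qed simp

text \<open>The operator \<open>I - V\<close> multiplies coefficients by \<open>1 - v\<close>.  Hence \<open>f - (I - V)\<^sup>s f\<close> is a trigonometric polynomial with symbol \<open>1 - (1 - v)\<^sup>s\<close>, where \<open>v\<close> is the symbol of the
  filter \<open>V\<close>.\<close>

lemma high_pass_power_eq:
  assumes f: "f \<in> X"
  shows "(high_pass n ^^ s) f = (\<lambda>x. f x - fourier_multiplier n (\<lambda>k. 1 - (1 - of_real (cutoff (of_int k / real n))) ^ s) f x)"
proof (induction s)
  case 0
  then show ?case by (simp add: fourier_multiplier_def trig_sum_def)
next
  case (Suc s)
  define v where "v k = complex_of_real (cutoff (of_int k / real n))" for k :: int
  let ?T = "fourier_multiplier n (\<lambda>k. 1 - (1 - v k) ^ s) f"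
  have IH: "(high_pass n ^^ s) f = (\<lambda>x. f x - ?T x)" using Suc unfolding v_def .
  have "fourier_coeff (\<lambda>x. f x - ?T x) k = (1 - v k) ^ s * fourier_coeff f k" if "\<bar>k\<bar> \<le> int n" for k
  proof -
    have "fourier_coeff (\<lambda>x. f x - ?T x) k = fourier_coeff f k - fourier_coeff ?T k"
      unfolding fourier_multiplier_def by (intro fourier_coeff_diff X_locally_L1 f locally_L1_trig_sum)
    then show ?thesis using that by (simp add: fourier_multiplier_def fourier_coeff_trig_sum algebra_simps)
  qed
  then have "low_pass n (\<lambda>x. f x - ?T x) x = trig_sum n (\<lambda>k. v k * ((1 - v k) ^ s * fourier_coeff f k)) x" for x
    unfolding low_pass_def fourier_multiplier_def trig_sum_def v_def[symmetric]
    by (intro sum.cong refl) auto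
  moreover have "?T x + trig_sum n (\<lambda>k. v k * ((1 - v k) ^ s * fourier_coeff f k)) x
    = fourier_multiplier n (\<lambda>k. 1 - (1 - v k) ^ Suc s) f x" for x
    unfolding fourier_multiplier_def trig_sum_def sum.distrib[symmetric]
    by (intro sum.cong refl) (simp add: algebra_simps)
  ultimately have "high_pass n (\<lambda>x. f x - ?T x) = (\<lambda>x. f x - fourier_multiplier n (\<lambda>k. 1 - (1 - v k) ^ Suc s) f x)"
    unfolding high_pass_def by (simp add: fun_eq_iff algebra_simps)
  then show ?case using IH by (simp add: v_def[symmetric])
qed

text \<open>The polynomial is \<open>T = f - (I - V)\<^sup>s f\<close> with \<open>V\<close> the low-pass filter at frequency \<open>n\<close>; a power of \<open>I - V\<close> is
  needed because one filter step removes only one power of the defect.\<close>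

lemma realization:
  assumes A: "steklov_bound A" and \<gamma>: "\<gamma> > 0"
  shows "\<exists>K\<ge>0. \<exists>L\<ge>0. \<forall>n\<ge>1. \<forall>f\<in>X. \<exists>T\<in>trig_polys n. T \<in> X \<and>
     N (\<lambda>x. f x - T x) \<le> K * N ((defect (\<gamma> / real n) ^^ s) f) \<and>
     N (nth_derivative s T) \<le> L * real n ^ s * N ((defect (\<gamma> / real n) ^^ s) f)"
proof -
  obtain K where K: "K \<ge> 0" "\<And>n u. n \<ge> 1 \<Longrightarrow> u \<in> X \<Longrightarrow> N (high_pass n u) \<le> K * N (defect (\<gamma> / real n) u)"
    using low_pass_error[OF A \<gamma>] unfolding high_pass_def by blast
  obtain C where C: "\<And>n. n \<ge> 1 \<Longrightarrow> \<exists>\<mu>. decaying_symbol n C \<mu> \<and> (\<forall>k. \<bar>k\<bar> > int n \<longrightarrow> \<mu> k = 0) \<and>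
    (\<forall>k. \<mu> k * (1 - exp_average (of_int k * (\<gamma> / real n))) ^ s
       = (\<i> * of_int k / of_nat n) ^ s * (1 - (1 - of_real (cutoff (of_int k / real n))) ^ s))"
    using decaying_symbol_derivative[OF \<gamma>] by blast
  have C0: "0 \<le> C" using C[of 1] decaying_symbol_nonneg by auto
  have A0: "0 \<le> A" using A by (simp add: steklov_bound_def)
  have "\<exists>T\<in>trig_polys n. T \<in> X \<and>
     N (\<lambda>x. f x - T x) \<le> K ^ s * N ((defect (\<gamma> / real n) ^^ s) f) \<and>
     N (nth_derivative s T) \<le> (180 * C * A) * real n ^ s * N ((defect (\<gamma> / real n) ^^ s) f)"
    if n: "n \<ge> 1" and f: "f \<in> X" for n f
  proof -
    define h where "h = \<gamma> / real n"
    have h: "h > 0" using \<gamma> n by (simp add: h_def)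
    define \<omega> where "\<omega> k = 1 - (1 - complex_of_real (cutoff (of_int k / real n))) ^ s" for k :: int
    define T where "T = fourier_multiplier n \<omega> f"
    define g where "g = (defect h ^^ s) f"
    have g: "g \<in> X" "\<And>k. fourier_coeff g k = (1 - exp_average (of_int k * h)) ^ s * fourier_coeff f k"
      unfolding g_def using fourier_coeff_defect_power[OF A f h] by auto
    obtain \<mu> where \<mu>: "decaying_symbol n C \<mu>" "\<And>k. \<bar>k\<bar> > int n \<Longrightarrow> \<mu> k = 0"
      "\<And>k. \<mu> k * (1 - exp_average (of_int k * h)) ^ s = (\<i> * of_int k / of_nat n) ^ s * \<omega> k"
      using C[OF n] unfolding h_def \<omega>_def by blast
    have "(\<lambda>x. f x - T x) = (high_pass n ^^ s) f"
      unfolding high_pass_power_eq[OF f] T_def \<omega>_def ..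
    then have 1: "N (\<lambda>x. f x - T x) \<le> K ^ s * N g"
      unfolding g_def using high_pass_power_le[OF A h K(1) _ f, of n s] K(2)[OF n] by (simp add: h_def)
    have "nth_derivative s T = (\<lambda>x. of_nat n ^ s * fourier_multiplier n \<mu> g x)"
    proof (rule ext)
      fix x
      have "(\<i> * of_int k) ^ s * (\<omega> k * fourier_coeff f k) = of_nat n ^ s * (\<mu> k * fourier_coeff g k)" for k
      proof -
        have "of_nat n ^ s * (\<mu> k * fourier_coeff g k) = of_nat n ^ s * (\<mu> k * (1 - exp_average (of_int k * h)) ^ s) * fourier_coeff f k"
          by (simp add: g(2))
        also have "\<dots> = (of_nat n * (\<i> * of_int k / of_nat n)) ^ s * \<omega> k * fourier_coeff f k"
          unfolding \<mu>(3) power_mult_distrib by (simp add: mult_ac)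
        also have "of_nat n * (\<i> * of_int k / of_nat n) = \<i> * of_int k" using n by simp
        finally show ?thesis by (simp add: mult_ac)
      qed
      then show "nth_derivative s T x = of_nat n ^ s * fourier_multiplier n \<mu> g x"
        unfolding T_def fourier_multiplier_def nth_derivative_trig_sum
        by (simp add: trig_sum_def sum_distrib_left mult.assoc)
    qed
    then have "N (nth_derivative s T) = real n ^ s * N (fourier_multiplier n \<mu> g)"
      using norm_scale[of "fourier_multiplier n \<mu> g" "of_nat n ^ s"] X_trig_sum
      by (simp add: fourier_multiplier_def norm_power)
    also have "\<dots> \<le> real n ^ s * (180 * C * A * N g)"
      using N_fourier_multiplier[OF A g(1) n \<mu>(1,2)] by (intro mult_left_mono) auto
    finally have 2: "N (nth_derivative s T) \<le> (180 * C * A) * real n ^ s * N g" by (simp add: mult_ac)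
    have "T \<in> trig_polys n" "T \<in> X"
      unfolding T_def fourier_multiplier_def by (rule trig_sum_in_trig_polys, rule X_trig_sum)
    then show ?thesis using 1 2 unfolding g_def h_def by blast
  qed
  moreover have "0 \<le> K ^ s" "0 \<le> 180 * C * A" using K A0 C0 by auto
  ultimately show ?thesis by blast
qed

section \<open>Kantorovich operators\<close>

lemma iterated_steklov_diff:
  assumes A: "steklov_bound A" and h: "h > 0" and f: "f \<in> X" and g: "g \<in> X"
  shows "iterated_steklov h r (\<lambda>x. f x - g x) x = iterated_steklov h r f x - iterated_steklov h r g x"
proof -
  have X: "(steklov h ^^ k) u \<in> X" if "u \<in> X" for k u
    by (induction k) (use A h that in \<open>auto simp: steklov_bound_def\<close>)
  have "(steklov h ^^ k) (\<lambda>x. f x - g x) = (\<lambda>x. (steklov h ^^ k) f x - (steklov h ^^ k) g x)" for k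
    by (induction k) (use X f g X_locally_L1 in \<open>auto simp: steklov_diff\<close>)
  then show ?thesis
    unfolding iterated_steklov_def by (simp only: sum_subtractf right_diff_distrib)
qed

lemma kantorovich_diff:
  assumes "steklov_bound A" "\<gamma> > 0" "n \<ge> 1" "f \<in> X" "g \<in> X"
  shows "kantorovich \<gamma> m x \<phi> n r (\<lambda>t. f t - g t) = (\<lambda>t. kantorovich \<gamma> m x \<phi> n r f t - kantorovich \<gamma> m x \<phi> n r g t)"
proof -
  have "\<gamma> / real n > 0" using assms by simp
  from iterated_steklov_diff[OF assms(1) this assms(4,5)]
  show ?thesis unfolding kantorovich_def by (simp add: sum_subtractf left_diff_distrib)
qed

end

lemma linear_subspace_sum:
  assumes V: "linear_subspace V" and F: "\<And>i. i \<in> I \<Longrightarrow> F i \<in> V"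
  shows "(\<lambda>x. \<Sum>i\<in>I. c i * F i x) \<in> V"
  using F
proof (induction I rule: infinite_finite_induct)
  case (insert i I)
  have "(\<lambda>x. c i * F i x) \<in> V" using V insert.prems by (auto simp: linear_subspace_def)
  moreover have "(\<lambda>x. \<Sum>i\<in>I. c i * F i x) \<in> V" using insert by auto
  ultimately show ?case using V insert.hyps by (simp add: linear_subspace_def)
qed (use V in \<open>auto simp: linear_subspace_def\<close>)

theorem theorem3p3:
  fixes X :: "(real \<Rightarrow> complex) set"
    and N :: "(real \<Rightarrow> complex) \<Rightarrow> real"
    and \<Phi> :: "nat \<Rightarrow> (real \<Rightarrow> complex) set"
    and \<phi> :: "nat \<Rightarrow> nat \<Rightarrow> real \<Rightarrow> complex"
    and x :: "nat \<Rightarrow> nat \<Rightarrow> real"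
    and m :: "nat \<Rightarrow> nat"
    and \<gamma> \<gamma>' C1 C2 C3 :: real
    and r s :: nat
  assumes "banach_lattice_on_circle X N"
    and "assumption_A X N"
    and "bernstein_family X N \<Phi>"
    and "\<gamma> > 0" and "\<gamma>' > 0"
    and "node_system \<gamma> \<gamma>' m x"
    and "\<And>n k. n \<ge> 1 \<Longrightarrow> k \<in> {1..m n} \<Longrightarrow> \<phi> n k \<in> \<Phi> n"
    and "r \<ge> 1" and "s \<ge> 1"
    and "C1 > 0" and "C2 > 0" and "C3 > 0"
    and "\<And>f n. f \<in> X \<Longrightarrow> n \<ge> 1 \<Longrightarrow> N (kantorovich \<gamma> m x \<phi> n r f) \<le> C1 * N f"
    and "\<And>T n. n \<ge> 1 \<Longrightarrow> T \<in> trig_polys n \<Longrightarrow>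
           N (\<lambda>t. T t - kantorovich \<gamma> m x \<phi> n r T t) \<le> C2 / real n ^ s * N (nth_derivative s T)"
    and "\<And>\<psi> n. n \<ge> 1 \<Longrightarrow> \<psi> \<in> \<Phi> n \<Longrightarrow>
           C3 / real n ^ s * N (nth_derivative s \<psi>) \<le> N (\<lambda>t. \<psi> t - kantorovich \<gamma> m x \<phi> n r \<psi> t)"
  shows "\<exists>c>0. \<exists>C>0. \<forall>f\<in>X. \<forall>n\<ge>1.
           c * N (steklov_difference (\<gamma> / real n) s f) \<le> N (\<lambda>t. f t - kantorovich \<gamma> m x \<phi> n r f t) \<and>
           N (\<lambda>t. f t - kantorovich \<gamma> m x \<phi> n r f t) \<le> C * N (steklov_difference (\<gamma> / real n) s f)"
proof -
  interpret banach_lattice_on_circle X N by fact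
  obtain A where A: "steklov_bound A" using assumption_A_imp_steklov_bound[OF assms(2)] .
  have A0: "0 \<le> A" using A by (simp add: steklov_bound_def)
  define K where "K n f = kantorovich \<gamma> m x \<phi> n r f" for n f
  have \<Phi>: "\<Phi> n \<subseteq> X" "linear_subspace (\<Phi> n)" for n
    using assms(3) unfolding bernstein_family_def by blast+
  have smooth: "smooth_in_X \<psi>" if "\<psi> \<in> \<Phi> n" for n \<psi>
    using assms(3) that unfolding bernstein_family_def smooth_in_X_def by blast
  have K\<Phi>: "K n f \<in> \<Phi> n" if "n \<ge> 1" for n f
    unfolding K_def kantorovich_def by (intro linear_subspace_sum \<Phi> assms(7) that)
  have KX: "K n f \<in> X" if "n \<ge> 1" for n f using K\<Phi>[OF that] \<Phi>(1) by blast
  have Kdiff: "K n (\<lambda>t. f t - g t) = (\<lambda>t. K n f t - K n g t)" if "n \<ge> 1" "f \<in> X" "g \<in> X" for n f g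
    unfolding K_def by (rule kantorovich_diff[OF A assms(4) that])
  have Kbound: "N (K n f) \<le> C1 * N f" if "f \<in> X" "n \<ge> 1" for n f
    unfolding K_def by (rule assms(13)[OF that])
  obtain P L where P: "P \<ge> 0" and L: "L \<ge> 0" and real: "\<And>n f. n \<ge> 1 \<Longrightarrow> f \<in> X \<Longrightarrow> \<exists>T\<in>trig_polys n. T \<in> X \<and>
     N (\<lambda>x. f x - T x) \<le> P * N ((defect (\<gamma> / real n) ^^ s) f) \<and>
     N (nth_derivative s T) \<le> L * real n ^ s * N ((defect (\<gamma> / real n) ^^ s) f)"
    using realization[OF A assms(4), of s] by blast
  define Cu where "Cu = (1 + C1) * P + C2 * L + 1"
  define Cl where "Cl = (1 + 2 * A) ^ s + (2 * A * \<gamma>) ^ s / C3 * C1 + 1"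
  have Cu: "Cu > 0" using P L assms(10-12) by (auto simp: Cu_def intro!: add_nonneg_pos)
  have Cl: "Cl > 0" using A0 assms(4,10-12) by (auto simp: Cl_def intro!: add_nonneg_pos)
  have upper: "N (\<lambda>t. f t - K n f t) \<le> Cu * N ((defect (\<gamma> / real n) ^^ s) f)" if f: "f \<in> X" and n: "n \<ge> 1" for f n
  proof -
    define w where "w = N ((defect (\<gamma> / real n) ^^ s) f)"
    have h: "\<gamma> / real n > 0" using assms(4) n by simp
    have w: "0 \<le> w" unfolding w_def using fourier_coeff_defect_power[OF A f h] norm_nonneg by blast
    obtain T where T: "T \<in> trig_polys n" "T \<in> X" "N (\<lambda>x. f x - T x) \<le> P * w"
      "N (nth_derivative s T) \<le> L * real n ^ s * w"
      using real[OF n f] unfolding w_def by blast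
    have "N (\<lambda>t. f t - K n f t) \<le> N (\<lambda>t. f t - T t) + N (\<lambda>t. T t - K n f t)"
      by (rule N_triangle_via[OF f T(2) KX[OF n]])
    also have "N (\<lambda>t. T t - K n f t) \<le> N (\<lambda>t. T t - K n T t) + N (\<lambda>t. K n T t - K n f t)"
      by (rule N_triangle_via[OF T(2) KX[OF n] KX[OF n]])
    also have "N (\<lambda>t. K n T t - K n f t) \<le> C1 * N (\<lambda>t. f t - T t)"
      using Kbound[OF X_diff[OF T(2) f] n] Kdiff[OF n T(2) f] N_minus_commute[OF T(2) f] by simp
    also have "N (\<lambda>t. T t - K n T t) \<le> C2 * L * w"
    proof -
      have "N (\<lambda>t. T t - K n T t) \<le> C2 / real n ^ s * N (nth_derivative s T)"
        unfolding K_def by (rule assms(14)[OF n T(1)])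
      also have "\<dots> \<le> C2 / real n ^ s * (L * real n ^ s * w)"
        using T(4) assms(11) by (intro mult_left_mono) auto
      finally show ?thesis using n by simp
    qed
    finally have "N (\<lambda>t. f t - K n f t) \<le> (1 + C1) * N (\<lambda>t. f t - T t) + C2 * L * w"
      by (simp add: algebra_simps)
    also have "\<dots> \<le> (1 + C1) * (P * w) + C2 * L * w"
      using mult_left_mono[OF T(3), of "1 + C1"] assms(10) by simp
    also have "\<dots> \<le> Cu * w" using w by (simp add: Cu_def algebra_simps)
    finally show ?thesis by (simp add: w_def)
  qed
  have lower: "N ((defect (\<gamma> / real n) ^^ s) f) \<le> Cl * N (\<lambda>t. f t - K n f t)" if f: "f \<in> X" and n: "n \<ge> 1" for f n
  proof -
    define h where "h = \<gamma> / real n"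
    have h: "h > 0" using assms(4) n by (simp add: h_def)
    define e where "e t = f t - K n f t" for t
    have e: "e \<in> X" unfolding e_def by (intro X_diff f KX[OF n])
    have DX: "(defect h ^^ s) u \<in> X" if "u \<in> X" for u using fourier_coeff_defect_power[OF A that h] by blast
    have "N ((defect h ^^ s) f) \<le> N ((defect h ^^ s) e) + N ((defect h ^^ s) (K n f))"
      using defect_power_diff[OF A h f KX[OF n], of s f] norm_triangle[OF DX[OF e] DX[OF KX[OF n, of f]]]
      unfolding e_def by simp
    also have "N ((defect h ^^ s) e) \<le> (1 + 2 * A) ^ s * N e" by (rule N_defect_power[OF A h e])
    also have "N ((defect h ^^ s) (K n f)) \<le> (2 * A * \<gamma>) ^ s / C3 * C1 * N e"
    proof -
      have "N ((defect h ^^ s) (K n f)) \<le> (2 * A * h) ^ s * N (nth_derivative s (K n f))"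
        by (rule N_defect_power_le_derivative[OF A h smooth[OF K\<Phi>[OF n]]])
      also have "\<dots> = (2 * A * \<gamma>) ^ s / C3 * (C3 / real n ^ s * N (nth_derivative s (K n f)))"
        using assms(12) by (simp add: h_def power_divide)
      also have "\<dots> \<le> (2 * A * \<gamma>) ^ s / C3 * N (\<lambda>t. K n f t - K n (K n f) t)"
        unfolding K_def
        using assms(15)[OF n K\<Phi>[OF n, of f]] A0 assms(4,12)
        by (intro mult_left_mono) (auto simp: K_def)
      also have "(\<lambda>t. K n f t - K n (K n f) t) = K n e"
        unfolding e_def Kdiff[OF n f KX[OF n]] ..
      also have "(2 * A * \<gamma>) ^ s / C3 * N (K n e) \<le> (2 * A * \<gamma>) ^ s / C3 * (C1 * N e)"
        using Kbound[OF e n] A0 assms(4,12) by (intro mult_left_mono) auto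
      finally show ?thesis by simp
    qed
    finally have "N ((defect h ^^ s) f) \<le> ((1 + 2 * A) ^ s + (2 * A * \<gamma>) ^ s / C3 * C1) * N e"
      by (simp add: algebra_simps)
    also have "\<dots> \<le> Cl * N e" using norm_nonneg[OF e] by (intro mult_right_mono) (auto simp: Cl_def)
    finally show ?thesis by (simp add: h_def e_def[abs_def])
  qed
  have "(1 / Cl) * N (steklov_difference (\<gamma> / real n) s f) \<le> N (\<lambda>t. f t - K n f t) \<and>
     N (\<lambda>t. f t - K n f t) \<le> Cu * N (steklov_difference (\<gamma> / real n) s f)" if "f \<in> X" "n \<ge> 1" for f n
    using upper[OF that] lower[OF that] Cl
    by (simp add: defect_power_eq_steklov_difference pos_divide_le_eq mult.commute)
  then show ?thesis using Cl Cu unfolding K_def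
    by (intro exI[of _ "1 / Cl"] conjI exI[of _ Cu]) auto
qed

end
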